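(* Fix $n\geqslant 3$ and $\delta>0$. There exists an $\varepsilon=\varepsilon(n,\delta)>0$ such that if $g$ is a rotationally symmetric Riemannian metric on the $n$-sphere $\mathbb{S}^n$ satisfying \begin{itemize} \item $\mathrm{Scal}_g\geqslant n(n-1)(1-\varepsilon)^2$, \item $\mathrm{Ric}_g\geqslant 0$, \item $W_g\geqslant\omega_{n-1}(1-\varepsilon)^{n-1}$, \end{itemize} then $\mathrm{d}_{GH}\big((\mathbb{S}^n,g),(\mathbb{S}^n,g_{rd})\big)\leqslant\delta$.
   Context: Notation. $g_{rd}$ denotes the unit round metric on a sphere (of the dimension indicated by context), $\omega_{n-1}$ is the volume of the unit round $(n-1)$-sphere, $\mathrm{Scal}_g$ and $\mathrm{Ric}_g$ are the scalar and Ricci curvatures, and $\mathrm{Vol}_g^{k}$ is the $k$-dimensional volume induced by $g$. $\mathrm{d}_{GH}$ is the Gromov--Hausdorff distance, a Riemannian manifold being viewed as a metric space with the distance function $d_g$ induced by $g$. Rotational symmetry. A (smooth) Riemannian metric $g$ on $\mathbb{S}^n$ is rotationally symmetric if, up to isometry, it has the form $g=ds^2+f(s)^2g_{rd}$ on $[0,D]\times\mathbb{S}^{n-1}$ (with $\{0\}\times\mathbb{S}^{n-1}$ and $\{D\}\times\mathbb{S}^{n-1}$ each collapsed to a point, the poles), where $f:[0,D]\to[0,\infty)$ is smooth, $f>0$ on $(0,D)$, $f(0)=f(D)=0$, $f'(0)=1$, $f'(D)=-1$, and all even-order derivatives of $f$ vanish at $0$ and $D$. Width. The canonical sweepout is the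 family $\{\Sigma_s\}_{s\in[0,D]}$, $\Sigma_s=\{s\}\times\mathbb{S}^{n-1}$ (the set of points at $g$-distance $s$ from the pole $s=0$), with induced metric $f(s)^2g_{rd}$. The width is $W_g:=\max_{s\in[0,D]}\mathrm{Vol}_g^{n-1}(\Sigma_s)=\omega_{n-1}\max_{s\in[0,D]} f(s)^{n-1}$. *)

theory Defs
  imports "HOL-Analysis.Analysis"
begin

subsection \<open>Smooth maps\<close>

primrec Ck_on :: "nat \<Rightarrow> ('a::real_normed_vector \<Rightarrow> 'b::real_normed_vector) \<Rightarrow> 'a set \<Rightarrow> bool" where
  "Ck_on 0 u U \<longleftrightarrow> continuous_on U u"
| "Ck_on (Suc k) u U \<longleftrightarrow> (\<forall>x\<in>U. u differentiable at x) \<and>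
     (\<forall>v. Ck_on k (\<lambda>x. frechet_derivative u (at x) v) U)"

text \<open>Meant for open subsets of Euclidean spaces.\<close>

definition smooth :: "('a::euclidean_space \<Rightarrow> 'b::euclidean_space) \<Rightarrow> 'a set \<Rightarrow> bool" where
  "smooth u U \<longleftrightarrow> open U \<and> (\<forall>k. Ck_on k u U)"

abbreviation usphere :: "'a::euclidean_space set" where
  "usphere \<equiv> sphere 0 1"

definition smooth_on_sphere :: "('a::euclidean_space \<Rightarrow> 'b::euclidean_space) \<Rightarrow> bool" where
  "smooth_on_sphere u \<longleftrightarrow>
     (\<exists>U v. usphere \<subseteq> U \<and> smooth v U \<and> (\<forall>p\<in>usphere. v p = u p))"

subsection \<open>Riemannian metrics on the unit sphere\<close>

text \<open>A field of bilinear forms assigns to a point \<open>p\<close> and two vectors a real number. For a metric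
  on the unit sphere of \<open>'a\<close>, only points of the sphere and vectors tangent to it there matter.\<close>

type_synonym 'a bilinear_field = "'a \<Rightarrow> 'a \<Rightarrow> 'a \<Rightarrow> real"

definition tangent :: "'a::euclidean_space \<Rightarrow> 'a set" where
  "tangent p = {v. p \<bullet> v = 0}"

definition tangent_field :: "('a::euclidean_space \<Rightarrow> 'a) \<Rightarrow> bool" where
  "tangent_field X \<longleftrightarrow> smooth_on_sphere X \<and> (\<forall>p\<in>usphere. X p \<in> tangent p)"

definition riemannian_metric :: "'a::euclidean_space bilinear_field \<Rightarrow> bool" where
  "riemannian_metric g \<longleftrightarrow>
     (\<forall>p\<in>usphere. \<forall>u\<in>tangent p. \<forall>v\<in>tangent p. \<forall>w\<in>tangent p. \<forall>a b.
        g p (a *\<^sub>R u + b *\<^sub>R v) w = a * g p u w + b * g p v w) \<and>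
     (\<forall>p\<in>usphere. \<forall>v\<in>tangent p. \<forall>w\<in>tangent p. g p v w = g p w v) \<and>
     (\<forall>p\<in>usphere. \<forall>v\<in>tangent p. v \<noteq> 0 \<longrightarrow> g p v v > 0) \<and>
     (\<forall>X Y. tangent_field X \<and> tangent_field Y \<longrightarrow> smooth_on_sphere (\<lambda>p. g p (X p) (Y p)))"

definition round_metric :: "'a::euclidean_space bilinear_field" where
  "round_metric p v w = v \<bullet> w"

definition pullback ::
  "('a::real_normed_vector \<Rightarrow> 'b::real_normed_vector) \<Rightarrow> 'b bilinear_field \<Rightarrow> 'a bilinear_field" where
  "pullback \<phi> g x v w =
     g (\<phi> x) (frechet_derivative \<phi> (at x) v) (frechet_derivative \<phi> (at x) w)"

subsection \<open>Distance\<close>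

text \<open>\<^const>\<open>valid_path\<close> allows unbounded derivatives near the finitely many break points, and the
  integral of a non-integrable function is \<open>0\<close>; hence the integrability condition, which
  restricts to curves of finite length.\<close>

definition speed :: "'a::euclidean_space bilinear_field \<Rightarrow> (real \<Rightarrow> 'a) \<Rightarrow> real \<Rightarrow> real" where
  "speed g \<gamma> t = sqrt (g (\<gamma> t) (vector_derivative \<gamma> (at t)) (vector_derivative \<gamma> (at t)))"

definition riem_dist :: "'a::euclidean_space bilinear_field \<Rightarrow> 'a \<Rightarrow> 'a \<Rightarrow> real" where
  "riem_dist g p q =
     Inf {integral {0..1} (speed g \<gamma>) | \<gamma>.
            valid_path \<gamma> \<and> path_image \<gamma> \<subseteq> usphere \<and> pathstart \<gamma> = p \<and> pathfinish \<gamma> = q \<and>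
            speed g \<gamma> integrable_on {0..1}}"

subsection \<open>Curvature of a metric in coordinates\<close>

definition partial :: "'n::finite \<Rightarrow> (real^'n \<Rightarrow> real) \<Rightarrow> real^'n \<Rightarrow> real" where
  "partial i u x = frechet_derivative u (at x) (axis i 1)"

definition coeff :: "(real^'n) bilinear_field \<Rightarrow> real^'n \<Rightarrow> real^'n^'n" where
  "coeff h x = (\<chi> i j. h x (axis i 1) (axis j 1))"

text \<open>\<open>christoffel h k i j\<close> is \<open>\<Gamma>\<^sup>k\<^sub>i\<^sub>j\<close>.\<close>

definition christoffel ::
  "(real^'n) bilinear_field \<Rightarrow> 'n::finite \<Rightarrow> 'n \<Rightarrow> 'n \<Rightarrow> real^'n \<Rightarrow> real" where
  "christoffel h k i j x =
     (\<Sum>l\<in>UNIV. matrix_inv (coeff h x) $ k $ l *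
        (partial i (\<lambda>y. coeff h y $ j $ l) x + partial j (\<lambda>y. coeff h y $ i $ l) x
         - partial l (\<lambda>y. coeff h y $ i $ j) x)) / 2"

text \<open>\<open>curvature h l i j k\<close> is the \<open>l\<close>-th component of
  \<open>\<nabla>\<^sub>i \<nabla>\<^sub>j \<partial>\<^sub>k - \<nabla>\<^sub>j \<nabla>\<^sub>i \<partial>\<^sub>k\<close>.\<close>

definition curvature ::
  "(real^'n) bilinear_field \<Rightarrow> 'n::finite \<Rightarrow> 'n \<Rightarrow> 'n \<Rightarrow> 'n \<Rightarrow> real^'n \<Rightarrow> real" where
  "curvature h l i j k x =
     partial i (christoffel h l j k) x - partial j (christoffel h l i k) x
     + (\<Sum>m\<in>UNIV. christoffel h l i m x * christoffel h m j k x
                 - christoffel h l j m x * christoffel h m i k x)"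

definition ricci :: "(real^'n) bilinear_field \<Rightarrow> real^'n \<Rightarrow> real^'n^'n" where
  "ricci h x = (\<chi> j k. \<Sum>i\<in>UNIV. curvature h i i j k x)"

definition scalar_curvature :: "(real^'n) bilinear_field \<Rightarrow> real^'n \<Rightarrow> real" where
  "scalar_curvature h x =
     (\<Sum>j\<in>UNIV. \<Sum>k\<in>UNIV. matrix_inv (coeff h x) $ j $ k * ricci h x $ j $ k)"

subsection \<open>Curvature bounds on the sphere\<close>

text \<open>We realise \<open>S\<^sup>n\<close> as the unit sphere of \<^typ>\<open>(real^'n) \<times> real\<close> with \<open>n = CARD('n)\<close>.
  A local parametrization is an injective immersion of an open subset of \<open>R\<^sup>n\<close>; as the dimensions
  agree, it is a diffeomorphism onto an open subset of \<open>S\<^sup>n\<close>. Curvature being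
  independent of the coordinates, a bound at all points is a bound in all local parametrizations.\<close>

definition local_param :: "(real^'n) set \<Rightarrow> (real^'n \<Rightarrow> (real^'n) \<times> real) \<Rightarrow> bool" where
  "local_param U \<phi> \<longleftrightarrow> smooth \<phi> U \<and> \<phi> ` U \<subseteq> usphere \<and> inj_on \<phi> U \<and>
     (\<forall>x\<in>U. inj (frechet_derivative \<phi> (at x)))"

definition Ric_nonneg :: "((real^'n) \<times> real) bilinear_field \<Rightarrow> bool" where
  "Ric_nonneg g \<longleftrightarrow>
     (\<forall>U \<phi>. local_param U \<phi> \<longrightarrow> (\<forall>x\<in>U. \<forall>v. v \<bullet> (ricci (pullback \<phi> g) x *v v) \<ge> 0))"

definition Scal_ge :: "((real^'n) \<times> real) bilinear_field \<Rightarrow> real \<Rightarrow> bool" where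
  "Scal_ge g c \<longleftrightarrow>
     (\<forall>U \<phi>. local_param U \<phi> \<longrightarrow> (\<forall>x\<in>U. scalar_curvature (pullback \<phi> g) x \<ge> c))"

subsection \<open>Rotational symmetry\<close>

text \<open>Smoothness up to the end points is expressed by one-sided derivatives;
  \<open>d k\<close> is the \<open>k\<close>-th derivative of \<open>f\<close> on \<open>[0, D]\<close>.\<close>

definition warping_function :: "real \<Rightarrow> (real \<Rightarrow> real) \<Rightarrow> bool" where
  "warping_function D f \<longleftrightarrow>
     D > 0 \<and> f 0 = 0 \<and> f D = 0 \<and> (\<forall>s\<in>{0<..<D}. f s > 0) \<and>
     (\<exists>d :: nat \<Rightarrow> real \<Rightarrow> real.
        (\<forall>s\<in>{0..D}. d 0 s = f s) \<and>
        (\<forall>k. \<forall>s\<in>{0..D}. (d k has_real_derivative d (Suc k) s) (at s within {0..D})) \<and>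
        d 1 0 = 1 \<and> d 1 D = -1 \<and>
        (\<forall>k. even k \<longrightarrow> d k 0 = 0 \<and> d k D = 0))"

text \<open>The quotient map that identifies \<open>[0, D] \<times> S\<^sup>n\<^sup>-\<^sup>1\<close>, with the two ends collapsed to the
  poles \<open>(0, 1)\<close> and \<open>(0, -1)\<close>, with \<open>S\<^sup>n\<close>.\<close>

definition polar :: "real \<Rightarrow> real \<times> (real^'n) \<Rightarrow> (real^'n) \<times> real" where
  "polar D = (\<lambda>(s, \<theta>). (sin (pi * s / D) *\<^sub>R \<theta>, cos (pi * s / D)))"

text \<open>\<open>F\<close> is defined and smooth near the sphere, and restricts to a diffeomorphism of the sphere.\<close>

definition sphere_diffeo :: "('a::euclidean_space \<Rightarrow> 'a) \<Rightarrow> bool" where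
  "sphere_diffeo F \<longleftrightarrow>
     (\<exists>U. usphere \<subseteq> U \<and> smooth F U) \<and> bij_betw F usphere usphere \<and>
     smooth_on_sphere (inv_into usphere F)"

text \<open>Up to the diffeomorphism \<open>F\<close>, the metric \<open>g\<close> is \<open>ds\<^sup>2 + f(s)\<^sup>2 g\<^sub>r\<^sub>d\<close> on
  \<open>[0, D] \<times> S\<^sup>n\<^sup>-\<^sup>1\<close>. Tangent vectors of the product are pairs \<open>(a, v)\<close> with \<open>v\<close> orthogonal
  to \<open>\<theta>\<close>.\<close>

definition rot_symmetric_form ::
  "((real^'n) \<times> real) bilinear_field \<Rightarrow> real \<Rightarrow> (real \<Rightarrow> real) \<Rightarrow>
   ((real^'n) \<times> real \<Rightarrow> (real^'n) \<times> real) \<Rightarrow> bool" where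
  "rot_symmetric_form g D f F \<longleftrightarrow>
     warping_function D f \<and> sphere_diffeo F \<and>
     (\<forall>s\<in>{0<..<D}. \<forall>\<theta>\<in>usphere. \<forall>a b. \<forall>v\<in>tangent \<theta>. \<forall>w\<in>tangent \<theta>.
        pullback (F \<circ> polar D) g (s, \<theta>) (a, v) (b, w) = a * b + (f s)\<^sup>2 * round_metric \<theta> v w)"

subsection \<open>Width\<close>

text \<open>For \<open>S\<^sup>n\<^sup>-\<^sup>1\<close> in \<open>R\<^sup>n\<close>, the integral against the standard surface measure is \<open>n\<close> times the
  integral of the radially constant extension over the unit ball (\<open>sgn x = x / |x|\<close>).\<close>

definition sphere_integral :: "('a::euclidean_space \<Rightarrow> real) \<Rightarrow> real" where
  "sphere_integral u = real DIM('a) * integral (ball 0 1) (\<lambda>x. u (sgn x))"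

text \<open>The Riemannian volume density of \<open>h\<close> on \<open>S\<^sup>n\<^sup>-\<^sup>1\<close> relative to the round one is the square
  root of the determinant of \<open>h\<close> on the tangent space at \<open>\<theta>\<close> in an orthonormal basis. It is computed in
  \<open>R\<^sup>n\<close> by completing \<open>h\<close> with the normal direction \<open>\<theta>\<close> as an orthogonal unit vector.\<close>

definition volume_density :: "(real^'n) bilinear_field \<Rightarrow> real^'n \<Rightarrow> real" where
  "volume_density h \<theta> =
     (let P = (\<lambda>v. v - (v \<bullet> \<theta>) *\<^sub>R \<theta>) in
      sqrt (det (\<chi> i j. h \<theta> (P (axis i 1)) (P (axis j 1)) + \<theta> $ i * \<theta> $ j)))"

definition sphere_volume :: "(real^'n) bilinear_field \<Rightarrow> real" where
  "sphere_volume h = sphere_integral (volume_density h)"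

text \<open>Slices of the canonical sweepout carry the metric induced by \<open>g\<close>.\<close>

definition slice_metric ::
  "((real^'n) \<times> real) bilinear_field \<Rightarrow> real \<Rightarrow>
   ((real^'n) \<times> real \<Rightarrow> (real^'n) \<times> real) \<Rightarrow> real \<Rightarrow> (real^'n) bilinear_field" where
  "slice_metric g D F s = pullback (\<lambda>\<theta>. F (polar D (s, \<theta>))) g"

definition width ::
  "((real^'n) \<times> real) bilinear_field \<Rightarrow> real \<Rightarrow>
   ((real^'n) \<times> real \<Rightarrow> (real^'n) \<times> real) \<Rightarrow> real" where
  "width g D F = (SUP s\<in>{0..D}. sphere_volume (slice_metric g D F s))"

subsection \<open>Gromov--Hausdorff distance\<close>

definition hausdorff_dist :: "('z \<Rightarrow> 'z \<Rightarrow> real) \<Rightarrow> 'z set \<Rightarrow> 'z set \<Rightarrow> real" where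
  "hausdorff_dist d A B =
     Inf {r. r > 0 \<and> (\<forall>a\<in>A. \<exists>b\<in>B. d a b < r) \<and> (\<forall>b\<in>B. \<exists>a\<in>A. d a b < r)}"

definition isometric_embedding ::
  "'a set \<Rightarrow> ('a \<Rightarrow> 'a \<Rightarrow> real) \<Rightarrow> 'z set \<Rightarrow> ('z \<Rightarrow> 'z \<Rightarrow> real) \<Rightarrow> ('a \<Rightarrow> 'z) \<Rightarrow> bool" where
  "isometric_embedding X dX Z d \<phi> \<longleftrightarrow>
     \<phi> ` X \<subseteq> Z \<and> (\<forall>x\<in>X. \<forall>y\<in>X. d (\<phi> x) (\<phi> y) = dX x y)"

text \<open>The ambient metric spaces \<open>Z\<close> range over carriers in \<^typ>\<open>'a + 'b\<close>. This loses nothing: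
  only the union of the images of \<open>X\<close> and \<open>Y\<close> matters, and it injects into the disjoint union.\<close>

definition gh_dist ::
  "'a set \<Rightarrow> ('a \<Rightarrow> 'a \<Rightarrow> real) \<Rightarrow> 'b set \<Rightarrow> ('b \<Rightarrow> 'b \<Rightarrow> real) \<Rightarrow> real" where
  "gh_dist X dX Y dY =
     Inf {hausdorff_dist d (\<phi> ` X) (\<psi> ` Y) | (Z :: ('a + 'b) set) d \<phi> \<psi>.
            Metric_space Z d \<and> isometric_embedding X dX Z d \<phi> \<and> isometric_embedding Y dY Z d \<psi>}"

end

(* Polar coordinates reduce the theorem to the profile f. In a conformally flat chart at a point of
   the sphere, the hypotheses Ric >= 0 and Scal >= n(n-1)c^2, with c = 1 - epsilon, become f'' <= 0
   and (n-2)(1 - f'^2) - 2 f f'' >= n c^2 f^2. Hence f^(n-2) (1 - f'^2 - c^2 f^2) increases from 0 up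
   to the maximum of f, where f' = 0 and, by the width bound, f >= c. So the defect
   1 - f'^2 - c^2 f^2 is nonnegative, and small wherever f is not small, while concavity forces f' to
   be close to 1 where f is small. By comparison with the sine, f' is uniformly close to the cosine,
   so D is close to pi and the quotient f(s) / sin(pi s / D) is uniformly close to 1. Therefore the
   diffeomorphism F is almost an isometry from the round sphere, which bounds the Gromov-Hausdorff
   distance. *)

theory Submission
  imports Defs
begin

section \<open>Calculus of smooth maps\<close>

text \<open>The curvature bounds hold in every local parametrization, so one convenient chart at
  each distance \<open>s\<close> from a pole is enough. In coordinates
  \<open>x = e^t \<theta>\<close> with \<open>ds/dt = f(s)\<close>, the metric
  \<open>ds^2 + f^2 g_rd\<close> becomes \<open>f^2 / |x|^2\<close> times the Euclidean one: the
  coefficient matrix is scalar and the curvature reduces to one radial function.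

  Two things degenerate at the poles. The weight \<open>f^(n-2)\<close> vanishes there, so a small
  weighted defect says nothing about the defect itself where \<open>f\<close> is small; this forces
  a threshold \<open>\<rho>\<close> for \<open>f\<close>, fixed before \<open>c\<close>, and below
  it \<open>f'\<close> is controlled from the threshold point by monotonicity. Also, lengths along
  the slices are compared through \<open>f(s) / sin (pi s / D)\<close>, so the error in
  \<open>f\<close> must be proportional to \<open>s\<close> and not merely small; integrating the
  bound on \<open>f' - cos\<close> from the pole achieves this. Both estimates start at a pole and
  end at the maximum of \<open>f\<close>, hence they are made for one half and applied to the other
  by reflection, after the maximum is shown to be attained at a single critical point.\<close>

lemma Ck_on_cong:
  assumes "open U" "\<And>x. x \<in> U \<Longrightarrow> u x = w x"
  shows "Ck_on k u U \<longleftrightarrow> Ck_on k w U"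
  using assms(2)
proof (induction k arbitrary: u w)
  case 0
  then show ?case by (simp cong: continuous_on_cong)
next
  case (Suc k)
  have d: "u differentiable at x \<longleftrightarrow> w differentiable at x" if "x \<in> U" for x
    using Suc.prems assms(1) that unfolding differentiable_def
    by (metis has_derivative_transform_within_open)
  have fd: "frechet_derivative u (at x) = frechet_derivative w (at x)" if "x \<in> U" for x
  proof -
    have "(u has_derivative L) (at x) \<longleftrightarrow> (w has_derivative L) (at x)" for L
      using Suc.prems assms(1) that by (metis has_derivative_transform_within_open)
    then show ?thesis by (simp add: frechet_derivative_def)
  qed
  have "Ck_on k (\<lambda>x. frechet_derivative u (at x) v) U \<longleftrightarrow> Ck_on k (\<lambda>x. frechet_derivative w (at x) v) U" for v
    using fd by (intro Suc.IH) simp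
  with d show ?case by simp
qed

text \<open>By uniqueness of the derivative an explicit family \<open>u'\<close> may replace the
  choice made by \<open>frechet_derivative\<close>, which need not be unfolded again.\<close>

lemma Ck_on_SucI:
  assumes "open U" "\<And>x. x \<in> U \<Longrightarrow> (u has_derivative u' x) (at x)"
    and "\<And>v. Ck_on k (\<lambda>x. u' x v) U"
  shows "Ck_on (Suc k) u U"
proof -
  have "Ck_on k (\<lambda>x. frechet_derivative u (at x) v) U" for v
    using assms(3)[of v] Ck_on_cong[OF assms(1), of "\<lambda>x. frechet_derivative u (at x) v" "\<lambda>x. u' x v" k]
      frechet_derivative_at[OF assms(2)] by simp
  then show ?thesis using assms(2) by (auto simp: differentiable_def)
qed

lemma Ck_on_SucD: "Ck_on (Suc k) u U \<Longrightarrow> Ck_on k u U"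
proof (induction k arbitrary: u)
  case 0
  then show ?case
    by (simp add: continuous_at_imp_continuous_on differentiable_imp_continuous_within)
next
  case (Suc k)
  then show ?case by (metis Ck_on.simps(2))
qed

lemma Ck_on_has_derivative:
  assumes "Ck_on (Suc k) u U" "x \<in> U"
  shows "(u has_derivative frechet_derivative u (at x)) (at x)"
  using assms by (simp add: frechet_derivative_works[symmetric])

lemma Ck_on_subset: "Ck_on k u U \<Longrightarrow> V \<subseteq> U \<Longrightarrow> Ck_on k u V"
  by (induction k arbitrary: u) (auto intro: continuous_on_subset)

lemma Ck_on_const: "open U \<Longrightarrow> Ck_on k (\<lambda>x. c) U"
proof (induction k arbitrary: c)
  case (Suc k)
  then show ?case by (intro Ck_on_SucI[where u' = "\<lambda>x v. 0"]) auto
qed auto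

lemma Ck_on_linear:
  assumes "open U" "bounded_linear L"
  shows "Ck_on k L U"
proof (cases k)
  case 0
  then show ?thesis using assms linear_continuous_on by auto
next
  case (Suc m)
  show ?thesis unfolding Suc
    using assms by (intro Ck_on_SucI[where u' = "\<lambda>x v. L v"] Ck_on_const bounded_linear_imp_has_derivative)
qed

lemma Ck_on_bounded_linear:
  assumes "open U" "bounded_linear L" "Ck_on k u U"
  shows "Ck_on k (\<lambda>x. L (u x)) U"
  using assms(3)
proof (induction k arbitrary: u)
  case 0
  then show ?case using assms(2) by (simp add: bounded_linear.continuous_on)
next
  case (Suc k)
  show ?case
  proof (rule Ck_on_SucI[where u' = "\<lambda>x v. L (frechet_derivative u (at x) v)"])
    show "open U" by fact
    show "((\<lambda>x. L (u x)) has_derivative (\<lambda>v. L (frechet_derivative u (at x) v))) (at x)" if "x \<in> U" for x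
      using bounded_linear.has_derivative[OF assms(2) Ck_on_has_derivative[OF Suc.prems that]] .
    show "Ck_on k (\<lambda>x. L (frechet_derivative u (at x) v)) U" for v
      using Suc.prems by (intro Suc.IH) auto
  qed
qed

lemma Ck_on_add:
  assumes "open U" "Ck_on k u U" "Ck_on k w U"
  shows "Ck_on k (\<lambda>x. u x + w x) U"
  using assms(2,3)
proof (induction k arbitrary: u w)
  case 0
  then show ?case by (auto intro: continuous_on_add)
next
  case (Suc k)
  show ?case
  proof (rule Ck_on_SucI[where u' = "\<lambda>x v. frechet_derivative u (at x) v + frechet_derivative w (at x) v"])
    show "open U" by fact
    show "((\<lambda>x. u x + w x) has_derivative
        (\<lambda>v. frechet_derivative u (at x) v + frechet_derivative w (at x) v)) (at x)" if "x \<in> U" for x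
      using has_derivative_add[OF Ck_on_has_derivative[OF Suc.prems(1) that] Ck_on_has_derivative[OF Suc.prems(2) that]] .
    show "Ck_on k (\<lambda>x. frechet_derivative u (at x) v + frechet_derivative w (at x) v) U" for v
      using Suc.prems by (intro Suc.IH) auto
  qed
qed

lemma Ck_on_sum:
  assumes "open U" "\<And>i. i \<in> I \<Longrightarrow> Ck_on k (u i) U"
  shows "Ck_on k (\<lambda>x. \<Sum>i\<in>I. u i x) U"
  using assms(2)
proof (induction I rule: infinite_finite_induct)
  case (insert i I)
  then show ?case by (simp add: Ck_on_add[OF assms(1)])
qed (auto intro: Ck_on_const assms(1))

lemma (in bounded_bilinear) Ck_on:
  assumes "open U" "Ck_on k u U" "Ck_on k w U"
  shows "Ck_on k (\<lambda>x. prod (u x) (w x)) U"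
  using assms(2,3)
proof (induction k arbitrary: u w)
  case 0
  then show ?case by (auto intro: continuous_on)
next
  case (Suc k)
  show ?case
  proof (rule Ck_on_SucI[where u' = "\<lambda>x v. prod (u x) (frechet_derivative w (at x) v) + prod (frechet_derivative u (at x) v) (w x)"])
    show "open U" by fact
    show "((\<lambda>x. prod (u x) (w x)) has_derivative
        (\<lambda>v. prod (u x) (frechet_derivative w (at x) v) + prod (frechet_derivative u (at x) v) (w x))) (at x)"
      if "x \<in> U" for x
      using FDERIV[OF Ck_on_has_derivative[OF Suc.prems(1) that] Ck_on_has_derivative[OF Suc.prems(2) that]] .
    show "Ck_on k (\<lambda>x. prod (u x) (frechet_derivative w (at x) v) + prod (frechet_derivative u (at x) v) (w x)) U" for v
      using Suc.prems Ck_on_SucD[OF Suc.prems(1)] Ck_on_SucD[OF Suc.prems(2)]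
      by (intro Ck_on_add assms(1) Suc.IH) auto
  qed
qed

lemmas Ck_on_mult = bounded_bilinear.Ck_on[OF bounded_bilinear_mult]
lemmas Ck_on_scaleR = bounded_bilinear.Ck_on[OF bounded_bilinear_scaleR]
lemmas Ck_on_inner = bounded_bilinear.Ck_on[OF bounded_bilinear_inner]

lemma Ck_on_Pair:
  assumes "open U" "Ck_on k u U" "Ck_on k w U"
  shows "Ck_on k (\<lambda>x. (u x, w x)) U"
proof -
  have "Ck_on k (\<lambda>x. (u x, 0) + (0, w x)) U"
    by (intro Ck_on_add assms(1) Ck_on_bounded_linear[OF assms(1) _ assms(2)]
        Ck_on_bounded_linear[OF assms(1) _ assms(3)] bounded_linear_Pair bounded_linear_ident bounded_linear_zero)
  then show ?thesis by simp
qed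

text \<open>In the chain rule the outer derivative acts on the direction
  \<open>frechet_derivative u (at x) v\<close>, which varies with \<open>x\<close>, while
  \<open>Ck_on\<close> speaks of fixed directions. Expanding this direction in \<open>Basis\<close>
  leaves finitely many fixed directions with scalar coefficients; the induction hypothesis is then
  used for the directional derivatives of \<open>f\<close>.\<close>

lemma Ck_on_compose:
  fixes u :: "'a::real_normed_vector \<Rightarrow> 'b::euclidean_space"
  assumes "open U" "open V" "Ck_on k f V" "Ck_on k u U" "u ` U \<subseteq> V"
  shows "Ck_on k (\<lambda>x. f (u x)) U"
  using assms(3,4)
proof (induction k arbitrary: f)
  case 0
  then show ?case using assms(5) continuous_on_compose2 by fastforce
next
  case (Suc k)
  have df: "(f has_derivative frechet_derivative f (at (u x))) (at (u x))" if "x \<in> U" for x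
    using Ck_on_has_derivative[OF Suc.prems(1)] assms(5) that by blast
  have eq: "frechet_derivative f (at (u x)) z = (\<Sum>b\<in>Basis. (z \<bullet> b) *\<^sub>R frechet_derivative f (at (u x)) b)"
    if "x \<in> U" for x z
  proof -
    interpret linear "frechet_derivative f (at (u x))"
      using df[OF that] by (rule has_derivative_linear)
    have "frechet_derivative f (at (u x)) (\<Sum>b\<in>Basis. (z \<bullet> b) *\<^sub>R b) = (\<Sum>b\<in>Basis. (z \<bullet> b) *\<^sub>R frechet_derivative f (at (u x)) b)"
      by (simp only: sum scale)
    then show ?thesis by (simp add: euclidean_representation)
  qed
  show ?case
  proof (rule Ck_on_SucI[where u' = "\<lambda>x v. \<Sum>b\<in>Basis. (frechet_derivative u (at x) v \<bullet> b) *\<^sub>R frechet_derivative f (at (u x)) b"])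
    show "open U" by fact
    show "((\<lambda>x. f (u x)) has_derivative
        (\<lambda>v. \<Sum>b\<in>Basis. (frechet_derivative u (at x) v \<bullet> b) *\<^sub>R frechet_derivative f (at (u x)) b)) (at x)"
      if "x \<in> U" for x
      using has_derivative_compose[OF Ck_on_has_derivative[OF Suc.prems(2) that] df[OF that]]
      by (simp add: eq[OF that, symmetric])
    show "Ck_on k (\<lambda>x. \<Sum>b\<in>Basis. (frechet_derivative u (at x) v \<bullet> b) *\<^sub>R frechet_derivative f (at (u x)) b) U" for v
      using Suc.prems Ck_on_SucD[OF Suc.prems(2)]
      by (intro Ck_on_sum Ck_on_scaleR Ck_on_inner Ck_on_const assms(1) Suc.IH) auto
  qed
qed

lemma Ck_on_real_SucI:
  assumes "open I" "\<And>t. t \<in> I \<Longrightarrow> (u has_real_derivative u' t) (at t)" "Ck_on k u' I"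
  shows "Ck_on (Suc k) u I"
proof (rule Ck_on_SucI[where u' = "\<lambda>t v. u' t * v"])
  show "(u has_derivative (\<lambda>v. u' x * v)) (at x)" if "x \<in> I" for x
    using assms(2)[OF that] by (simp add: has_field_derivative_def)
  show "Ck_on k (\<lambda>t. u' t * v) I" for v
    by (intro Ck_on_mult Ck_on_const assms)
qed fact

lemma Ck_on_real_derivatives:
  assumes "open I" "\<And>k t. t \<in> I \<Longrightarrow> (d k has_real_derivative d (Suc k) t) (at t)"
  shows "Ck_on m (d k) I"
proof (induction m arbitrary: k)
  case 0
  have "d k differentiable at x within I" if "x \<in> I" for x
    using assms(2)[OF that, of k] by (meson differentiable_at_withinI real_differentiable_def)
  then show ?case
    by (auto intro!: differentiable_imp_continuous_on simp: differentiable_on_def)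
next
  case (Suc m)
  show ?case by (rule Ck_on_real_SucI[OF assms Suc])
qed

lemma Ck_on_sin_cos: "Ck_on k sin (UNIV :: real set) \<and> Ck_on k cos (UNIV :: real set)"
proof (induction k)
  case 0
  then show ?case by (auto intro: continuous_on_sin continuous_on_cos continuous_on_id)
next
  case (Suc k)
  have "Ck_on (Suc k) sin (UNIV :: real set)"
    using Suc by (intro Ck_on_real_SucI[where u' = cos]) (auto intro: DERIV_sin)
  moreover have "Ck_on k (\<lambda>t. - 1 * sin t) (UNIV :: real set)"
    using Suc by (intro Ck_on_mult Ck_on_const) auto
  then have "Ck_on (Suc k) cos (UNIV :: real set)"
    by (intro Ck_on_real_SucI[where u' = "\<lambda>t. - 1 * sin t"]) (auto intro: derivative_eq_intros)
  ultimately show ?case by blast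
qed

lemma Ck_on_exp: "Ck_on k exp (UNIV :: real set)"
  by (rule Ck_on_real_derivatives[where d = "\<lambda>_. exp"]) auto

text \<open>The derivative of \<open>inverse\<close> is \<open>- inverse^2\<close>, so its
  smoothness follows by induction from the product rule, and \<open>ln\<close> is one integration
  away.\<close>

lemma Ck_on_ln: "Ck_on k ln {0::real<..}"
proof -
  have inv: "Ck_on k inverse {0::real<..}" for k
  proof (induction k)
    case 0
    then show ?case by (auto intro!: continuous_intros)
  next
    case (Suc k)
    have "Ck_on k (\<lambda>t. (- 1) * (inverse t * inverse t)) {0::real<..}"
      by (intro Ck_on_mult Ck_on_const Suc) auto
    then show ?case
      by (rule Ck_on_real_SucI[rotated 2]) (auto intro!: derivative_eq_intros)
  qed
  show ?thesis
  proof (cases k)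
    case 0
    then show ?thesis by (auto intro!: continuous_intros)
  next
    case (Suc m)
    show ?thesis unfolding Suc
      by (rule Ck_on_real_SucI[OF _ _ inv]) (auto intro!: derivative_eq_intros simp: field_simps)
  qed
qed

text \<open>Bootstrapping: if \<open>s\<close> is C^k, then so is its own derivative
  \<open>f \<circ> s\<close>.\<close>

lemma Ck_on_autonomous_ode:
  assumes "open I" "open J" "\<And>k. Ck_on k f J" "s ` I \<subseteq> J"
    and "\<And>t. t \<in> I \<Longrightarrow> (s has_real_derivative f (s t)) (at t)"
  shows "Ck_on k s I"
proof (induction k)
  case 0
  have "s differentiable at x within I" if "x \<in> I" for x
    using assms(5)[OF that] by (meson differentiable_at_withinI real_differentiable_def)
  then show ?case
    by (auto intro!: differentiable_imp_continuous_on simp: differentiable_on_def)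
next
  case (Suc k)
  show ?case
    by (rule Ck_on_real_SucI[OF assms(1,5) Ck_on_compose[OF assms(1-3) Suc assms(4)]])
qed

section \<open>Curvature of conformally flat metrics with radial factor\<close>

lemma partial_eq:
  assumes "(u has_derivative u') (at x)"
  shows "partial i u x = u' (axis i 1)"
  using frechet_derivative_at[OF assms] by (simp add: partial_def)

lemma partial_eq_on_open:
  assumes "open U" "x \<in> U" "\<And>y. y \<in> U \<Longrightarrow> u y = w y" "(w has_derivative w') (at x)"
  shows "partial i u x = w' (axis i 1)"
  using assms by (intro partial_eq) (metis has_derivative_transform_within_open)

abbreviation kron :: "'n \<Rightarrow> 'n \<Rightarrow> real" where
  "kron i j \<equiv> (if i = j then 1 else 0)"

lemma matrix_inv_scaleR_mat:
  assumes "c \<noteq> (0::real)"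
  shows "matrix_inv (c *\<^sub>R mat 1 :: real^'n^'n) = (1 / c) *\<^sub>R mat 1"
proof -
  have 1: "(c *\<^sub>R mat 1 :: real^'n^'n) ** ((1 / c) *\<^sub>R mat 1) = mat 1"
    "((1 / c) *\<^sub>R mat 1 :: real^'n^'n) ** (c *\<^sub>R mat 1) = mat 1"
    using assms by (simp_all add: matrix_scalar_ac scalar_matrix_assoc[symmetric])
  then have inv: "invertible (c *\<^sub>R mat 1 :: real^'n^'n)" unfolding invertible_def by blast
  have "matrix_inv (c *\<^sub>R mat 1 :: real^'n^'n) ** (c *\<^sub>R mat 1) = mat 1"
    using someI_ex[OF inv[unfolded invertible_def]] by (simp add: matrix_inv_def)
  then show ?thesis using 1 by (metis matrix_mul_assoc matrix_mul_lid matrix_mul_rid)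
qed

lemma axis_nth_eq: "axis i (1::real) $ j = kron j i"
  by (simp add: axis_def)

text \<open>Write \<open>E = exp (2 * u)\<close>. Then \<open>deriv_E\<close> says that the gradient
  of \<open>u\<close> is \<open>w x\<close> times the vector \<open>x\<close>, and
  \<open>deriv_w\<close> that the Hessian of \<open>u\<close> is \<open>w\<close> times the identity
  plus \<open>w'\<close> times \<open>x x^T\<close>, as for a radial \<open>u\<close>. This form
  keeps logarithms and square roots out of the computation.\<close>

locale conformal_metric =
  fixes h :: "(real^'n) bilinear_field" and U :: "(real^'n) set" and E w w' :: "real^'n \<Rightarrow> real"
  assumes open_U: "open U"
    and coeff_h: "x \<in> U \<Longrightarrow> coeff h x = E x *\<^sub>R mat 1"
    and E_pos: "x \<in> U \<Longrightarrow> E x > 0"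
    and deriv_E: "x \<in> U \<Longrightarrow> (E has_derivative (\<lambda>v. 2 * E x * w x * (x \<bullet> v))) (at x)"
    and deriv_w: "x \<in> U \<Longrightarrow> (w has_derivative (\<lambda>v. w' x * (x \<bullet> v))) (at x)"
begin

lemma partial_coeff:
  assumes "x \<in> U"
  shows "partial i (\<lambda>y. coeff h y $ j $ l) x = 2 * E x * w x * x $ i * kron j l"
  using assms inner_axis[of x i "1::real"]
  by (subst partial_eq_on_open[OF open_U assms, where w = "\<lambda>y. E y * kron j l" and
       w' = "\<lambda>v. (2 * E x * w x * (x \<bullet> v)) * kron j l"])
     (auto simp: coeff_h mat_def intro!: deriv_E has_derivative_mult_left)

lemma christoffel_eq:
  assumes "x \<in> U"
  shows "christoffel h k i j x = w x * (kron j k * x $ i + kron i k * x $ j - kron i j * x $ k)"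
proof -
  have "christoffel h k i j x = (\<Sum>l\<in>UNIV. if k = l then w x * 2 * (kron j l * x $ i + kron i l * x $ j - kron i j * x $ l) else 0) / 2"
    using E_pos[OF assms]
    unfolding christoffel_def partial_coeff[OF assms] coeff_h[OF assms] matrix_inv_scaleR_mat[OF less_imp_neq[OF E_pos[OF assms], symmetric]]
    by (intro arg_cong2[where f = "(/)"] sum.cong) (auto simp: mat_def field_simps)
  then show ?thesis by simp
qed

lemma partial_christoffel:
  assumes "x \<in> U"
  shows "partial l (christoffel h k i j) x =
    w' x * x $ l * (kron j k * x $ i + kron i k * x $ j - kron i j * x $ k)
    + w x * (kron j k * kron i l + kron i k * kron j l - kron i j * kron k l)"
proof -
  have c: "((\<lambda>y::real^'n. y $ m) has_derivative (\<lambda>v. v $ m)) (at x)" for m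
    by (rule bounded_linear_imp_has_derivative) (rule bounded_linear_vec_nth)
  show ?thesis
    using assms inner_axis[of x l "1::real"]
    by (subst partial_eq_on_open[OF open_U assms,
         where w = "\<lambda>y. w y * (kron j k * y $ i + kron i k * y $ j - kron i j * y $ k)" and
         w' = "\<lambda>v. w x * (kron j k * v $ i + kron i k * v $ j - kron i j * v $ k)
           + w' x * (x \<bullet> v) * (kron j k * x $ i + kron i k * x $ j - kron i j * x $ k)"])
      (auto simp: christoffel_eq axis_nth_eq algebra_simps
         intro!: has_derivative_mult deriv_w derivative_eq_intros c)
qed

text \<open>The classical \<open>Ric = - (n - 2) (Hess u - du \<otimes> du) - (\<Delta>u + (n - 2)
  |du|^2) \<delta>\<close> for \<open>exp (2 u)\<close> times the flat metric. The part
  \<open>w \<delta>\<close> of the Hessian joins the Laplacian \<open>n w + w' |x|^2\<close>, whence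
  the coefficient \<open>2 (n - 1)\<close> of \<open>w\<close>.\<close>

lemma ricci_eq:
  assumes "x \<in> U"
  shows "ricci h x $ j $ k =
    - (real CARD('n) - 2) * (w' x - (w x)\<^sup>2) * (x $ j * x $ k)
    - kron j k * (w' x * (x \<bullet> x) + 2 * (real CARD('n) - 1) * w x + (real CARD('n) - 2) * (w x)\<^sup>2 * (x \<bullet> x))"
proof -
  let ?n = "real CARD('n)" and ?d = "kron j k"
  have q: "(\<Sum>i\<in>UNIV. x $ i * x $ i) = x \<bullet> x" by (simp add: inner_vec_def)
  have "(\<Sum>i\<in>UNIV. partial i (christoffel h i j k) x) =
      (\<Sum>i\<in>UNIV. (if i = k then w' x * (x $ j * x $ k) + w x * ?d else 0)
        + (if i = j then w' x * (x $ j * x $ k) + w x * ?d else 0)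
        - w' x * ?d * (x $ i * x $ i) - w x * ?d)"
    unfolding partial_christoffel[OF assms] by (intro sum.cong) (auto simp: algebra_simps)
  also have "\<dots> = w' x * (2 * (x $ j * x $ k) - ?d * (x \<bullet> x)) + w x * (2 - ?n) * ?d"
    by (simp only: sum.distrib sum_subtractf sum_distrib_left[symmetric] q) (simp add: algebra_simps)
  finally have s1: "(\<Sum>i\<in>UNIV. partial i (christoffel h i j k) x) = \<dots>" .
  have s2: "(\<Sum>i\<in>UNIV. partial j (christoffel h i i k) x) = ?n * (w' x * (x $ j * x $ k) + w x * ?d)"
    unfolding partial_christoffel[OF assms]
    by (subst sum.cong[OF refl, where h = "\<lambda>i. w' x * (x $ j * x $ k) + w x * ?d"])
       (auto simp: algebra_simps)
  have "(\<Sum>m\<in>UNIV. christoffel h i i m x * christoffel h m j k x) =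
      (\<Sum>m\<in>UNIV. (if m = k then (w x)\<^sup>2 * (x $ j * x $ k) else 0)
        + (if m = j then (w x)\<^sup>2 * (x $ j * x $ k) else 0) - (w x)\<^sup>2 * ?d * (x $ m * x $ m))" for i
    unfolding christoffel_eq[OF assms] by (intro sum.cong) (auto simp: algebra_simps power2_eq_square)
  also have "\<dots> = (w x)\<^sup>2 * (2 * (x $ j * x $ k) - ?d * (x \<bullet> x))"
    by (simp only: sum.distrib sum_subtractf sum_distrib_left[symmetric] q) (simp add: algebra_simps)
  finally have s3: "(\<Sum>m\<in>UNIV. christoffel h i i m x * christoffel h m j k x) = \<dots>" for i .
  \<comment> \<open>The products are sorted by the Kronecker delta that pins \<open>m\<close> to
    \<open>i\<close>, \<open>k\<close> or \<open>j\<close>, so that these sums collapse; the last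
    summand is the one that sums to a multiple of \<open>|x|^2\<close>.\<close>
  have "(\<Sum>m\<in>UNIV. christoffel h i j m x * christoffel h m i k x) =
      (\<Sum>m\<in>UNIV. (if m = i then (w x)\<^sup>2 * (x $ j * x $ k) + (w x)\<^sup>2 * kron i j * (x $ j * x $ k) else 0)
        + (if m = k then (w x)\<^sup>2 * kron i j * (x $ j * x $ k) else 0)
        - (if m = j then (w x)\<^sup>2 * (?d * (x $ i * x $ i) + kron i j * (x $ j * x $ k) - kron i k * (x $ j * x $ k)) else 0)
        - (w x)\<^sup>2 * (kron i j * kron i k) * (x $ m * x $ m))" for i
    unfolding christoffel_eq[OF assms] by (intro sum.cong) (auto simp: algebra_simps power2_eq_square)
  also have "\<dots> i = (if i = j then (w x)\<^sup>2 * (x $ j * x $ k - ?d * (x \<bullet> x)) else 0)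
      + (if i = k then (w x)\<^sup>2 * (x $ j * x $ k) else 0)
      + (w x)\<^sup>2 * (x $ j * x $ k) - (w x)\<^sup>2 * ?d * (x $ i * x $ i)" for i
    by (simp only: sum.distrib sum_subtractf sum_distrib_left[symmetric] q) (simp add: algebra_simps)
  finally have s4: "(\<Sum>m\<in>UNIV. christoffel h i j m x * christoffel h m i k x) = \<dots> i" for i .
  have s4': "(\<Sum>i\<in>UNIV. \<Sum>m\<in>UNIV. christoffel h i j m x * christoffel h m i k x) =
      (w x)\<^sup>2 * ((?n + 2) * (x $ j * x $ k) - 2 * ?d * (x \<bullet> x))"
    unfolding s4
    by (simp only: sum.distrib sum_subtractf sum_distrib_left[symmetric] q) (simp add: algebra_simps)
  have "ricci h x $ j $ k = (\<Sum>i\<in>UNIV. partial i (christoffel h i j k) x)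
      - (\<Sum>i\<in>UNIV. partial j (christoffel h i i k) x)
      + (\<Sum>i\<in>UNIV. \<Sum>m\<in>UNIV. christoffel h i i m x * christoffel h m j k x)
      - (\<Sum>i\<in>UNIV. \<Sum>m\<in>UNIV. christoffel h i j m x * christoffel h m i k x)"
    by (simp add: ricci_def curvature_def sum.distrib sum_subtractf)
  also have "\<dots> = - (?n - 2) * (w' x - (w x)\<^sup>2) * (x $ j * x $ k)
    - ?d * (w' x * (x \<bullet> x) + 2 * (?n - 1) * w x + (?n - 2) * (w x)\<^sup>2 * (x \<bullet> x))"
    unfolding s1 s2 s3 s4' by (simp add: algebra_simps)
  finally show ?thesis .
qed

lemma scalar_curvature_eq:
  assumes "x \<in> U"
  shows "scalar_curvature h x = - (real CARD('n) - 1) / E x *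
    (2 * (w' x * (x \<bullet> x) + real CARD('n) * w x) + (real CARD('n) - 2) * (w x)\<^sup>2 * (x \<bullet> x))"
proof -
  let ?n = "real CARD('n)"
  have q: "(\<Sum>i\<in>UNIV. x $ i * x $ i) = x \<bullet> x" by (simp add: inner_vec_def)
  have "matrix_inv (coeff h x) $ j $ k = (if k = j then 1 / E x else 0)" for j k
    unfolding coeff_h[OF assms] matrix_inv_scaleR_mat[OF less_imp_neq[OF E_pos[OF assms], symmetric]]
    by (auto simp: mat_def)
  then have "scalar_curvature h x = (\<Sum>j\<in>UNIV. \<Sum>k\<in>UNIV. if k = j then 1 / E x * ricci h x $ j $ k else 0)"
    unfolding scalar_curvature_def by (intro sum.cong) auto
  also have "\<dots> = (\<Sum>j\<in>UNIV. 1 / E x * ricci h x $ j $ j)" by simp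
  also have "\<dots> = (\<Sum>j\<in>UNIV. 1 / E x * (- (?n - 2) * (w' x - (w x)\<^sup>2) * (x $ j * x $ j)
      - (w' x * (x \<bullet> x) + 2 * (?n - 1) * w x + (?n - 2) * (w x)\<^sup>2 * (x \<bullet> x))))"
    by (simp only: ricci_eq[OF assms] refl if_True mult_1)
  also have "\<dots> = 1 / E x * (- (?n - 2) * (w' x - (w x)\<^sup>2) * (x \<bullet> x)
      - ?n * (w' x * (x \<bullet> x) + 2 * (?n - 1) * w x + (?n - 2) * (w x)\<^sup>2 * (x \<bullet> x)))"
    by (simp only: sum_distrib_left[symmetric] sum_subtractf q) simp
  also have "\<dots> = - (?n - 1) / E x *
    (2 * (w' x * (x \<bullet> x) + ?n * w x) + (?n - 2) * (w x)\<^sup>2 * (x \<bullet> x))"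
    using E_pos[OF assms] by (simp add: field_simps)
  finally show ?thesis .
qed

text \<open>The terms with \<open>w^2\<close> cancel in the radial direction. For a warped metric
  what remains is a multiple of \<open>f''\<close>, so this direction isolates the concavity of the
  profile.\<close>

lemma ricci_radial:
  assumes "x \<in> U"
  shows "x \<bullet> (ricci h x *v x) = - (real CARD('n) - 1) * (x \<bullet> x) * (w' x * (x \<bullet> x) + 2 * w x)"
proof -
  let ?n = "real CARD('n)"
  let ?a = "- (?n - 2) * (w' x - (w x)\<^sup>2)"
  let ?b = "w' x * (x \<bullet> x) + 2 * (?n - 1) * w x + (?n - 2) * (w x)\<^sup>2 * (x \<bullet> x)"
  have q: "(\<Sum>i\<in>UNIV. x $ i * x $ i) = x \<bullet> x" by (simp add: inner_vec_def)
  have "(ricci h x *v x) $ j = x $ j * (?a * (x \<bullet> x) - ?b)" for j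
  proof -
    have "(ricci h x *v x) $ j = (\<Sum>k\<in>UNIV. x $ j * ?a * (x $ k * x $ k) - (if k = j then x $ j * ?b else 0))"
      unfolding matrix_vector_mult_def vec_lambda_beta
      by (intro sum.cong) (auto simp: ricci_eq[OF assms] algebra_simps)
    then show ?thesis
      by (simp only: sum_distrib_left[symmetric] sum_subtractf q) (simp add: algebra_simps)
  qed
  then have "ricci h x *v x = (?a * (x \<bullet> x) - ?b) *\<^sub>R x"
    by (simp add: vec_eq_iff)
  then have "x \<bullet> (ricci h x *v x) = (?a * (x \<bullet> x) - ?b) * (x \<bullet> x)" by (simp only: inner_scaleR_right)
  then show ?thesis by (simp only:) (simp add: algebra_simps power2_eq_square)
qed

end

section \<open>Conformal charts of rotationally symmetric metrics\<close>

text \<open>Separation of variables: \<open>T\<close> is the time needed to travel from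
  \<open>a\<close>, and the solution is its inverse function.\<close>

lemma autonomous_ode_solution:
  fixes f :: "real \<Rightarrow> real"
  assumes cont: "continuous_on {l<..<r} f" and pos: "\<And>x. x \<in> {l<..<r} \<Longrightarrow> f x > 0" and s0: "s0 \<in> {l<..<r}"
  obtains s I t0 where "open I" "t0 \<in> I" "s t0 = s0" "s ` I \<subseteq> {l<..<r}" "inj_on s I"
    "\<And>t. t \<in> I \<Longrightarrow> (s has_real_derivative f (s t)) (at t)"
proof -
  \<comment> \<open>The integral stays in a compact subinterval because \<open>1 / f\<close> may
    blow up at \<open>l\<close> and \<open>r\<close>; for a profile it does, at both poles.\<close>
  define a b where "a = (l + s0) / 2" and "b = (s0 + r) / 2"
  have ab: "l < a" "a < s0" "s0 < b" "b < r" using s0 by (auto simp: a_def b_def)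
  then have sub: "{a..b} \<subseteq> {l<..<r}" by auto
  define T where "T x = integral {a..x} (\<lambda>u. 1 / f u)" for x
  have cont1: "continuous_on {a..b} (\<lambda>u. 1 / f u)"
  proof (rule continuous_on_divide[OF continuous_on_const continuous_on_subset[OF cont sub]])
    have "f x > 0" if "x \<in> {a..b}" for x
      by (rule pos, rule subsetD[OF sub that])
    then show "\<forall>x\<in>{a..b}. f x \<noteq> 0" by (simp add: less_imp_neq[symmetric])
  qed
  have dT: "(T has_real_derivative 1 / f x) (at x within {a..b})" if "x \<in> {a..b}" for x
    unfolding T_def using integral_has_real_derivative[OF cont1 that] .
  have contT: "continuous_on {a..b} T"
    by (rule DERIV_continuous_on) (rule dT)
  have dTi: "(T has_real_derivative 1 / f x) (at x)" if "x \<in> {a<..<b}" for x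
    using dT[of x] that at_within_Icc_at[of a x b] by auto
  have mono: "T x < T y" if "a \<le> x" "x < y" "y \<le> b" for x y
  proof (rule DERIV_pos_imp_increasing_open[OF that(2)])
    show "\<exists>d. (T has_real_derivative d) (at z) \<and> d > 0" if "x < z" "z < y" for z
      using dTi[of z] pos[of z] ab that \<open>a \<le> x\<close> \<open>y \<le> b\<close> by (intro exI[of _ "1 / f z"]) auto
    show "continuous_on {x..y} T" using contT that by (auto intro: continuous_on_subset)
  qed
  have inj: "inj_on T {a..b}"
  proof (rule inj_onI)
    fix x y assume "x \<in> {a..b}" "y \<in> {a..b}" "T x = T y"
    then show "x = y" using mono[of x y] mono[of y x] by (cases x y rule: linorder_cases) auto
  qed
  define s where "s = inv_into {a..b} T"
  define I where "I = {T a<..<T b}"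
  have sT: "s (T x) = x" if "x \<in> {a..b}" for x
    using inj that by (simp add: s_def)
  have sI: "s t \<in> {a<..<b}" "T (s t) = t" if t: "t \<in> I" for t
  proof -
    obtain x where x: "a \<le> x" "x \<le> b" "T x = t"
      using IVT'[of T a t b] contT ab t by (auto simp: I_def)
    with t have "x \<noteq> a" "x \<noteq> b" by (auto simp: I_def)
    with x sT[of x] show "s t \<in> {a<..<b}" "T (s t) = t" by auto
  qed
  have conts: "continuous_on (T ` {a..b}) s"
    using continuous_on_inv[OF contT] sT by auto
  have I_sub: "I \<subseteq> T ` {a..b}"
  proof
    fix t assume "t \<in> I"
    with sI[OF this] show "t \<in> T ` {a..b}" by (intro image_eqI[of t T "s t"]) auto
  qed
  have ds: "(s has_real_derivative f (s t)) (at t)" if "t \<in> I" for t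
  proof -
    have "isCont s t"
      using continuous_on_subset[OF conts I_sub] that by (simp add: I_def continuous_on_eq_continuous_at)
    then have "(s has_real_derivative inverse (1 / f (s t))) (at t)"
      using dTi[OF sI(1)[OF that]] pos[of "s t"] ab sI(1)[OF that] that sI(2)
      by (intro DERIV_inverse_function[where f = T and a = "T a" and b = "T b"]) (auto simp: I_def)
    then show ?thesis by simp
  qed
  show ?thesis
  proof (rule that[of I "T s0" s])
    show "T s0 \<in> I" using mono[of a s0] mono[of s0 b] ab by (simp add: I_def)
    show "s (T s0) = s0" using sT[of s0] ab by simp
    show "s ` I \<subseteq> {l<..<r}" using sI(1) ab by force
    show "inj_on s I" using sI(2) by (metis inj_onI)
  qed (use ds in \<open>auto simp: I_def\<close>)
qed

section \<open>The polar map and charts adapted to the profile\<close>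

lemma polar_eq: "polar D p = (sin (pi * fst p / D) *\<^sub>R snd p, cos (pi * fst p / D))"
  by (simp add: polar_def case_prod_beta)

lemma Ck_on_polar: "Ck_on k (polar D) UNIV"
proof -
  have lin: "Ck_on k (\<lambda>p::real \<times> (real^'n). pi * fst p / D) UNIV"
    using bounded_linear_compose[OF bounded_linear_mult_right[of "pi / D"] bounded_linear_fst]
    by (intro Ck_on_linear) auto
  have "Ck_on k (\<lambda>p::real \<times> (real^'n). (sin (pi * fst p / D) *\<^sub>R snd p, cos (pi * fst p / D))) UNIV"
    using Ck_on_sin_cos
    by (intro Ck_on_Pair Ck_on_scaleR Ck_on_linear[OF open_UNIV bounded_linear_snd]
        Ck_on_compose[OF open_UNIV open_UNIV _ lin]) auto
  then show ?thesis by (simp add: polar_eq[abs_def])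
qed

lemma polar_in_usphere: "\<theta> \<in> usphere \<Longrightarrow> polar D (s, \<theta>) \<in> usphere"
  by (simp add: polar_eq norm_Pair power_mult_distrib dist_norm)

lemma polar_inj:
  assumes "polar D (s, \<theta>) = polar D (s', \<theta>')" "s \<in> {0<..<D}" "s' \<in> {0<..<D}" "D > 0"
  shows "s = s' \<and> \<theta> = \<theta>'"
proof -
  have b: "pi * s / D \<in> {0<..<pi}" "pi * s' / D \<in> {0<..<pi}"
    using assms(2-4) by (auto simp: field_simps)
  have "cos (pi * s / D) = cos (pi * s' / D)" using assms(1) by (simp add: polar_eq)
  then have "pi * s / D = pi * s' / D"
    using b cos_inj_pi[of "pi * s / D" "pi * s' / D"] by simp
  then have s: "s = s'" using assms(4) by simp
  have "sin (pi * s / D) > 0" using b by (simp add: sin_gt_zero)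
  then show ?thesis using assms(1) s by (simp add: polar_eq)
qed

lemma riemannian_metric_zero:
  assumes "riemannian_metric g" "p \<in> usphere" "v \<in> tangent p"
  shows "g p 0 v = 0"
proof -
  have "g p (0 *\<^sub>R v + 0 *\<^sub>R v) v = 0 * g p v v + 0 * g p v v"
    using assms unfolding riemannian_metric_def by blast
  then show ?thesis by simp
qed

text \<open>Fixing the witness \<open>d\<close> for the one-sided derivatives lets
  \<open>d 1\<close> and \<open>d 2\<close> serve as \<open>f'\<close> and \<open>f''\<close> up to
  the end points.\<close>

locale warped_sphere =
  fixes g :: "((real^'n) \<times> real) bilinear_field" and D :: real and f :: "real \<Rightarrow> real"
    and F :: "(real^'n) \<times> real \<Rightarrow> (real^'n) \<times> real" and d :: "nat \<Rightarrow> real \<Rightarrow> real"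
  assumes metric: "riemannian_metric g"
    and form: "rot_symmetric_form g D f F"
    and d_0: "s \<in> {0..D} \<Longrightarrow> d 0 s = f s"
    and deriv_d_within: "s \<in> {0..D} \<Longrightarrow> (d k has_real_derivative d (Suc k) s) (at s within {0..D})"
    and d_start: "d 1 0 = 1" and d_end: "d 1 D = -1"
begin

lemma D_pos: "D > 0" and f_0: "f 0 = 0" and f_D: "f D = 0" and f_pos: "s \<in> {0<..<D} \<Longrightarrow> f s > 0"
  using form by (auto simp: rot_symmetric_form_def warping_function_def)

lemma diffeo: "sphere_diffeo F"
  using form by (simp add: rot_symmetric_form_def)

lemma form_polar:
  assumes "s \<in> {0<..<D}" "\<theta> \<in> usphere" "v \<in> tangent \<theta>" "w \<in> tangent \<theta>"
  shows "pullback (F \<circ> polar D) g (s, \<theta>) (a, v) (b, w) = a * b + (f s)\<^sup>2 * (v \<bullet> w)"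
  using form assms by (auto simp: rot_symmetric_form_def round_metric_def)

lemma deriv_d: "s \<in> {0<..<D} \<Longrightarrow> (d k has_real_derivative d (Suc k) s) (at s)"
  using deriv_d_within[of s k] at_within_Icc_at[of 0 s D] by auto

lemma deriv_f: "s \<in> {0<..<D} \<Longrightarrow> (f has_real_derivative d 1 s) (at s)"
  using deriv_d[of s 0] d_0
  by (auto intro: has_field_derivative_transform_within_open[where S = "{0<..<D}"])

lemma Ck_on_f: "Ck_on k f {0<..<D}"
  using Ck_on_real_derivatives[of "{0<..<D}" d k 0] deriv_d d_0
    Ck_on_cong[of "{0<..<D}" f "d 0" k] by simp

lemma F_smooth:
  obtains V where "open V" "usphere \<subseteq> V" "\<And>k. Ck_on k F V"
  using diffeo unfolding sphere_diffeo_def smooth_def by metis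

lemma F_bij: "bij_betw F usphere usphere"
  using diffeo by (simp add: sphere_diffeo_def)

lemma F_polar_has_derivative:
  assumes "\<theta> \<in> usphere"
  shows "((F \<circ> polar D) has_derivative frechet_derivative (F \<circ> polar D) (at (s, \<theta>))) (at (s, \<theta>))"
proof -
  obtain V where V: "open V" "usphere \<subseteq> V" "\<And>k. Ck_on k F V" by (rule F_smooth) blast
  have "F differentiable (at (polar D (s, \<theta>)))"
    using V(2) polar_in_usphere[OF assms] Ck_on_has_derivative[OF V(3)] by (blast intro: differentiableI)
  moreover have "polar D differentiable (at (s, \<theta>))"
    using Ck_on_has_derivative[OF Ck_on_polar, of "(s, \<theta>)"] by (blast intro: differentiableI)
  ultimately show ?thesis
    by (simp add: frechet_derivative_works[symmetric] differentiable_chain_at)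
qed

text \<open>With \<open>ds = f dt\<close> the metric is \<open>f^2 (dt^2 + g_rd)\<close>, and
  \<open>dt^2 + g_rd\<close> is the Euclidean metric divided by \<open>|x|^2\<close> when
  \<open>x = e^t \<theta>\<close>. The chart reads this backwards: take \<open>t = ln |x|\<close>
  and \<open>\<theta> = x / |x|\<close>, flow to \<open>s t\<close>, then apply the polar map and
  \<open>F\<close>.\<close>

lemma conformal_chart:
  assumes s0: "s0 \<in> {0<..<D}"
  obtains U \<phi> S x0 where "local_param U \<phi>" "x0 \<in> U" "S x0 = s0" "\<And>x. x \<in> U \<Longrightarrow> S x \<in> {0<..<D}"
    "\<And>x. x \<in> U \<Longrightarrow> x \<noteq> 0"
    "\<And>x. x \<in> U \<Longrightarrow> (S has_derivative (\<lambda>v. f (S x) * (x \<bullet> v) / (x \<bullet> x))) (at x)"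
    "\<And>x v w. x \<in> U \<Longrightarrow> pullback \<phi> g x v w = (f (S x))\<^sup>2 / (x \<bullet> x) * (v \<bullet> w)"
proof -
  have "continuous_on {0<..<D} f" using Ck_on_f[of 0] by simp
  then obtain s I t0 where I: "open I" "t0 \<in> I" "s t0 = s0" "s ` I \<subseteq> {0<..<D}" "inj_on s I"
    and ds: "\<And>t. t \<in> I \<Longrightarrow> (s has_real_derivative f (s t)) (at t)"
    by (rule autonomous_ode_solution[OF _ f_pos s0]) blast+
  define t where "t x = 1 / 2 * ln (x \<bullet> x)" for x :: "real^'n"
  define S where "S x = s (t x)" for x
  define U where "U = {x. x \<noteq> 0} \<inter> t -` I"
  define P where "P x = (S x, exp (- t x) *\<^sub>R x)" for x
  define \<phi> where "\<phi> x = F (polar D (P x))" for x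
  have tU: "t x \<in> I" "x \<noteq> 0" if "x \<in> U" for x using that by (auto simp: U_def)
  have SU: "S x \<in> {0<..<D}" if "x \<in> U" for x using tU[OF that] I(4) by (auto simp: S_def)
  have open0: "open {x::real^'n. x \<noteq> 0}" by (simp add: open_Collect_neq)
  have Ck_t: "Ck_on k t {x. x \<noteq> 0}" for k
  proof -
    have "Ck_on k (\<lambda>x::real^'n. 1 / 2 * ln (x \<bullet> x)) {x. x \<noteq> 0}"
      by (intro Ck_on_mult Ck_on_const open0 Ck_on_compose[OF _ _ Ck_on_ln] Ck_on_inner Ck_on_linear
          bounded_linear_ident) auto
    then show ?thesis by (simp add: t_def[abs_def])
  qed
  have openU: "open U"
    unfolding U_def using Ck_t[of 0] open0 I(1) by (intro continuous_open_preimage) auto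
  have Ck_tU: "Ck_on k t U" for k using Ck_on_subset[OF Ck_t] by (auto simp: U_def)
  have Ck_S: "Ck_on k S U" for k
    unfolding S_def[abs_def]
    using Ck_on_autonomous_ode[OF I(1) _ Ck_on_f I(4) ds] tU
    by (intro Ck_on_compose[OF openU I(1) _ Ck_tU]) auto
  have Ck_P: "Ck_on k P U" for k
  proof -
    have "Ck_on k (\<lambda>x. - 1 * t x) U" by (intro Ck_on_mult Ck_on_const openU Ck_tU)
    then have "Ck_on k (\<lambda>x. exp (- t x)) U"
      by (intro Ck_on_compose[OF openU open_UNIV Ck_on_exp]) auto
    then show ?thesis
      unfolding P_def[abs_def]
      by (intro Ck_on_Pair Ck_on_scaleR openU Ck_S Ck_on_linear[OF openU bounded_linear_ident])
  qed
  have exp_t: "exp (t x) = norm x" if "x \<noteq> 0" for x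
  proof -
    have "t x = ln (norm x)"
      using that by (simp add: t_def norm_eq_sqrt_inner ln_sqrt)
    then show ?thesis using that by simp
  qed
  have theta: "exp (- t x) *\<^sub>R x \<in> usphere" if "x \<noteq> 0" for x
    using that exp_t[OF that] by (simp add: exp_minus dist_norm)
  obtain V where V: "open V" "usphere \<subseteq> V" "\<And>k. Ck_on k F V" by (rule F_smooth) blast
  have polP: "polar D (P x) \<in> usphere" if "x \<in> U" for x
    using polar_in_usphere[OF theta] tU[OF that] by (simp add: P_def)
  have Ck_phi: "Ck_on k \<phi> U" for k
    unfolding \<phi>_def[abs_def]
    using V polP Ck_on_compose[OF openU open_UNIV Ck_on_polar Ck_P, of k D]
    by (intro Ck_on_compose[OF openU V(1) V(3)]) auto
  have dt: "(t has_derivative (\<lambda>v. (x \<bullet> v) / (x \<bullet> x))) (at x)" if "x \<in> U" for x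
  proof -
    have q: "x \<bullet> x > 0" using tU(2)[OF that] by simp
    have "((\<lambda>x. ln (x \<bullet> x)) has_derivative (\<lambda>v. inverse (x \<bullet> x) * (x \<bullet> v + v \<bullet> x))) (at x)"
      by (rule has_derivative_compose[OF has_derivative_inner[OF has_derivative_ident has_derivative_ident]])
         (use DERIV_ln[OF q] in \<open>simp add: has_field_derivative_def\<close>)
    then have "(t has_derivative (\<lambda>v. 1 / 2 * (inverse (x \<bullet> x) * (x \<bullet> v + v \<bullet> x)))) (at x)"
      unfolding t_def[abs_def] by (rule has_derivative_mult_right)
    moreover have "1 / 2 * (inverse (x \<bullet> x) * (x \<bullet> v + v \<bullet> x)) = (x \<bullet> v) / (x \<bullet> x)" for v
      using inner_commute[of v x] by (simp only: divide_inverse) simp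
    ultimately show ?thesis by simp
  qed
  have dS: "(S has_derivative (\<lambda>v. f (S x) * (x \<bullet> v) / (x \<bullet> x))) (at x)" if "x \<in> U" for x
    using has_derivative_compose[OF dt[OF that], of s "(*) (f (s (t x)))"] ds[OF tU(1)[OF that]]
    by (simp add: S_def[abs_def] has_field_derivative_def)
  \<comment> \<open>The second component is the derivative of \<open>x / |x|\<close>: the part of
    \<open>v\<close> orthogonal to \<open>x\<close>, divided by \<open>|x|\<close>. It is tangent to
    the unit sphere, as \<open>form_polar\<close> requires.\<close>
  define dP where "dP x v = (f (S x) * (x \<bullet> v) / (x \<bullet> x), exp (- t x) *\<^sub>R (v - ((x \<bullet> v) / (x \<bullet> x)) *\<^sub>R x))" for x v
  have dP: "(P has_derivative dP x) (at x)" if "x \<in> U" for x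
    unfolding P_def[abs_def] dP_def[abs_def]
    by (rule has_derivative_eq_rhs, rule has_derivative_Pair[OF dS[OF that]],
        rule has_derivative_scaleR, rule has_derivative_exp, rule has_derivative_minus, rule dt[OF that],
        rule has_derivative_ident)
       (auto simp: fun_eq_iff algebra_simps)
  have tang: "snd (dP x v) \<in> tangent (exp (- t x) *\<^sub>R x)" if "x \<in> U" for x v
    using tU[OF that] by (simp add: tangent_def dP_def inner_diff_right)
  have dphi: "frechet_derivative \<phi> (at x) v = frechet_derivative (F \<circ> polar D) (at (P x)) (dP x v)"
    if "x \<in> U" for x v
  proof -
    have "(\<phi> has_derivative (\<lambda>v. frechet_derivative (F \<circ> polar D) (at (P x)) (dP x v))) (at x)"
      using has_derivative_compose[OF dP[OF that], of "F \<circ> polar D"]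
        F_polar_has_derivative[OF theta, of x "S x"] tU[OF that]
      by (simp add: P_def \<phi>_def[abs_def] o_def)
    then show ?thesis by (simp add: frechet_derivative_at[symmetric])
  qed
  have pb: "pullback \<phi> g x v w = (f (S x))\<^sup>2 / (x \<bullet> x) * (v \<bullet> w)" if "x \<in> U" for x v w
  proof -
    have q: "x \<bullet> x > 0" using tU[OF that] by simp
    have e: "exp (- t x) * exp (- t x) = 1 / (x \<bullet> x)"
      using exp_t[OF tU(2)[OF that]]
      by (simp add: exp_minus divide_inverse power2_norm_eq_inner[symmetric] power2_eq_square)
    have "pullback \<phi> g x v w = pullback (F \<circ> polar D) g (P x) (dP x v) (dP x w)"
      using that by (simp add: pullback_def dphi) (simp add: \<phi>_def)
    also have "\<dots> = fst (dP x v) * fst (dP x w) + (f (S x))\<^sup>2 * (snd (dP x v) \<bullet> snd (dP x w))"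
      using form_polar[OF SU[OF that] theta tang[OF that] tang[OF that], of "fst (dP x v)" v "fst (dP x w)" w] tU[OF that]
      by (simp add: P_def)
    also have "snd (dP x v) \<bullet> snd (dP x w) =
        1 / (x \<bullet> x) * ((v - ((x \<bullet> v) / (x \<bullet> x)) *\<^sub>R x) \<bullet> (w - ((x \<bullet> w) / (x \<bullet> x)) *\<^sub>R x))"
      by (simp add: dP_def e[symmetric])
    also have "(v - ((x \<bullet> v) / (x \<bullet> x)) *\<^sub>R x) \<bullet> (w - ((x \<bullet> w) / (x \<bullet> x)) *\<^sub>R x) = v \<bullet> w - (x \<bullet> v) * (x \<bullet> w) / (x \<bullet> x)"
      using q inner_commute[of v x] by (simp add: inner_diff_left inner_diff_right)
    finally show ?thesis
      using q by (simp add: dP_def field_simps power2_eq_square)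
  qed
  have phi_sphere: "\<phi> x \<in> usphere" if "x \<in> U" for x
    using bij_betwE[OF F_bij] polP[OF that] by (auto simp: \<phi>_def)
  have param: "local_param U \<phi>"
    unfolding local_param_def
  proof (intro conjI ballI)
    show "smooth \<phi> U" using openU Ck_phi by (simp add: smooth_def)
    show "\<phi> ` U \<subseteq> usphere" using phi_sphere by blast
    show "inj_on \<phi> U"
    proof (rule inj_onI)
      fix x y assume xy: "x \<in> U" "y \<in> U" "\<phi> x = \<phi> y"
      then have "polar D (P x) = polar D (P y)"
        using F_bij polP unfolding \<phi>_def bij_betw_def by (meson inj_onD)
      then have eq: "S x = S y" "exp (- t x) *\<^sub>R x = exp (- t y) *\<^sub>R y"
        using polar_inj[OF _ SU[OF xy(1)] SU[OF xy(2)] D_pos] by (auto simp: P_def)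
      then have "t x = t y" using I(5) tU xy by (auto simp: S_def dest: inj_onD)
      with eq show "x = y" by simp
    qed
    fix x assume x: "x \<in> U"
    have lin: "linear (frechet_derivative \<phi> (at x))"
      using Ck_on_has_derivative[OF Ck_phi x] has_derivative_linear by blast
    \<comment> \<open>A vector in the kernel would have length zero in the pulled-back metric, which
      \<open>pb\<close> shows to be definite.\<close>
    show "inj (frechet_derivative \<phi> (at x))"
      unfolding linear_injective_0[OF lin]
    proof (intro allI impI)
      fix v assume "frechet_derivative \<phi> (at x) v = 0"
      then have "pullback \<phi> g x v v = 0"
        using riemannian_metric_zero[OF metric phi_sphere[OF x], of 0] by (simp add: pullback_def tangent_def)
      then show "v = 0" using pb[OF x, of v v] f_pos[OF SU[OF x]] tU[OF x] by auto
    qed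
  qed
  \<comment> \<open>Every vector of norm \<open>exp t0\<close> lies over \<open>s0\<close>; a
    multiple of a basis vector will do.\<close>
  obtain i :: 'n where True by simp
  define x0 :: "real^'n" where "x0 = exp t0 *\<^sub>R axis i 1"
  have t_x0: "t x0 = t0"
    by (simp add: t_def x0_def inner_axis_axis exp_add[symmetric])
  have "x0 \<noteq> 0" by (simp add: x0_def)
  then have "x0 \<in> U" "S x0 = s0" using I t_x0 by (auto simp: U_def S_def)
  with param show ?thesis by (rule that[OF _ _ _ SU tU(2) dS pb])
qed

text \<open>Here \<open>u = ln f(S) - ln |x|\<close>, whose gradient is
  \<open>(f' - 1) x / |x|^2\<close> because \<open>S\<close> has gradient
  \<open>f x / |x|^2\<close>. This gives \<open>w\<close>, and one more differentiation gives
  \<open>w'\<close>. The Ricci bound is evaluated on \<open>x0\<close> itself, where it is a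
  positive multiple of \<open>- f f''\<close>.\<close>

lemma curvature_inequalities:
  assumes n: "CARD('n) \<ge> 2" and s0: "s0 \<in> {0<..<D}"
    and scal: "Scal_ge g (real CARD('n) * (real CARD('n) - 1) * c\<^sup>2)" and ric: "Ric_nonneg g"
  shows "d 2 s0 \<le> 0"
    and "(real CARD('n) - 2) * (1 - (d 1 s0)\<^sup>2) - 2 * f s0 * d 2 s0 \<ge> real CARD('n) * c\<^sup>2 * (f s0)\<^sup>2"
proof -
  obtain U \<phi> S x0 where param: "local_param U \<phi>" and x0: "x0 \<in> U" "S x0 = s0"
    and SU: "\<And>x. x \<in> U \<Longrightarrow> S x \<in> {0<..<D}" and nz: "\<And>x. x \<in> U \<Longrightarrow> x \<noteq> 0"
    and dS: "\<And>x. x \<in> U \<Longrightarrow> (S has_derivative (\<lambda>v. f (S x) * (x \<bullet> v) / (x \<bullet> x))) (at x)"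
    and pb: "\<And>x v w. x \<in> U \<Longrightarrow> pullback \<phi> g x v w = (f (S x))\<^sup>2 / (x \<bullet> x) * (v \<bullet> w)"
    by (rule conformal_chart[OF s0]) blast
  define E where "E x = (f (S x))\<^sup>2 * inverse (x \<bullet> x)" for x
  define w where "w x = (d 1 (S x) - 1) * inverse (x \<bullet> x)" for x
  define w' where "w' x = (f (S x) * d 2 (S x) - 2 * (d 1 (S x) - 1)) * (inverse (x \<bullet> x))\<^sup>2" for x
  have q: "x \<bullet> x > 0" if "x \<in> U" for x using nz[OF that] by simp
  have dinv: "((\<lambda>x. inverse (x \<bullet> x)) has_derivative (\<lambda>v. - 2 * (inverse (x \<bullet> x))\<^sup>2 * (x \<bullet> v))) (at x)"
    if "x \<in> U" for x
  proof -
    have "((\<lambda>x. inverse (x \<bullet> x)) has_derivative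
        (\<lambda>v. - (inverse (x \<bullet> x) * (x \<bullet> v + v \<bullet> x) * inverse (x \<bullet> x)))) (at x)"
      using q[OF that]
      by (intro Deriv.has_derivative_inverse has_derivative_inner[OF has_derivative_ident has_derivative_ident]) auto
    moreover have "- (inverse (x \<bullet> x) * (x \<bullet> v + v \<bullet> x) * inverse (x \<bullet> x)) = - 2 * (inverse (x \<bullet> x))\<^sup>2 * (x \<bullet> v)" for v
      using inner_commute[of v x] by (simp add: power2_eq_square)
    ultimately show ?thesis by simp
  qed
  have dcomp: "((\<lambda>x. u (S x)) has_derivative (\<lambda>v. u' * (f (S x) * (x \<bullet> v) / (x \<bullet> x)))) (at x)"
    if "x \<in> U" "(u has_real_derivative u') (at (S x))" for x u u'
    by (rule has_derivative_compose[OF dS[OF that(1)] that(2)[unfolded has_field_derivative_def]])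
  interpret conformal_metric "pullback \<phi> g" U E w w'
  proof
    show "open U" using param by (simp add: local_param_def smooth_def)
    fix x assume x: "x \<in> U"
    show "coeff (pullback \<phi> g) x = E x *\<^sub>R mat 1"
      unfolding coeff_def E_def pb[OF x]
      by (auto simp: vec_eq_iff mat_def inner_axis_axis divide_inverse)
    show "E x > 0" using f_pos[OF SU[OF x]] q[OF x] by (simp add: E_def)
    have "(E has_derivative (\<lambda>v. (f (S x))\<^sup>2 * (- 2 * (inverse (x \<bullet> x))\<^sup>2 * (x \<bullet> v))
        + (2 * f (S x) * d 1 (S x)) * (f (S x) * (x \<bullet> v) / (x \<bullet> x)) * inverse (x \<bullet> x))) (at x)"
      unfolding E_def[abs_def]
      by (intro has_derivative_mult dinv[OF x] dcomp[OF x])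
         (use deriv_f[OF SU[OF x]] in \<open>auto intro!: derivative_eq_intros\<close>)
    moreover have "(f (S x))\<^sup>2 * (- 2 * (inverse (x \<bullet> x))\<^sup>2 * (x \<bullet> v))
        + (2 * f (S x) * d 1 (S x)) * (f (S x) * (x \<bullet> v) / (x \<bullet> x)) * inverse (x \<bullet> x)
        = 2 * E x * w x * (x \<bullet> v)" for v
      by (simp add: E_def w_def divide_inverse power2_eq_square algebra_simps)
    ultimately show "(E has_derivative (\<lambda>v. 2 * E x * w x * (x \<bullet> v))) (at x)" by simp
    have "(w has_derivative (\<lambda>v. (d 1 (S x) - 1) * (- 2 * (inverse (x \<bullet> x))\<^sup>2 * (x \<bullet> v))
        + d 2 (S x) * (f (S x) * (x \<bullet> v) / (x \<bullet> x)) * inverse (x \<bullet> x))) (at x)"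
      unfolding w_def[abs_def]
      by (intro has_derivative_mult dinv[OF x] dcomp[OF x])
         (use deriv_d[OF SU[OF x], of 1] in \<open>auto intro!: derivative_eq_intros simp: numeral_2_eq_2\<close>)
    moreover have "(d 1 (S x) - 1) * (- 2 * (inverse (x \<bullet> x))\<^sup>2 * (x \<bullet> v))
        + d 2 (S x) * (f (S x) * (x \<bullet> v) / (x \<bullet> x)) * inverse (x \<bullet> x) = w' x * (x \<bullet> v)" for v
      by (simp add: w'_def divide_inverse power2_eq_square algebra_simps)
    ultimately show "(w has_derivative (\<lambda>v. w' x * (x \<bullet> v))) (at x)" by simp
  qed
  let ?n = "real CARD('n)" and ?q = "x0 \<bullet> x0"
  have n': "?n \<ge> 2" using n by simp
  have q0: "?q > 0" using q x0 by simp
  have f0: "f s0 > 0" using f_pos[OF s0] .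
  have wq: "w x0 * ?q = d 1 s0 - 1" using q0 by (simp add: w_def x0)
  have w'q: "w' x0 * ?q * ?q = f s0 * d 2 s0 - 2 * (d 1 s0 - 1)"
  proof -
    have "a * (inverse q)\<^sup>2 * q * q = a" if "q > 0" for a q :: real
      using that by (simp add: power2_eq_square field_simps)
    from this[OF q0] show ?thesis by (simp only: w'_def x0)
  qed
  have "0 \<le> x0 \<bullet> (ricci (pullback \<phi> g) x0 *v x0)"
    using ric param x0 by (auto simp: Ric_nonneg_def)
  also have "\<dots> = - (?n - 1) * (w' x0 * ?q * ?q + 2 * (w x0 * ?q))"
    by (simp add: ricci_radial[OF x0(1)] algebra_simps)
  also have "\<dots> = (?n - 1) * f s0 * (- d 2 s0)" unfolding wq w'q by (simp add: algebra_simps)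
  finally show "d 2 s0 \<le> 0"
    using mult_le_cancel_left_pos[of "(?n - 1) * f s0" 0 "- d 2 s0"] n' f0 by simp
  have Eq: "E x0 * ?q = (f s0)\<^sup>2" using q0 by (simp add: E_def x0)
  have "?n * (?n - 1) * c\<^sup>2 \<le> scalar_curvature (pullback \<phi> g) x0"
    using scal param x0 by (auto simp: Scal_ge_def)
  \<comment> \<open>Expanding the fraction by \<open>|x0|^2\<close> leaves only \<open>w q\<close>,
    \<open>w' q^2\<close> and \<open>E q\<close>, which depend on \<open>s0\<close> alone.\<close>
  also have "\<dots> = - (?n - 1) / (E x0 * ?q) * (2 * (w' x0 * ?q * ?q + ?n * (w x0 * ?q)) + (?n - 2) * (w x0 * ?q)\<^sup>2)"
  proof -
    have *: "a / e * X = a / (e * q) * (X * q)" if "q > 0" for a e X q :: real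
      using that by simp
    show ?thesis
      unfolding scalar_curvature_eq[OF x0(1)]
      by (rule trans[OF *[OF q0]], rule arg_cong[where f = "\<lambda>y. - (?n - 1) / (E x0 * ?q) * y"])
         (simp add: power2_eq_square algebra_simps)
  qed
  also have "\<dots> = (?n - 1) / (f s0)\<^sup>2 * ((?n - 2) * (1 - (d 1 s0)\<^sup>2) - 2 * f s0 * d 2 s0)"
    unfolding wq w'q Eq by (simp add: divide_inverse power2_eq_square algebra_simps)
  finally have "(?n - 1) * (?n * c\<^sup>2 * (f s0)\<^sup>2) \<le> (?n - 1) * ((?n - 2) * (1 - (d 1 s0)\<^sup>2) - 2 * f s0 * d 2 s0)"
    using f0 by (simp add: field_simps)
  then show "(?n - 2) * (1 - (d 1 s0)\<^sup>2) - 2 * f s0 * d 2 s0 \<ge> ?n * c\<^sup>2 * (f s0)\<^sup>2"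
    using n' by simp
qed

end

section \<open>The differential inequality for the profile\<close>

lemma deriv_nonneg_imp_le:
  fixes f :: "real \<Rightarrow> real"
  assumes "a \<le> b" "continuous_on {a..b} f"
    and "\<And>x. a < x \<Longrightarrow> x < b \<Longrightarrow> (f has_real_derivative f' x) (at x)"
    and "\<And>x. a < x \<Longrightarrow> x < b \<Longrightarrow> f' x \<ge> 0"
  shows "f a \<le> f b"
proof (cases "a = b")
  case False
  with assms(1) have "a < b" by simp
  then obtain l z where z: "a < z" "z < b" "DERIV f z :> l" "f b - f a = (b - a) * l"
    using MVT[OF \<open>a < b\<close> assms(2)] assms(3) real_differentiable_def by metis
  then have "l \<ge> 0" using assms(3,4) DERIV_unique by metis
  then show ?thesis using z(4) \<open>a < b\<close> by (smt (verit) mult_nonneg_nonneg)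
qed simp

lemma deriv_le_imp_diff_le:
  fixes f g :: "real \<Rightarrow> real"
  assumes "a \<le> b" "continuous_on {a..b} f" "continuous_on {a..b} g"
    and "\<And>x. a < x \<Longrightarrow> x < b \<Longrightarrow> (f has_real_derivative f' x) (at x)"
    and "\<And>x. a < x \<Longrightarrow> x < b \<Longrightarrow> (g has_real_derivative g' x) (at x)"
    and "\<And>x. a < x \<Longrightarrow> x < b \<Longrightarrow> f' x \<le> g' x"
  shows "f b - f a \<le> g b - g a"
  using deriv_nonneg_imp_le[of a b "\<lambda>x. g x - f x" "\<lambda>x. g' x - f' x"] assms
  by (force intro: continuous_on_diff DERIV_diff)

section \<open>Elementary bounds for sine and cosine\<close>

lemma abs_cos_diff_le: "\<bar>cos x - cos y\<bar> \<le> \<bar>x - y\<bar>" for x y :: real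
proof -
  have "\<bar>cos x - cos y\<bar> = 2 * (\<bar>sin ((x + y) / 2)\<bar> * \<bar>sin ((y - x) / 2)\<bar>)"
    by (simp add: cos_diff_cos abs_mult)
  also have "\<dots> \<le> 2 * (1 * \<bar>(y - x) / 2\<bar>)"
    by (intro mult_left_mono mult_mono abs_sin_x_le_abs_x abs_sin_le_one) auto
  finally show ?thesis by (simp add: abs_minus_commute)
qed

lemma abs_sin_diff_le: "\<bar>sin x - sin y\<bar> \<le> \<bar>x - y\<bar>" for x y :: real
  using abs_cos_diff_le[of "x - pi / 2" "y - pi / 2"] by (simp add: cos_diff)

text \<open>The cubic remainder \<open>x^3 / 6\<close> takes away at most two thirds of
  \<open>x\<close> as long as \<open>x^2 \<le> 4\<close>. The range reaches beyond
  \<open>pi / 2\<close>.\<close>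

lemma sin_ge_third:
  assumes "0 \<le> x" "x \<le> (2::real)"
  shows "sin x \<ge> x / 3"
proof -
  have "\<bar>sin x - x\<bar> \<le> \<bar>x\<bar> ^ 3 / 6"
    using Maclaurin_sin_bound[of x 3] by (simp add: eval_nat_numeral sin_coeff_def field_simps)
  moreover have "\<bar>x\<bar> ^ 3 / 6 \<le> 2 * x / 3"
  proof -
    have "x * x \<le> 2 * 2" using assms by (intro mult_mono) auto
    then have "x * (x * x) \<le> x * 4" using assms by (intro mult_left_mono) auto
    then show ?thesis using assms by (simp add: eval_nat_numeral)
  qed
  ultimately show ?thesis by linarith
qed

text \<open>One half of the profile of a rotationally symmetric metric, from a pole up to the equator.\<close>

locale rising_profile =
  fixes f f1 f2 :: "real \<Rightarrow> real" and a c :: real and N :: nat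
  assumes a_pos: "a > 0"
    and cont_f: "continuous_on {0..a} f" and cont_f1: "continuous_on {0..a} f1"
    and deriv_f: "s \<in> {0<..<a} \<Longrightarrow> (f has_real_derivative f1 s) (at s)"
    and deriv_f1: "s \<in> {0<..<a} \<Longrightarrow> (f1 has_real_derivative f2 s) (at s)"
    and f_0: "f 0 = 0" and f1_0: "f1 0 = 1" and f1_a: "f1 a = 0"
    and f1_pos: "s \<in> {0..<a} \<Longrightarrow> f1 s > 0"
    and f2_nonpos: "s \<in> {0<..<a} \<Longrightarrow> f2 s \<le> 0"
    and scal: "s \<in> {0<..<a} \<Longrightarrow> real N * (1 - (f1 s)\<^sup>2) - 2 * f s * f2 s \<ge> (real N + 2) * c\<^sup>2 * (f s)\<^sup>2"
    and wide: "c \<le> f a"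
    and c_ge: "1 / 2 \<le> c" and c_le: "c \<le> 1"
    and N_pos: "N \<ge> 1"
begin

lemma f1_nonneg: "s \<in> {0..a} \<Longrightarrow> f1 s \<ge> 0"
  using f1_pos[of s] f1_a by (cases "s = a") auto

lemma f1_antimono:
  assumes "0 \<le> s" "s \<le> t" "t \<le> a"
  shows "f1 t \<le> f1 s"
proof -
  have "- f1 s \<le> - f1 t"
  proof (rule deriv_nonneg_imp_le[where f = "\<lambda>x. - f1 x" and f' = "\<lambda>x. - f2 x", OF assms(2)])
    show "continuous_on {s..t} (\<lambda>x. - f1 x)"
      using assms by (intro continuous_on_minus continuous_on_subset[OF cont_f1]) auto
    show "((\<lambda>x. - f1 x) has_real_derivative - f2 x) (at x)" if "s < x" "x < t" for x
      using that assms by (intro DERIV_minus deriv_f1) auto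
  qed (use f2_nonpos assms in auto)
  then show ?thesis by simp
qed

lemma f1_le_1: "s \<in> {0..a} \<Longrightarrow> f1 s \<le> 1"
  using f1_antimono[of 0 s] f1_0 by simp

lemma f_mono:
  assumes "0 \<le> s" "s \<le> t" "t \<le> a"
  shows "f s \<le> f t"
proof (rule deriv_nonneg_imp_le[where f = f and f' = f1, OF assms(2)])
  show "continuous_on {s..t} f" using cont_f assms by (auto intro: continuous_on_subset)
qed (use assms deriv_f f1_nonneg in auto)

lemma f_nonneg: "s \<in> {0..a} \<Longrightarrow> f s \<ge> 0"
  using f_mono[of 0 s] f_0 by simp

text \<open>Vanishes identically for the profile \<open>sin (c s) / c\<close> of the round sphere of
  curvature \<open>c^2\<close>.\<close>

definition defect :: "real \<Rightarrow> real" where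
  "defect s = 1 - (f1 s)\<^sup>2 - c\<^sup>2 * (f s)\<^sup>2"

text \<open>\<open>f ^ N\<close> is an integrating factor: the derivative is
  \<open>f1 * f ^ (N - 1)\<close> times exactly the slack in \<open>scal\<close>.\<close>

lemma weighted_defect_mono:
  assumes "0 \<le> s" "s \<le> t" "t \<le> a"
  shows "f s ^ N * defect s \<le> f t ^ N * defect t"
proof (rule deriv_nonneg_imp_le[where f = "\<lambda>x. f x ^ N * defect x", OF assms(2)])
  show "continuous_on {s..t} (\<lambda>x. f x ^ N * defect x)"
    unfolding defect_def using assms
    by (intro continuous_intros continuous_on_subset[OF cont_f] continuous_on_subset[OF cont_f1]) auto
  fix x assume x: "s < x" "x < t"
  then have xa: "x \<in> {0<..<a}" using assms by auto
  define M where "M = N - 1"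
  have M: "N = Suc M" using N_pos by (simp add: M_def)
  have "((\<lambda>x. f x ^ Suc M) has_real_derivative (1 + real M) * (f1 x * f x ^ M)) (at x)"
    using DERIV_power_Suc[OF deriv_f[OF xa]] by simp
  moreover have "(defect has_real_derivative - (2 * f1 x * f2 x) - 2 * c\<^sup>2 * f x * f1 x) (at x)"
    unfolding defect_def[abs_def] using deriv_f[OF xa] deriv_f1[OF xa]
    by (auto intro!: derivative_eq_intros)
  ultimately have "((\<lambda>x. f x ^ Suc M * defect x) has_real_derivative
      (1 + real M) * (f1 x * f x ^ M) * defect x + (- (2 * f1 x * f2 x) - 2 * c\<^sup>2 * f x * f1 x) * f x ^ Suc M) (at x)"
    by (rule DERIV_mult)
  moreover have "(1 + real M) * (f1 x * f x ^ M) * defect x + (- (2 * f1 x * f2 x) - 2 * c\<^sup>2 * f x * f1 x) * f x ^ Suc M =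
      f1 x * f x ^ M * ((real N * (1 - (f1 x)\<^sup>2) - 2 * f x * f2 x) - (real N + 2) * c\<^sup>2 * (f x)\<^sup>2)"
    by (simp add: defect_def M algebra_simps power2_eq_square)
  ultimately show "((\<lambda>x. f x ^ N * defect x) has_real_derivative
      f1 x * f x ^ (N - 1) * ((real N * (1 - (f1 x)\<^sup>2) - 2 * f x * f2 x) - (real N + 2) * c\<^sup>2 * (f x)\<^sup>2)) (at x)"
    by (simp only: M diff_Suc_1)
  show "f1 x * f x ^ (N - 1) * ((real N * (1 - (f1 x)\<^sup>2) - 2 * f x * f2 x) - (real N + 2) * c\<^sup>2 * (f x)\<^sup>2) \<ge> 0"
    using scal[OF xa] f1_nonneg[of x] f_nonneg[of x] xa by (intro mult_nonneg_nonneg) auto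
qed

lemma f_pos:
  assumes "s \<in> {0<..a}"
  shows "f s > 0"
proof -
  have "f (s / 2) < f s"
  proof (rule DERIV_pos_imp_increasing_open[of "s / 2" s f])
    show "continuous_on {s / 2..s} f" using cont_f assms by (auto intro: continuous_on_subset)
    show "\<exists>y. (f has_real_derivative y) (at x) \<and> y > 0" if "s / 2 < x" "x < s" for x
      using that assms deriv_f[of x] f1_pos[of x] by force
  qed (use assms in auto)
  then show ?thesis using f_nonneg[of "s / 2"] assms by auto
qed

text \<open>The weighted defect starts from 0, because \<open>f 0 = 0\<close> and
  \<open>N \<ge> 1\<close>.\<close>

lemma defect_nonneg:
  assumes "s \<in> {0..a}"
  shows "defect s \<ge> 0"
proof (cases "s = 0")
  case True
  then show ?thesis by (simp add: defect_def f_0 f1_0)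
next
  case False
  have "0 \<le> f s ^ N * defect s"
    using weighted_defect_mono[of 0 s] assms N_pos by (simp add: f_0 power_0_left)
  then show ?thesis
    using mult_le_cancel_left_pos[of "f s ^ N" 0 "defect s"] f_pos[of s] False assms by simp
qed

text \<open>Compare with the value at \<open>a\<close>. There \<open>f1\<close> vanishes, so the
  defect is \<open>1 - c^2 f(a)^2\<close>, which is at most \<open>1 - c^4\<close> since
  \<open>c \<le> f a\<close>. That it is also nonnegative gives
  \<open>f a \<le> 1 / c \<le> 2\<close>, whence the factor \<open>2 ^ N\<close>.\<close>

lemma weighted_defect_le:
  assumes "s \<in> {0..a}"
  shows "f s ^ N * defect s \<le> 2 ^ N * (1 - c ^ 4)"
proof -
  have c: "c > 0" using c_ge by simp
  have "(c * f a)\<^sup>2 \<le> 1"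
    using defect_nonneg[of a] a_pos by (simp add: defect_def f1_a power_mult_distrib)
  then have cf: "c * f a \<le> 1" using power2_le_imp_le[of "c * f a" 1] by simp
  have "f a \<le> 1 / c" using cf c by (simp add: field_simps)
  also have "\<dots> \<le> 2" using c_ge by (simp add: field_simps)
  finally have "f a ^ N \<le> 2 ^ N" using f_nonneg[of a] a_pos by (intro power_mono) auto
  moreover have "c\<^sup>2 * c\<^sup>2 \<le> c\<^sup>2 * (f a)\<^sup>2"
    using wide c by (intro mult_left_mono power_mono) auto
  then have "defect a \<le> 1 - c ^ 4" by (simp add: defect_def f1_a power2_eq_square power4_eq_xxxx)
  ultimately have "f a ^ N * defect a \<le> 2 ^ N * (1 - c ^ 4)"
    using defect_nonneg[of a] a_pos by (intro mult_mono) auto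
  then show ?thesis using weighted_defect_mono[of s a] assms by simp
qed

text \<open>For \<open>y = c f\<close>, nonnegative defect means
  \<open>y' \<le> c sqrt (1 - y^2)\<close>, so \<open>arcsin y\<close> grows at rate at most
  \<open>c\<close>. Before \<open>a\<close> the derivative \<open>f1\<close> is positive, which
  makes \<open>y < 1\<close> strict and keeps \<open>arcsin\<close> differentiable.\<close>

lemma cf_le_sin:
  assumes "s \<in> {0..a}" "c * s \<le> pi / 2"
  shows "c * f s \<le> sin (c * s)"
proof -
  have lt: "(c * f x)\<^sup>2 < 1" if "x \<in> {0..<a}" for x
  proof -
    have "(f1 x)\<^sup>2 > 0" using f1_pos[OF that] by simp
    moreover have "defect x \<ge> 0" using that by (intro defect_nonneg) auto
    ultimately show ?thesis unfolding defect_def power_mult_distrib by linarith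
  qed
  have main: "c * f x \<le> sin (c * x)" if x: "x \<in> {0..<a}" "c * x \<le> pi / 2" for x
  proof -
    have abs1: "\<bar>c * f y\<bar> < 1" if "y \<in> {0..<a}" for y
      using lt[OF that] by (simp add: abs_square_less_1)
    have "arcsin (c * f x) - arcsin (c * f 0) \<le> c * x - c * 0"
    proof (rule deriv_le_imp_diff_le)
      show "continuous_on {0..x} (\<lambda>x. arcsin (c * f x))"
      proof (intro continuous_on_arcsin continuous_on_mult_left continuous_on_subset[OF cont_f] ballI)
        show "- 1 \<le> c * f y \<and> c * f y \<le> 1" if "y \<in> {0..x}" for y
          using abs1[of y] x(1) that by (auto simp: abs_less_iff)
      qed (use x in auto)
      show "continuous_on {0..x} ((*) c)" by (intro continuous_intros)
      fix y assume y: "0 < y" "y < x"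
      then have ya: "y \<in> {0<..<a}" "y \<in> {0..<a}" using x by auto
      show "((\<lambda>x. arcsin (c * f x)) has_real_derivative inverse (sqrt (1 - (c * f y)\<^sup>2)) * (c * f1 y)) (at y)"
        using abs1[OF ya(2)] deriv_f[OF ya(1)]
        by (intro DERIV_chain2[OF DERIV_arcsin] DERIV_cmult) auto
      show "((*) c has_real_derivative c) (at y)" by (auto intro!: derivative_eq_intros)
      have "(f1 y)\<^sup>2 \<le> 1 - (c * f y)\<^sup>2"
        using defect_nonneg[of y] ya unfolding defect_def power_mult_distrib by simp
      then have "f1 y \<le> sqrt (1 - (c * f y)\<^sup>2)"
        using real_le_rsqrt by blast
      moreover have "sqrt (1 - (c * f y)\<^sup>2) > 0" using lt[OF ya(2)] by simp
      ultimately have "f1 y / sqrt (1 - (c * f y)\<^sup>2) \<le> 1" by simp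
      then have "c * (f1 y / sqrt (1 - (c * f y)\<^sup>2)) \<le> c * 1"
        using c_ge by (intro mult_left_mono) auto
      then show "inverse (sqrt (1 - (c * f y)\<^sup>2)) * (c * f1 y) \<le> c" by (simp add: field_simps)
    qed (use x in auto)
    then have "sin (arcsin (c * f x)) \<le> sin (c * x)"
      using x abs1[OF x(1)] c_ge arcsin_bounded[of "c * f x"] by (intro sin_monotone_2pi_le) (auto simp: f_0 abs_less_iff)
    then show ?thesis using abs1[OF x(1)] by (simp add: abs_less_iff)
  qed
  show ?thesis
  proof (cases "s = a")
    case False
    then show ?thesis using main assms by simp
  next
    case True
    \<comment> \<open>The strict bound \<open>c * f < 1\<close> can fail at \<open>a\<close>, where
      \<open>f1\<close> vanishes, so this end point is reached as a limit from the left.\<close>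
    have "((\<lambda>x. c * f x) \<longlongrightarrow> c * f a) (at_left a)"
      using cont_f a_pos by (intro tendsto_intros) (auto simp: continuous_on_Icc_at_leftD)
    moreover have "((\<lambda>x. sin (c * x)) \<longlongrightarrow> sin (c * a)) (at_left a)"
      by (intro tendsto_intros)
    moreover have "\<forall>\<^sub>F x in at_left a. c * f x \<le> sin (c * x)"
    proof -
      have "\<forall>\<^sub>F x in at_left a. x \<in> {0<..<a}" using a_pos by (rule eventually_at_left_real)
      then show ?thesis
      proof eventually_elim
        case (elim x)
        have "c * x \<le> c * a" using elim c_ge by (intro mult_left_mono) auto
        then show ?case using main[of x] elim assms True by auto
      qed
    qed
    ultimately show ?thesis unfolding True
      by (intro tendsto_le[OF trivial_limit_at_left_real]) auto
  qed
qed

text \<open>\<open>\<rho>\<close> separates small from large values of \<open>f\<close>. Dividing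
  \<open>weighted_defect_le\<close> by \<open>\<rho> ^ N\<close> bounds the defect by
  \<open>\<eta>\<close> where \<open>f \<ge> \<rho>\<close>. The error \<open>\<beta>\<close> in the
  derivative has to cover \<open>sqrt \<eta>\<close> above the threshold, from taking a root, and
  \<open>\<rho>^2 + \<eta>\<close> below it. The bound on \<open>real N * \<eta>\<close> keeps
  \<open>f2\<close> away from 0 past the quarter period.\<close>

context
  fixes \<rho> \<eta> \<beta> :: real
  assumes rho: "0 < \<rho>" "\<rho> \<le> 1 / 4"
    and eta: "2 ^ N * (1 - c ^ 4) / \<rho> ^ N \<le> \<eta>" "real N * \<eta> \<le> 1 / 8"
    and beta: "\<rho>\<^sup>2 + sqrt \<eta> \<le> \<beta>" "\<beta> \<le> 1 / 4"
begin

lemma eta_nonneg: "\<eta> \<ge> 0"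
proof -
  have "c ^ 4 \<le> 1" using c_ge c_le by (intro power_le_one) auto
  then have "0 \<le> 2 ^ N * (1 - c ^ 4) / \<rho> ^ N" using rho by simp
  then show ?thesis using eta(1) by linarith
qed

lemma eta_le: "\<eta> \<le> 1 / 8" "\<eta> \<le> sqrt \<eta>"
proof -
  show le: "\<eta> \<le> 1 / 8"
    using mult_right_mono[of 1 "real N" \<eta>] N_pos eta_nonneg eta(2) by simp
  have "\<eta> * \<eta> \<le> 1 * \<eta>" using le eta_nonneg by (intro mult_right_mono) auto
  then show "\<eta> \<le> sqrt \<eta>" by (intro real_le_rsqrt) (simp add: power2_eq_square)
qed

lemma beta_pos: "\<beta> > 0"
  using beta(1) rho eta_nonneg by (smt (verit) real_sqrt_ge_zero zero_less_power)

lemma beta_le_sqrt: "\<beta> \<le> sqrt \<beta>"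
proof -
  have "\<beta> * \<beta> \<le> 1 * \<beta>" using beta(2) beta_pos by (intro mult_right_mono) auto
  then show ?thesis by (intro real_le_rsqrt) (simp add: power2_eq_square)
qed

lemma defect_le_eta:
  assumes "s \<in> {0..a}" "f s \<ge> \<rho>"
  shows "defect s \<le> \<eta>"
proof -
  have "\<rho> ^ N * defect s \<le> f s ^ N * defect s"
    using assms rho defect_nonneg by (intro mult_right_mono power_mono) auto
  also have "\<dots> \<le> 2 ^ N * (1 - c ^ 4)" by (rule weighted_defect_le[OF assms(1)])
  finally have "defect s \<le> 2 ^ N * (1 - c ^ 4) / \<rho> ^ N" using rho by (simp add: field_simps)
  then show ?thesis using eta(1) by linarith
qed

text \<open>Where \<open>f \<ge> \<rho>\<close> the defect is small, and \<open>cf_le_sin\<close>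
  replaces \<open>1 - c^2 f^2\<close> by \<open>cos^2\<close>. Where \<open>f < \<rho>\<close>, go
  on to the point \<open>t\<close> with \<open>f t = \<rho>\<close>: since \<open>f1\<close>
  decreases and lies in \<open>[0, 1]\<close>,
  \<open>f1 s \<ge> f1 t \<ge> (f1 t)^2 \<ge> 1 - \<rho>^2 - \<eta>\<close>.\<close>

lemma f1_ge_cos:
  assumes "s \<in> {0..a}" "c * s \<le> pi / 2"
  shows "f1 s \<ge> cos (c * s) - \<beta>"
proof (cases "f s \<ge> \<rho>")
  case True
  have cs: "0 \<le> c * s" using assms c_ge by simp
  have "(c * f s)\<^sup>2 \<le> (sin (c * s))\<^sup>2"
    using cf_le_sin[OF assms] f_nonneg[OF assms(1)] c_ge by (intro power_mono) auto
  then have "(cos (c * s))\<^sup>2 \<le> (f1 s)\<^sup>2 + \<eta>"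
    using defect_le_eta[OF assms(1) True] unfolding defect_def power_mult_distrib cos_squared_eq by linarith
  also have "\<dots> \<le> (f1 s + sqrt \<eta>)\<^sup>2"
    using f1_nonneg[OF assms(1)] eta_nonneg by (simp add: power2_sum)
  finally have "cos (c * s) \<le> f1 s + sqrt \<eta>"
    by (rule power2_le_imp_le) (use f1_nonneg[OF assms(1)] eta_nonneg in auto)
  then show ?thesis using beta(1) zero_le_power2[of \<rho>] by linarith
next
  case False
  have "\<rho> \<le> f a" using rho wide c_ge by linarith
  then obtain t where t: "s \<le> t" "t \<le> a" "f t = \<rho>"
    using IVT'[of f s \<rho> a] False assms(1) continuous_on_subset[OF cont_f, of "{s..a}"] by auto
  have ta: "t \<in> {0..a}" using t assms(1) by auto
  have "c\<^sup>2 * \<rho>\<^sup>2 \<le> 1 * \<rho>\<^sup>2" using c_le c_ge by (intro mult_right_mono power_le_one) auto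
  then have "1 - \<rho>\<^sup>2 - \<eta> \<le> (f1 t)\<^sup>2"
    using defect_le_eta[OF ta] t by (simp add: defect_def)
  also have "\<dots> \<le> 1 * f1 t"
    unfolding power2_eq_square using f1_nonneg[OF ta] f1_le_1[OF ta] by (intro mult_right_mono) auto
  also have "\<dots> \<le> f1 s" using f1_antimono[of s t] t assms(1) by simp
  finally show ?thesis using beta(1) eta_le(2) cos_le_one[of "c * s"] by linarith
qed

text \<open>Integrate \<open>f1_ge_cos\<close> from the pole; the error accumulates to
  \<open>\<beta>\<close> times \<open>c s \<le> pi / 2 < 2\<close>.\<close>

lemma cf_ge_sin:
  assumes "s \<in> {0..a}" "c * s \<le> pi / 2"
  shows "c * f s \<ge> sin (c * s) - 2 * \<beta>"
proof -
  have "(sin (c * s) - c * \<beta> * s) - (sin (c * 0) - c * \<beta> * 0) \<le> c * f s - c * f 0"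
  proof (rule deriv_le_imp_diff_le)
    show "continuous_on {0..s} (\<lambda>x. c * f x)"
      using assms by (intro continuous_intros continuous_on_subset[OF cont_f]) auto
    fix x assume x: "0 < x" "x < s"
    then have xa: "x \<in> {0<..<a}" using assms by auto
    show "((\<lambda>x. sin (c * x) - c * \<beta> * x) has_real_derivative c * cos (c * x) - c * \<beta>) (at x)"
      by (auto intro!: derivative_eq_intros)
    show "((\<lambda>x. c * f x) has_real_derivative c * f1 x) (at x)"
      by (intro DERIV_cmult deriv_f xa)
    have "c * x \<le> c * s" using x c_ge by (intro mult_left_mono) auto
    then have "cos (c * x) - \<beta> \<le> f1 x" using f1_ge_cos[of x] xa assms(2) by auto
    then have "c * (cos (c * x) - \<beta>) \<le> c * f1 x" using c_ge by (intro mult_left_mono) auto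
    then show "c * cos (c * x) - c * \<beta> \<le> c * f1 x" by (simp add: algebra_simps)
  qed (use assms in \<open>auto intro!: continuous_intros\<close>)
  moreover have "c * s * \<beta> \<le> 2 * \<beta>"
    using assms(2) pi_less_4 beta_pos by (intro mult_right_mono) auto
  ultimately show ?thesis by (simp add: f_0 algebra_simps)
qed

text \<open>The lower bound on \<open>f\<close> feeds back into the derivative: nonnegative defect
  gives \<open>f1^2 \<le> 1 - (c f)^2\<close>, which exceeds \<open>cos^2\<close> by at most
  \<open>4 \<beta>\<close>. Taking the root of this error is what turns \<open>\<beta>\<close> into
  \<open>sqrt \<beta>\<close>.\<close>

lemma f1_le_cos:
  assumes "s \<in> {0..a}" "c * s \<le> pi / 2"
  shows "f1 s \<le> cos (c * s) + 2 * sqrt \<beta>"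
proof -
  have cs: "0 \<le> c * s" using assms c_ge by simp
  have sin0: "sin (c * s) \<ge> 0" using cs assms(2) by (intro sin_ge_zero) auto
  have cos0: "cos (c * s) \<ge> 0" using cs assms(2) by (intro cos_ge_zero) auto
  have "(sin (c * s))\<^sup>2 - 4 * \<beta> \<le> (c * f s)\<^sup>2"
  proof (cases "sin (c * s) \<ge> 2 * \<beta>")
    case True
    then have "(sin (c * s) - 2 * \<beta>)\<^sup>2 \<le> (c * f s)\<^sup>2"
      using cf_ge_sin[OF assms] by (intro power_mono) auto
    moreover have "4 * \<beta> * sin (c * s) \<le> 4 * \<beta> * 1"
      using beta_pos by (intro mult_left_mono) auto
    moreover have "(sin (c * s) - 2 * \<beta>)\<^sup>2 = (sin (c * s))\<^sup>2 - 4 * \<beta> * sin (c * s) + 4 * \<beta>\<^sup>2"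
      by (simp add: power2_eq_square algebra_simps)
    ultimately show ?thesis using zero_le_power2[of \<beta>] by linarith
  next
    case False
    have "(sin (c * s))\<^sup>2 \<le> sin (c * s) * 1"
      unfolding power2_eq_square using sin0 by (intro mult_left_mono) auto
    then show ?thesis using False beta_pos zero_le_power2[of "c * f s"] by linarith
  qed
  then have "(f1 s)\<^sup>2 \<le> (cos (c * s))\<^sup>2 + 4 * \<beta>"
    using defect_nonneg[OF assms(1)] unfolding defect_def power_mult_distrib cos_squared_eq by linarith
  also have "\<dots> \<le> (cos (c * s) + 2 * sqrt \<beta>)\<^sup>2"
    using cos0 beta_pos by (simp add: power2_sum power_mult_distrib)
  finally show ?thesis by (rule power2_le_imp_le) (use cos0 beta_pos in auto)
qed

text \<open>Since \<open>f1 a = 0\<close>, the lower bound on \<open>f1\<close> makes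
  \<open>cos (c a) \<le> \<beta>\<close>, and \<open>sin_ge_third\<close> applied to
  \<open>pi / 2 - c a\<close> converts this into a bound on \<open>a\<close>.\<close>

lemma length_ge: "a \<ge> pi / 2 - 3 * \<beta>"
proof (cases "c * a \<le> pi / 2")
  case True
  have ca: "0 \<le> c * a" using a_pos c_ge by simp
  have "(pi / 2 - c * a) / 3 \<le> sin (pi / 2 - c * a)"
    using ca True pi_less_4 by (intro sin_ge_third) auto
  also have "\<dots> = cos (c * a)" by (simp add: sin_diff)
  also have "\<dots> \<le> \<beta>" using f1_ge_cos[of a] True a_pos f1_a by simp
  finally have "c * a \<ge> pi / 2 - 3 * \<beta>" by simp
  moreover have "c * a \<le> 1 * a" using c_le a_pos by (intro mult_right_mono) auto
  ultimately show ?thesis by linarith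
next
  case False
  have "c * a \<le> 1 * a" using c_le a_pos by (intro mult_right_mono) auto
  then show ?thesis using False beta_pos by linarith
qed

lemma f1_quarter:
  assumes "pi / (2 * c) \<in> {0..a}"
  shows "f1 (pi / (2 * c)) \<le> 2 * sqrt \<beta>"
  using f1_le_cos[OF assms] c_ge by simp

text \<open>Past the quarter period \<open>b\<close> the comparison with the cosine is no longer
  available. But \<open>f\<close> stays large up to \<open>a\<close>, so the defect is small and the
  scalar curvature inequality forces \<open>f2 \<le> - 1 / 8\<close>. Starting from at most
  \<open>2 sqrt \<beta>\<close> at \<open>b\<close>, the derivative reaches 0 within
  \<open>16 sqrt \<beta>\<close>.\<close>

lemma length_le: "a \<le> pi / (2 * c) + 16 * sqrt \<beta>"
proof (cases "a \<le> pi / (2 * c)")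
  case True
  moreover have "sqrt \<beta> \<ge> 0" using beta_pos by simp
  ultimately show ?thesis by linarith
next
  case False
  define b where "b = pi / (2 * c)"
  have b: "0 < b" "b < a" using False c_ge by (auto simp: b_def)
  have cb: "c * b = pi / 2" using c_ge by (simp add: b_def)
  have "c * f b \<ge> 1 / 2"
    using cf_ge_sin[of b] b beta(2) unfolding cb by simp
  then have fb: "c * f s \<ge> 1 / 2" "f s \<ge> 1 / 2" if "b \<le> s" "s \<le> a" for s
  proof -
    have "c * f b \<le> c * f s" using f_mono[of b s] that b c_ge by (intro mult_left_mono) auto
    then show *: "c * f s \<ge> 1 / 2" using \<open>c * f b \<ge> 1 / 2\<close> by linarith
    have "c * f s \<le> 1 * f s" using c_le f_nonneg[of s] that b by (intro mult_right_mono) auto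
    then show "f s \<ge> 1 / 2" using * by linarith
  qed
  have f2: "f2 s \<le> - (1 / 8)" if s: "b < s" "s < a" for s
  proof -
    have sa: "s \<in> {0<..<a}" using s b by auto
    have "real N * defect s \<le> real N * \<eta>"
      using defect_le_eta[of s] fb(2)[of s] s b rho by (intro mult_left_mono) auto
    then have Nd: "real N * defect s \<le> 1 / 8" using eta(2) by linarith
    have "real N * (1 - (f1 s)\<^sup>2) - 2 * f s * f2 s \<ge> (real N + 2) * c\<^sup>2 * (f s)\<^sup>2" by (rule scal[OF sa])
    \<comment> \<open>\<open>N (1 - f1^2) - (N + 2) c^2 f^2\<close> is \<open>N\<close> times the
      defect minus \<open>2 (c f)^2\<close>.\<close>
    then have "2 * f s * f2 s \<le> real N * defect s - 2 * (c * f s) * (c * f s)"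
      by (simp add: defect_def algebra_simps power2_eq_square)
    also have "\<dots> \<le> f s * (1 / 4) - 2 * (c * (1 / 2) * f s)"
    proof -
      have "real N * defect s \<le> f s * (1 / 4)" using Nd fb(2)[of s] s by linarith
      moreover have "(1 / 2) * (c * f s) \<le> (c * f s) * (c * f s)"
        using fb(1)[of s] s by (intro mult_right_mono) auto
      ultimately show ?thesis by linarith
    qed
    also have "\<dots> \<le> f s * (1 / 4) - 2 * (1 / 2 * (1 / 2) * f s)"
      using c_ge f_nonneg[of s] sa by (intro diff_left_mono mult_left_mono mult_right_mono) auto
    finally have "f s * (2 * f2 s) \<le> f s * - (1 / 4)" by (simp add: algebra_simps)
    then have "2 * f2 s \<le> - (1 / 4)"
      using fb(2)[of s] s mult_le_cancel_left_pos[of "f s" "2 * f2 s" "- (1 / 4)"] by simp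
    then show ?thesis by linarith
  qed
  have "f1 a - f1 b \<le> - (1 / 8) * a - - (1 / 8) * b"
  proof (rule deriv_le_imp_diff_le)
    show "continuous_on {b..a} f1" using cont_f1 b by (auto intro: continuous_on_subset)
    show "((\<lambda>x. - (1 / 8) * x) has_real_derivative - (1 / 8)) (at x)" for x
      by (auto intro!: derivative_eq_intros)
    show "(f1 has_real_derivative f2 x) (at x)" if "b < x" "x < a" for x
      using deriv_f1[of x] that b by auto
    show "f2 x \<le> - (1 / 8)" if "b < x" "x < a" for x using f2 that .
  qed (use b in \<open>auto intro!: continuous_intros\<close>)
  moreover have "f1 b \<le> 2 * sqrt \<beta>" using f1_quarter b by (simp add: b_def)
  ultimately show ?thesis using f1_a by (simp add: b_def[symmetric])
qed

lemma quarter_period: "pi / (2 * c) - pi / 2 \<le> 4 * (1 - c)" "pi / 2 \<le> pi / (2 * c)" "pi / (2 * c) < 4"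
proof -
  have "pi * (1 - c) \<le> 4 * (1 - c)" using pi_less_4 c_le by (intro mult_right_mono) auto
  moreover have "4 * (1 - c) \<le> (4 * (1 - c)) * (2 * c)" using c_ge c_le mult_left_mono[of 1 "2 * c" "4 * (1 - c)"] by auto
  ultimately have "pi * (1 - c) \<le> 4 * (1 - c) * (2 * c)" by linarith
  then show "pi / (2 * c) - pi / 2 \<le> 4 * (1 - c)" using c_ge by (simp add: field_simps)
  show "pi / 2 \<le> pi / (2 * c)" using c_le c_ge by (simp add: field_simps)
  have "pi < 4 * (2 * c)" using pi_less_4 c_ge by linarith
  then show "pi / (2 * c) < 4" using c_ge by (simp add: field_simps)
qed

text \<open>\<open>4 (1 - c)\<close> pays for replacing \<open>c s\<close> by \<open>s\<close> and
  \<open>pi / (2 c)\<close> by \<open>pi / 2\<close>. Past the quarter period \<open>f1\<close> lies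
  between 0 and \<open>2 sqrt \<beta>\<close> while \<open>\<bar>cos s\<bar>\<close> is at most the
  overshoot \<open>s - pi / 2\<close>, so 18 is \<open>16 + 2\<close>.\<close>

lemma profile_close:
  shows "\<bar>a - pi / 2\<bar> \<le> 4 * (1 - c) + 18 * sqrt \<beta>"
    and "s \<in> {0..a} \<Longrightarrow> \<bar>f1 s - cos s\<bar> \<le> 4 * (1 - c) + 18 * sqrt \<beta>"
proof -
  have sq: "sqrt \<beta> \<ge> 0" using beta_pos by simp
  show "\<bar>a - pi / 2\<bar> \<le> 4 * (1 - c) + 18 * sqrt \<beta>"
  proof -
    define b r where "b = pi / (2 * c)" and "r = sqrt \<beta>"
    show ?thesis
      using length_ge length_le[folded b_def r_def] quarter_period(1)[folded b_def] c_le
        beta_le_sqrt[folded r_def] sq[folded r_def] beta_pos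
      unfolding r_def[symmetric] by (smt (verit))
  qed
  assume s: "s \<in> {0..a}"
  show "\<bar>f1 s - cos s\<bar> \<le> 4 * (1 - c) + 18 * sqrt \<beta>"
  proof (cases "c * s \<le> pi / 2")
    case True
    have "s \<le> pi / (2 * c)" using True c_ge by (simp add: field_simps)
    then have "\<bar>c * s - s\<bar> \<le> 4 * (1 - c)"
      using s c_le quarter_period(3) mult_right_mono[of s 4 "1 - c"] mult_nonneg_nonneg[of s "1 - c"]
      by (simp add: algebra_simps abs_if)
    then have "\<bar>cos (c * s) - cos s\<bar> \<le> 4 * (1 - c)"
      using abs_cos_diff_le[of "c * s" s] by linarith
    then show ?thesis
      using f1_ge_cos[OF s True] f1_le_cos[OF s True] beta_le_sqrt sq by linarith
  next
    case False
    have "pi / (2 * c) \<le> s" using False c_ge by (simp add: field_simps)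
    then have "f1 s \<le> 2 * sqrt \<beta>"
      using f1_quarter f1_antimono[of "pi / (2 * c)" s] s c_ge by auto
    moreover have "\<bar>cos s\<bar> \<le> s - pi / 2"
      using abs_cos_diff_le[of s "pi / 2"] \<open>pi / (2 * c) \<le> s\<close> quarter_period(2) by simp
    ultimately show ?thesis
      using f1_nonneg[OF s] length_le quarter_period(1) s sq by auto
  qed
qed

text \<open>Integration from the pole makes the error proportional to \<open>s\<close>, which is
  what later permits division by the sine.\<close>

lemma f_close:
  assumes "s \<in> {0..a}"
  shows "\<bar>f s - sin s\<bar> \<le> (4 * (1 - c) + 18 * sqrt \<beta>) * s"
proof -
  let ?t = "4 * (1 - c) + 18 * sqrt \<beta>"
  have cont: "continuous_on {0..s} f" using assms cont_f by (auto intro: continuous_on_subset)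
  have "f s - f 0 \<le> (sin s + ?t * s) - (sin 0 + ?t * 0)"
  proof (rule deriv_le_imp_diff_le[OF _ cont])
    fix x assume x: "0 < x" "x < s"
    show "(f has_real_derivative f1 x) (at x)" using deriv_f[of x] x assms by auto
    show "((\<lambda>x. sin x + ?t * x) has_real_derivative cos x + ?t) (at x)"
      by (auto intro!: derivative_eq_intros)
    show "f1 x \<le> cos x + ?t" using profile_close(2)[of x] x assms by auto
  qed (use assms in \<open>auto intro!: continuous_intros\<close>)
  moreover have "(sin s - ?t * s) - (sin 0 - ?t * 0) \<le> f s - f 0"
  proof (rule deriv_le_imp_diff_le[OF _ _ cont])
    fix x assume x: "0 < x" "x < s"
    show "(f has_real_derivative f1 x) (at x)" using deriv_f[of x] x assms by auto
    show "((\<lambda>x. sin x - ?t * x) has_real_derivative cos x - ?t) (at x)"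
      by (auto intro!: derivative_eq_intros)
    show "cos x - ?t \<le> f1 x" using profile_close(2)[of x] x assms by auto
  qed (use assms in \<open>auto intro!: continuous_intros\<close>)
  ultimately show ?thesis by (simp add: f_0 abs_le_iff)
qed

end

end

section \<open>Comparison of the profile with the sine\<close>

text \<open>\<open>\<tau>\<close> determines \<open>\<beta>\<close>, then \<open>\<beta>\<close> and
  \<open>N\<close> determine \<open>\<rho>\<close> and \<open>\<eta>\<close>, each paying half of
  \<open>\<beta>\<close>. Last comes \<open>c\<close>: the conditions that tie it to the others hold
  strictly at \<open>c = 1\<close>, hence also just below 1.\<close>

lemma pinching_parameters:
  fixes N :: nat and \<tau> :: real
  assumes N: "N \<ge> 1" and \<tau>: "\<tau> > 0"
  obtains c \<rho> \<eta> \<beta> :: real where "1 / 2 \<le> c" "c < 1" "real N < (real N + 2) * c ^ 4"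
    "0 < \<rho>" "\<rho> \<le> 1 / 4" "2 ^ N * (1 - c ^ 4) / \<rho> ^ N \<le> \<eta>" "real N * \<eta> \<le> 1 / 8"
    "\<rho>\<^sup>2 + sqrt \<eta> \<le> \<beta>" "\<beta> \<le> 1 / 4" "4 * (1 - c) + 18 * sqrt \<beta> \<le> \<tau>"
proof -
  define \<beta> where "\<beta> = min (1 / 4) ((\<tau> / 36)\<^sup>2)"
  define \<rho> where "\<rho> = min (1 / 4) (sqrt (\<beta> / 2))"
  define \<eta> where "\<eta> = min ((\<beta> / 2)\<^sup>2) (1 / (8 * real N))"
  have \<beta>: "\<beta> > 0" "\<beta> \<le> 1 / 4" using \<tau> by (auto simp: \<beta>_def)
  have \<rho>: "\<rho> > 0" "\<rho> \<le> 1 / 4" using \<beta> by (auto simp: \<rho>_def)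
  have \<eta>: "\<eta> > 0" using \<beta> N by (auto simp: \<eta>_def)
  have "\<rho>\<^sup>2 \<le> (sqrt (\<beta> / 2))\<^sup>2" using \<rho> by (intro power_mono) (auto simp: \<rho>_def)
  then have \<rho>2: "\<rho>\<^sup>2 \<le> \<beta> / 2" using \<beta> by simp
  have "sqrt \<eta> \<le> sqrt ((\<beta> / 2)\<^sup>2)" by (intro real_sqrt_le_mono) (simp add: \<eta>_def)
  then have \<eta>1: "sqrt \<eta> \<le> \<beta> / 2" using \<beta> by simp
  have "real N * \<eta> \<le> real N * (1 / (8 * real N))" by (intro mult_left_mono) (auto simp: \<eta>_def)
  then have \<eta>2: "real N * \<eta> \<le> 1 / 8" using N by simp
  have "sqrt \<beta> \<le> sqrt ((\<tau> / 36)\<^sup>2)" by (intro real_sqrt_le_mono) (simp add: \<beta>_def)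
  then have \<beta>1: "18 * sqrt \<beta> \<le> \<tau> / 2" using \<tau> by simp
  have "((\<lambda>c. 2 ^ N * (1 - c ^ 4) / \<rho> ^ N) \<longlongrightarrow> 2 ^ N * (1 - 1 ^ 4) / \<rho> ^ N) (at_left 1)"
    using \<rho> by (intro tendsto_intros) auto
  then have ev1: "\<forall>\<^sub>F c in at_left 1. 2 ^ N * (1 - c ^ 4) / \<rho> ^ N < \<eta>"
    by (rule order_tendstoD) (use \<eta> in simp)
  have "((\<lambda>c. (real N + 2) * c ^ 4) \<longlongrightarrow> (real N + 2) * 1 ^ 4) (at_left 1)"
    by (intro tendsto_intros)
  then have ev2: "\<forall>\<^sub>F c in at_left 1. real N < (real N + 2) * c ^ 4"
    by (rule order_tendstoD) simp
  have "((\<lambda>c::real. 4 * (1 - c)) \<longlongrightarrow> 4 * (1 - 1)) (at_left 1)"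
    by (intro tendsto_intros)
  then have ev3: "\<forall>\<^sub>F c in at_left 1. 4 * (1 - c) < \<tau> / 2"
    by (rule order_tendstoD) (use \<tau> in simp)
  have ev4: "\<forall>\<^sub>F c in at_left (1::real). c \<in> {1 / 2<..<1}"
    by (rule eventually_at_left_real) simp
  have "\<forall>\<^sub>F c in at_left (1::real). 2 ^ N * (1 - c ^ 4) / \<rho> ^ N < \<eta> \<and> real N < (real N + 2) * c ^ 4
      \<and> 4 * (1 - c) < \<tau> / 2 \<and> c \<in> {1 / 2<..<1}"
    using ev1 ev2 ev3 ev4 by eventually_elim simp
  then obtain c where c: "2 ^ N * (1 - c ^ 4) / \<rho> ^ N < \<eta>" "real N < (real N + 2) * c ^ 4"
      "4 * (1 - c) < \<tau> / 2" "c \<in> {1 / 2<..<1}"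
    using eventually_happens'[OF trivial_limit_at_left_real] by blast
  show ?thesis
  proof (rule that[of c \<rho> \<eta> \<beta>])
    show "4 * (1 - c) + 18 * sqrt \<beta> \<le> \<tau>" using c \<beta>1 by simp
    show "\<rho>\<^sup>2 + sqrt \<eta> \<le> \<beta>" using \<rho>2 \<eta>1 by simp
  qed (use c \<rho> \<beta> \<eta>2 in auto)
qed

section \<open>The whole profile: a single critical point and two rising halves\<close>

context warped_sphere
begin

lemma cont_d: "continuous_on {0..D} (d k)"
  by (rule DERIV_continuous_on) (rule deriv_d_within)

lemma cont_f: "continuous_on {0..D} f"
  using cont_d[of 0] d_0 continuous_on_cong[of "{0..D}" "{0..D}" "d 0" f] by simp

context
  fixes N :: nat and c :: real
  assumes concave: "\<And>s. s \<in> {0<..<D} \<Longrightarrow> d 2 s \<le> 0"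
    and scal: "\<And>s. s \<in> {0<..<D} \<Longrightarrow> real N * (1 - (d 1 s)\<^sup>2) - 2 * f s * d 2 s \<ge> (real N + 2) * c\<^sup>2 * (f s)\<^sup>2"
    and wide: "\<exists>s\<in>{0..D}. c \<le> f s"
    and N_pos: "N \<ge> 1" and c: "1 / 2 \<le> c" "c \<le> 1" and pinch: "real N < (real N + 2) * c ^ 4"
begin

lemma d1_antimono:
  assumes "0 \<le> s" "s \<le> t" "t \<le> D"
  shows "d 1 t \<le> d 1 s"
proof -
  have "- d 1 s \<le> - d 1 t"
  proof (rule deriv_nonneg_imp_le[where f = "\<lambda>x. - d 1 x" and f' = "\<lambda>x. - d 2 x", OF assms(2)])
    show "continuous_on {s..t} (\<lambda>x. - d 1 x)"
      using assms by (intro continuous_on_minus continuous_on_subset[OF cont_d]) auto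
    show "((\<lambda>x. - d 1 x) has_real_derivative - d 2 x) (at x)" if "s < x" "x < t" for x
      using deriv_d[of x 1] that assms by (intro DERIV_minus) (auto simp: numeral_2_eq_2)
  qed (use concave assms in auto)
  then show ?thesis by simp
qed

lemma f_le_critical:
  assumes "z \<in> {0..D}" "d 1 z = 0" "s \<in> {0..D}"
  shows "f s \<le> f z"
proof (cases "s \<le> z")
  case True
  then show ?thesis
  proof (rule deriv_nonneg_imp_le[where f = f and f' = "d 1"])
    show "continuous_on {s..z} f" using assms by (intro continuous_on_subset[OF cont_f]) auto
    show "(f has_real_derivative d 1 x) (at x)" if "s < x" "x < z" for x
      using that assms deriv_f[of x] by auto
    show "0 \<le> d 1 x" if "s < x" "x < z" for x
      using that assms d1_antimono[of x z] by auto
  qed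
next
  case False
  then have "z \<le> s" by simp
  then have "- f z \<le> - f s"
  proof (rule deriv_nonneg_imp_le[where f = "\<lambda>x. - f x" and f' = "\<lambda>x. - d 1 x"])
    show "continuous_on {z..s} (\<lambda>x. - f x)"
      using assms by (intro continuous_on_minus continuous_on_subset[OF cont_f]) auto
    show "((\<lambda>x. - f x) has_real_derivative - d 1 x) (at x)" if "z < x" "x < s" for x
      using that assms deriv_f[of x] by (intro DERIV_minus) auto
    show "0 \<le> - d 1 x" if "z < x" "x < s" for x
      using that assms d1_antimono[of z x] by auto
  qed
  then show ?thesis by simp
qed

lemma critical_wide:
  assumes "z \<in> {0..D}" "d 1 z = 0"
  shows "c \<le> f z"
  using wide f_le_critical[OF assms] by force

text \<open>Between two critical points \<open>d 1\<close> vanishes by monotonicity, hence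
  \<open>d 2\<close> does too. As \<open>f \<ge> c\<close> at critical points, the scalar curvature
  inequality becomes \<open>(N + 2) c^4 \<le> N\<close>, against \<open>pinch\<close>. Uniqueness
  provides the strict positivity of the derivative before the maximum that
  \<open>rising_profile\<close> asks for.\<close>

lemma critical_unique:
  assumes "0 \<le> s" "s < t" "t \<le> D" "d 1 s = 0" "d 1 t = 0"
  shows False
proof -
  have zero: "d 1 x = 0" if "x \<in> {s<..<t}" for x
    using d1_antimono[of s x] d1_antimono[of x t] assms that by auto
  define x where "x = (s + t) / 2"
  have x: "x \<in> {s<..<t}" using assms by (auto simp: x_def)
  then have xD: "x \<in> {0<..<D}" using assms by auto
  have "(d 1 has_real_derivative d 2 x) (at x)"
    using deriv_d[OF xD, of 1] by (simp add: numeral_2_eq_2)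
  then have "((\<lambda>x. 0) has_real_derivative d 2 x) (at x)"
    by (rule has_field_derivative_transform_within_open[OF _ open_greaterThanLessThan x]) (rule zero)
  then have d2: "d 2 x = 0" by (rule DERIV_unique) (rule DERIV_const)
  have "c\<^sup>2 * c\<^sup>2 \<le> c\<^sup>2 * (f x)\<^sup>2"
    by (rule mult_left_mono[OF power_mono]) (use critical_wide[of x] zero[OF x] xD c in auto)
  then have "(real N + 2) * (c\<^sup>2 * c\<^sup>2) \<le> (real N + 2) * (c\<^sup>2 * (f x)\<^sup>2)"
    by (rule mult_left_mono) simp
  also have "\<dots> \<le> real N" using scal[OF xD] d2 zero[OF x] by (simp add: mult.assoc)
  finally show False using pinch by (simp add: power2_eq_square power4_eq_xxxx mult.assoc)
qed

text \<open>Each side of the critical point is a \<open>rising_profile\<close>, the far side after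
  the reflection of \<open>s\<close> to \<open>D - s\<close>. The sine is symmetric under the same
  reflection.\<close>

lemma profile_near_sine:
  assumes rho: "0 < \<rho>" "\<rho> \<le> 1 / 4"
    and eta: "2 ^ N * (1 - c ^ 4) / \<rho> ^ N \<le> \<eta>" "real N * \<eta> \<le> 1 / 8"
    and beta: "\<rho>\<^sup>2 + sqrt \<eta> \<le> \<beta>" "\<beta> \<le> 1 / 4"
    and tau: "4 * (1 - c) + 18 * sqrt \<beta> \<le> \<tau>" "\<tau> \<le> 1 / 10"
  shows "\<bar>D - pi\<bar> \<le> 2 * \<tau>"
    and "s \<in> {0<..<D} \<Longrightarrow> \<bar>f s - sin (pi * s / D)\<bar> \<le> 18 * \<tau> * sin (pi * s / D)"
proof -
  have D: "D > 0" by (rule D_pos)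
  obtain a where a: "0 \<le> a" "a \<le> D" "d 1 a = 0"
    using IVT2'[of "d 1" D 0 0] cont_d[of 1] D d_start d_end by auto
  have "a \<noteq> 0" "a \<noteq> D" using a d_start d_end by auto
  with a have aD: "0 < a" "a < D" by auto
  have pos: "d 1 s > 0" if "s \<in> {0..<a}" for s
    using d1_antimono[of s a] critical_unique[of s a] that a by (force simp: less_le)
  have neg: "d 1 s < 0" if "s \<in> {a<..D}" for s
    using d1_antimono[of a s] critical_unique[of a s] that a by (force simp: less_le)
  interpret R1: rising_profile f "d 1" "d 2" a c N
  proof
    show "continuous_on {0..a} f" "continuous_on {0..a} (d 1)"
      using aD by (auto intro: continuous_on_subset[OF cont_f] continuous_on_subset[OF cont_d])
    show "(d 1 has_real_derivative d 2 s) (at s)" if "s \<in> {0<..<a}" for s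
      using deriv_d[of s 1] that aD by (simp add: numeral_2_eq_2)
    show "c \<le> f a" using critical_wide a by simp
  qed (use aD a pos concave scal N_pos c f_0 d_start deriv_f in auto)
  interpret R2: rising_profile "\<lambda>s. f (D - s)" "\<lambda>s. - d 1 (D - s)" "\<lambda>s. d 2 (D - s)" "D - a" c N
  proof
    show "continuous_on {0..D - a} (\<lambda>s. f (D - s))" "continuous_on {0..D - a} (\<lambda>s. - d 1 (D - s))"
      using aD by (auto intro!: continuous_intros continuous_on_compose2[OF cont_f] continuous_on_compose2[OF cont_d])
    have sub: "((\<lambda>s. D - s) has_real_derivative - 1) (at s)" for s
      by (auto intro!: derivative_eq_intros)
    show "((\<lambda>s. f (D - s)) has_real_derivative - d 1 (D - s)) (at s)" if "s \<in> {0<..<D - a}" for s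
      using DERIV_chain2[OF deriv_f sub, of s] that aD by simp
    show "((\<lambda>s. - d 1 (D - s)) has_real_derivative d 2 (D - s)) (at s)" if "s \<in> {0<..<D - a}" for s
      using DERIV_minus[OF DERIV_chain2[OF deriv_d[of "D - s" 1] sub]] that aD
      by (simp add: numeral_2_eq_2)
    show "c \<le> f (D - (D - a))" using critical_wide a by simp
    show "- d 1 (D - s) > 0" if "s \<in> {0..<D - a}" for s using neg[of "D - s"] that aD by simp
  qed (use aD a concave scal N_pos c f_D d_end in auto)
  note hyps = rho eta beta
  have a1: "\<bar>a - pi / 2\<bar> \<le> \<tau>" "\<bar>D - a - pi / 2\<bar> \<le> \<tau>"
    using R1.profile_close(1)[OF hyps] R2.profile_close(1)[OF hyps] tau by linarith+
  then show Dpi: "\<bar>D - pi\<bar> \<le> 2 * \<tau>" by linarith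
  have \<tau>: "\<tau> \<ge> 0" using a1 by linarith
  \<comment> \<open>Turns the error \<open>\<tau> s\<close> of one half into a relative error at the
    angle \<open>x = pi s / D\<close>. Since \<open>s \<le> 2 x\<close> and
    \<open>\<bar>s - x\<bar> \<le> \<tau> x\<close>, the total is \<open>3 \<tau> x\<close>, and
    \<open>x \<le> 6 sin x\<close> yields 18.\<close>
  have main: "\<bar>h s - sin (pi * s / D)\<bar> \<le> 18 * \<tau> * sin (pi * s / D)"
    if "0 < s" "s \<le> b" "\<bar>b - pi / 2\<bar> \<le> \<tau>" "\<bar>h s - sin s\<bar> \<le> \<tau> * s" for h :: "real \<Rightarrow> real" and s b
  proof -
    define x where "x = pi * s / D"
    have xpos: "x > 0" using that D by (simp add: x_def)
    have s_eq: "s = D * x / pi" using D by (simp add: x_def)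
    have sx: "s - x = x * (D - pi) / pi" using D by (simp add: s_eq field_simps)
    have "\<bar>s - x\<bar> = x * (\<bar>D - pi\<bar> / pi)" using xpos by (simp add: sx abs_mult)
    also have "\<dots> \<le> x * (2 * \<tau> / 2)"
      using Dpi pi_ge_two \<tau> xpos by (intro mult_left_mono frac_le) auto
    finally have sx: "\<bar>s - x\<bar> \<le> x * \<tau>" by simp
    also have "x * \<tau> \<le> x * 1" using xpos tau by (intro mult_left_mono) auto
    finally have s2: "s \<le> 2 * x" by linarith
    \<comment> \<open>A half may extend beyond the middle of the interval, but only so far that
      \<open>x \<le> 2 pi / 3\<close>. Then \<open>pi - x \<ge> x / 2\<close>, so the bound for
      \<open>sin (pi - x)\<close> still gives \<open>x / 6\<close>.\<close>
    have "3 * b \<le> 2 * D" using that(3) Dpi pi_ge_two tau by linarith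
    then have "3 * s \<le> 2 * D" using that(2) by linarith
    then have "pi * (3 * s) \<le> pi * (2 * D)" by (intro mult_left_mono) auto
    then have x_le: "x \<le> 2 * pi / 3" using D by (simp add: x_def field_simps)
    have sinx: "x / 6 \<le> sin x"
    proof (cases "x \<le> pi / 2")
      case True
      then show ?thesis using sin_ge_third[of x] xpos pi_less_4 by simp
    next
      case False
      then have "(pi - x) / 3 \<le> sin (pi - x)"
        using x_le pi_less_4 by (intro sin_ge_third) auto
      then show ?thesis using x_le by simp
    qed
    have "\<bar>h s - sin x\<bar> \<le> \<bar>h s - sin s\<bar> + \<bar>sin s - sin x\<bar>" by linarith
    also have "\<dots> \<le> \<tau> * s + x * \<tau>" using that(4) abs_sin_diff_le[of s x] sx by linarith
    also have "\<dots> \<le> \<tau> * (2 * x) + x * \<tau>" using s2 \<tau> by (intro add_right_mono mult_left_mono)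
    also have "\<dots> = 18 * \<tau> * (x / 6)" by simp
    also have "\<dots> \<le> 18 * \<tau> * sin x" using sinx \<tau> by (intro mult_left_mono) auto
    finally show ?thesis by (simp add: x_def)
  qed
  assume s: "s \<in> {0<..<D}"
  show "\<bar>f s - sin (pi * s / D)\<bar> \<le> 18 * \<tau> * sin (pi * s / D)"
  proof (cases "s \<le> a")
    case True
    have "\<bar>f s - sin s\<bar> \<le> (4 * (1 - c) + 18 * sqrt \<beta>) * s"
      by (rule R1.f_close[OF hyps]) (use s True in auto)
    also have "\<dots> \<le> \<tau> * s" using tau s by (intro mult_right_mono) auto
    finally show ?thesis using main[of s a f] True a1 s by auto
  next
    case False
    have "\<bar>f (D - (D - s)) - sin (D - s)\<bar> \<le> (4 * (1 - c) + 18 * sqrt \<beta>) * (D - s)"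
      by (rule R2.f_close[OF hyps]) (use s False in auto)
    also have "\<dots> \<le> \<tau> * (D - s)" using tau s by (intro mult_right_mono) auto
    finally have "\<bar>f (D - (D - s)) - sin (pi * (D - s) / D)\<bar> \<le> 18 * \<tau> * sin (pi * (D - s) / D)"
      using main[of "D - s" "D - a" "\<lambda>s. f (D - s)"] False a1 s by auto
    moreover have "pi * (D - s) / D = pi - pi * s / D" using D by (simp add: field_simps)
    ultimately show ?thesis by simp
  qed
qed

end

end

section \<open>The width\<close>

text \<open>The matrix acts as \<open>c\<close> on the orthogonal complement of
  \<open>\<theta>\<close> and as 1 along \<open>\<theta>\<close>; an orthogonal \<open>A\<close>
  that takes a basis vector to \<open>\<theta>\<close> diagonalizes it.\<close>

lemma det_rank_one_perturbation:
  fixes \<theta> :: "real^'n" and c :: real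
  assumes "norm \<theta> = 1"
  shows "det (\<chi> i j. c * (kron i j - \<theta> $ i * \<theta> $ j) + \<theta> $ i * \<theta> $ j) = c ^ (CARD('n) - 1)"
proof -
  obtain k :: 'n where True by simp
  obtain A :: "real^'n^'n" where A: "orthogonal_matrix A" "A *v (axis k 1) = \<theta>"
    using orthogonal_matrix_exists_basis[OF assms] by metis
  have A_k: "A $ i $ k = \<theta> $ i" for i
    using A(2) by (auto simp: matrix_vector_mult_basis column_def)
  have "A ** transpose A = mat 1" using A(1) by (simp add: orthogonal_matrix_def)
  then have AA: "(\<Sum>m\<in>UNIV. A $ i $ m * A $ j $ m) = kron i j" for i j
    by (simp add: vec_eq_iff matrix_matrix_mult_def transpose_def mat_def)
  define C :: "real^'n^'n" where "C = (\<chi> i j. if i = j then (if i = k then 1 else c) else 0)"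
  have "(A ** C ** transpose A) $ i $ j = c * (kron i j - \<theta> $ i * \<theta> $ j) + \<theta> $ i * \<theta> $ j" for i j
  proof -
    have "(A ** C) $ i $ m = A $ i $ m * (if m = k then 1 else c)" for m
    proof -
      have "(A ** C) $ i $ m = (\<Sum>l\<in>UNIV. if l = m then A $ i $ m * (if m = k then 1 else c) else 0)"
        unfolding matrix_matrix_mult_def C_def vec_lambda_beta by (rule sum.cong) auto
      then show ?thesis by simp
    qed
    then have "(A ** C ** transpose A) $ i $ j = (\<Sum>m\<in>UNIV. A $ i $ m * (if m = k then 1 else c) * A $ j $ m)"
      unfolding matrix_matrix_mult_def[of "A ** C"] transpose_def by simp
    also have "\<dots> = (\<Sum>m\<in>UNIV. c * (A $ i $ m * A $ j $ m) + (if m = k then (1 - c) * (A $ i $ k * A $ j $ k) else 0))"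
      by (intro sum.cong) (auto simp: algebra_simps)
    also have "\<dots> = c * kron i j + (1 - c) * (A $ i $ k * A $ j $ k)"
      by (simp only: sum.distrib sum_distrib_left[symmetric] AA) simp
    finally show ?thesis by (simp only: A_k) (simp add: algebra_simps)
  qed
  then have "(\<chi> i j. c * (kron i j - \<theta> $ i * \<theta> $ j) + \<theta> $ i * \<theta> $ j) = A ** C ** transpose A"
    by (simp add: vec_eq_iff)
  also have "det \<dots> = det A * det A * det C" by (simp add: det_mul)
  also have "det A * det A = 1" using det_orthogonal_matrix[OF A(1)] by auto
  also have "det C = (\<Prod>i\<in>UNIV. C $ i $ i)" by (rule det_diagonal) (simp add: C_def)
  also have "\<dots> = (\<Prod>i\<in>insert k (UNIV - {k}). if i = k then 1 else c)"
    by (intro prod.cong) (auto simp: C_def)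
  also have "\<dots> = (\<Prod>i\<in>UNIV - {k}. if i = k then 1 else c)" by (subst prod.insert) auto
  also have "\<dots> = (\<Prod>i\<in>UNIV - {k}. c)" by (intro prod.cong) auto
  also have "\<dots> = c ^ (CARD('n) - 1)" by (simp add: card_Diff_singleton)
  finally show ?thesis by simp
qed

lemma volume_density_homothetic:
  fixes \<theta> :: "real^'n" and h :: "(real^'n) bilinear_field"
  assumes \<theta>: "norm \<theta> = 1" and r: "r \<ge> 0"
    and h: "\<And>v w. v \<in> tangent \<theta> \<Longrightarrow> w \<in> tangent \<theta> \<Longrightarrow> h \<theta> v w = r\<^sup>2 * (v \<bullet> w)"
  shows "volume_density h \<theta> = r ^ (CARD('n) - 1)"
proof -
  let ?P = "\<lambda>v. v - (v \<bullet> \<theta>) *\<^sub>R \<theta>"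
  have \<theta>\<theta>: "\<theta> \<bullet> \<theta> = 1" using \<theta> by (simp add: norm_eq_1)
  have tang: "?P v \<in> tangent \<theta>" for v
    using \<theta>\<theta> by (simp add: tangent_def inner_diff_right inner_commute)
  have ax: "axis i 1 \<bullet> \<theta> = \<theta> $ i" for i using inner_axis[of \<theta> i "1::real"] by (simp add: inner_commute)
  have "?P (axis i 1) \<bullet> ?P (axis j 1) = kron i j - \<theta> $ i * \<theta> $ j" for i j
    using ax[of i] ax[of j] \<theta>\<theta> inner_axis_axis[of i "1::real" j 1]
    by (simp add: inner_diff_left inner_diff_right inner_commute[of \<theta> "axis _ _"])
  then have "h \<theta> (?P (axis i 1)) (?P (axis j 1)) + \<theta> $ i * \<theta> $ j
      = r\<^sup>2 * (kron i j - \<theta> $ i * \<theta> $ j) + \<theta> $ i * \<theta> $ j" for i j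
    by (simp only: h[OF tang tang])
  then have "volume_density h \<theta> = sqrt ((r\<^sup>2) ^ (CARD('n) - 1))"
    by (simp only: volume_density_def Let_def det_rank_one_perturbation[OF \<theta>])
  also have "\<dots> = r ^ (CARD('n) - 1)"
    using r by (simp add: real_sqrt_power)
  finally show ?thesis .
qed

text \<open>\<open>sgn x\<close> is a unit vector except at the origin, a null set.\<close>

lemma sphere_integral_const_on_sphere:
  fixes u :: "'a::euclidean_space \<Rightarrow> real"
  assumes "\<And>\<theta>. norm \<theta> = 1 \<Longrightarrow> u \<theta> = k"
  shows "sphere_integral u = k * sphere_integral (\<lambda>_::'a. 1)"
proof -
  have "integral (ball 0 1) (\<lambda>x. u (sgn x)) = integral (ball 0 1) (\<lambda>x::'a. k * 1)"
    by (rule integral_spike[of "{0}"]) (auto simp: assms norm_sgn)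
  then show ?thesis by (simp only: sphere_integral_def integral_mult_right) simp
qed

lemma sphere_integral_1_pos: "sphere_integral (\<lambda>_::'a::euclidean_space. 1) > 0"
  using lmeasure_integral[of "ball (0::'a) 1"] content_ball_pos[of 1 "0::'a"]
  by (simp add: sphere_integral_def)

lemma sphere_volume_round: "sphere_volume (round_metric :: (real^'n) bilinear_field) = sphere_integral (\<lambda>_::real^'n. 1)"
  unfolding sphere_volume_def
  by (subst sphere_integral_const_on_sphere[where k = 1])
     (simp_all add: volume_density_homothetic[where r = 1] round_metric_def)

section \<open>Slices of the sweepout and their volumes\<close>

context warped_sphere
begin

lemma f_nonneg: "s \<in> {0..D} \<Longrightarrow> f s \<ge> 0"
  using f_pos[of s] f_0 f_D by (cases "s = 0 \<or> s = D") (auto simp: less_imp_le)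

text \<open>At the end slices the map into the sphere is constant, so its derivative is 0 and the
  pulled-back metric vanishes, in agreement with \<open>f 0 = f D = 0\<close>. The supremum in
  \<open>width\<close> includes these slices.\<close>

lemma slice_metric_eq:
  assumes s: "s \<in> {0..D}" and \<theta>: "norm \<theta> = 1" and v: "v \<in> tangent \<theta>" and w: "w \<in> tangent \<theta>"
  shows "slice_metric g D F s \<theta> v w = (f s)\<^sup>2 * (v \<bullet> w)"
proof (cases "s \<in> {0<..<D}")
  case True
  have \<theta>': "\<theta> \<in> usphere" using \<theta> by (simp add: dist_norm)
  have "((\<lambda>\<theta>. (s, \<theta>)) has_derivative (\<lambda>v. (0, v))) (at \<theta>)"
    by (intro has_derivative_Pair has_derivative_const has_derivative_ident)
  then have "((\<lambda>\<theta>. F (polar D (s, \<theta>))) has_derivative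
      (\<lambda>v. frechet_derivative (F \<circ> polar D) (at (s, \<theta>)) (0, v))) (at \<theta>)"
    using has_derivative_compose[of "\<lambda>\<theta>. (s, \<theta>)" "\<lambda>v. (0, v)" \<theta> UNIV "F \<circ> polar D"]
      F_polar_has_derivative[OF \<theta>', of s]
    by (simp add: o_def)
  then have "slice_metric g D F s \<theta> v w = pullback (F \<circ> polar D) g (s, \<theta>) (0, v) (0, w)"
    by (simp add: slice_metric_def pullback_def frechet_derivative_at[symmetric])
  also have "\<dots> = (f s)\<^sup>2 * (v \<bullet> w)" using form_polar[OF True \<theta>' v w, of 0 0] by simp
  finally show ?thesis .
next
  case False
  then have end_pt: "s = 0 \<or> s = D" using s by auto
  then have "polar D (s, \<theta>') = (0, cos (pi * s / D))" for \<theta>' :: "real^'n"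
    using D_pos by (auto simp: polar_eq)
  then have "slice_metric g D F s \<theta> v w = g (F (0, cos (pi * s / D))) 0 0"
    by (simp add: slice_metric_def pullback_def frechet_derivative_const)
  also have "\<dots> = 0"
  proof (rule riemannian_metric_zero[OF metric])
    have "((0::real^'n), cos (pi * s / D)) \<in> usphere"
      using end_pt D_pos by (auto simp: norm_Pair dist_norm)
    then show "F (0, cos (pi * s / D)) \<in> usphere" using F_bij bij_betwE by blast
  qed (simp add: tangent_def)
  finally show ?thesis using end_pt f_0 f_D by auto
qed

lemma sphere_volume_slice:
  assumes "s \<in> {0..D}"
  shows "sphere_volume (slice_metric g D F s)
    = f s ^ (CARD('n) - 1) * sphere_volume (round_metric :: (real^'n) bilinear_field)"
  unfolding sphere_volume_round sphere_volume_def[of "slice_metric g D F s"]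
  by (intro sphere_integral_const_on_sphere volume_density_homothetic f_nonneg slice_metric_eq assms)

lemma width_imp_wide_slice:
  assumes n: "CARD('n) \<ge> 2" and c: "c \<ge> 0"
    and width: "width g D F \<ge> sphere_volume (round_metric :: (real^'n) bilinear_field) * c ^ (CARD('n) - 1)"
  shows "\<exists>s\<in>{0..D}. c \<le> f s"
proof -
  let ?V = "sphere_volume (round_metric :: (real^'n) bilinear_field)"
  have V: "?V > 0" using sphere_integral_1_pos by (simp add: sphere_volume_round)
  obtain m where m: "m \<in> {0..D}" "\<And>s. s \<in> {0..D} \<Longrightarrow> f s \<le> f m"
    using continuous_attains_sup[OF compact_Icc _ cont_f] D_pos by fastforce
  have "width g D F \<le> f m ^ (CARD('n) - 1) * ?V"
    unfolding width_def
  proof (rule cSUP_least)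
    show "sphere_volume (slice_metric g D F s) \<le> f m ^ (CARD('n) - 1) * ?V" if "s \<in> {0..D}" for s
      unfolding sphere_volume_slice[OF that]
      using V m that f_nonneg by (intro mult_right_mono power_mono) auto
  qed (use D_pos in auto)
  then have "?V * c ^ (CARD('n) - 1) \<le> ?V * f m ^ (CARD('n) - 1)"
    using width by (simp add: mult.commute)
  then have "c ^ (CARD('n) - 1) \<le> f m ^ (CARD('n) - 1)" using V by simp
  then have "c \<le> f m"
    using power_mono_iff[of c "f m" "CARD('n) - 1"] c f_nonneg[OF m(1)] n by simp
  then show ?thesis using m(1) by blast
qed

end

section \<open>Lengths of curves\<close>

lemma integral_le_off_negligible:
  fixes a b :: "real \<Rightarrow> real"
  assumes a: "a integrable_on S" and b: "b integrable_on S" and N: "negligible N"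
    and le: "\<And>t. t \<in> S - N \<Longrightarrow> a t \<le> b t"
  shows "integral S a \<le> integral S b"
proof -
  define b' where "b' t = (if t \<in> N then a t else b t)" for t
  have "b' integrable_on S"
    by (rule integrable_spike[OF b N]) (simp add: b'_def)
  then have "integral S a \<le> integral S b'"
    using a le by (intro integral_le) (auto simp: b'_def)
  also have "integral S b' = integral S b"
    by (rule integral_spike[OF N]) (simp add: b'_def)
  finally show ?thesis .
qed

text \<open>Transfers integrability from the speed of a curve in one metric to its speed in another.
  Measurability of \<open>a\<close> comes from continuity on the open set \<open>G\<close>, off
  which \<open>a\<close> vanishes almost everywhere; the majorant is altered on \<open>N\<close> so
  that it dominates at every point.\<close>

lemma integral_dominated:
  fixes a b :: "real \<Rightarrow> real"
  assumes G: "open G" "continuous_on G a" and N: "negligible N"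
    and zero: "\<And>t. t \<in> {0..1} - G - N \<Longrightarrow> a t = 0"
    and b: "b integrable_on {0..1}"
    and le: "\<And>t. t \<in> {0..1} - N \<Longrightarrow> 0 \<le> a t \<and> a t \<le> C * b t"
  shows "a integrable_on {0..1}" and "integral {0..1} a \<le> C * integral {0..1} b"
proof -
  define a' where "a' t = indicator G t *\<^sub>R a t" for t
  define b' where "b' t = (if t \<in> N then \<bar>a' t\<bar> else C * b t)" for t
  have Cb: "(\<lambda>t. C * b t) integrable_on {0..1}"
    using b by (rule integrable_on_mult_right)
  have b': "b' integrable_on {0..1}"
    by (rule integrable_spike[OF Cb N]) (simp add: b'_def)
  have "a' \<in> borel_measurable borel"
    unfolding a'_def[abs_def] using G by (intro borel_measurable_continuous_on_indicator) auto
  then have "a' \<in> borel_measurable lborel" by simp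
  then have "a' \<in> borel_measurable lebesgue" by (rule measurable_completion)
  then have meas: "a' \<in> borel_measurable (lebesgue_on {0..1})" by (rule measurable_restrict_space1)
  have "\<bar>a' t\<bar> \<le> b' t" if "t \<in> {0..1}" for t
    using le[of t] zero[of t] that by (cases "t \<in> N"; cases "t \<in> G") (auto simp: a'_def b'_def)
  then have a': "a' integrable_on {0..1}"
    using measurable_bounded_by_integrable_imp_integrable_real[OF meas b'] by simp
  have aa': "a t = a' t" if "t \<in> {0..1} - N" for t
    using zero[of t] that by (cases "t \<in> G") (auto simp: a'_def)
  show a: "a integrable_on {0..1}"
    by (rule integrable_spike[OF a' N]) (simp add: aa')
  have "integral {0..1} a \<le> integral {0..1} (\<lambda>t. C * b t)"
    using le by (intro integral_le_off_negligible[OF a Cb N]) auto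
  then show "integral {0..1} a \<le> C * integral {0..1} b" by simp
qed

text \<open>Each point gets an interval with rational ends that contains no other point of
  \<open>S\<close>, and this choice is injective.\<close>

lemma countable_isolated_reals:
  fixes S :: "real set"
  assumes "\<And>t. t \<in> S \<Longrightarrow> \<not> t islimpt S"
  shows "countable S"
proof -
  have "\<exists>q. fst q < t \<and> t < snd q \<and> S \<inter> {fst q<..<snd q} \<subseteq> {t} \<and> q \<in> \<rat> \<times> \<rat>" if t: "t \<in> S" for t
  proof -
    obtain e where e: "e > 0" "\<And>s. s \<in> S \<Longrightarrow> s \<noteq> t \<Longrightarrow> dist s t \<ge> e"
      using assms[OF t] unfolding islimpt_approachable by force
    obtain a b where "a \<in> \<rat>" "t - e < a" "a < t" "b \<in> \<rat>" "t < b" "b < t + e"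
      using Rats_dense_in_real[of "t - e" t] Rats_dense_in_real[of t "t + e"] e(1) by auto
    then have "fst (a, b) < t \<and> t < snd (a, b) \<and> S \<inter> {fst (a, b)<..<snd (a, b)} \<subseteq> {t} \<and> (a, b) \<in> \<rat> \<times> \<rat>"
      using e(2) by (force simp: dist_real_def)
    then show ?thesis by blast
  qed
  then obtain r where r: "\<And>t. t \<in> S \<Longrightarrow> fst (r t) < t \<and> t < snd (r t) \<and>
      S \<inter> {fst (r t)<..<snd (r t)} \<subseteq> {t} \<and> r t \<in> \<rat> \<times> \<rat>"
    by metis
  have "inj_on r S"
  proof (rule inj_onI)
    fix s t assume "s \<in> S" "t \<in> S" "r s = r t"
    then show "s = t" using r[of s] r[of t] by auto
  qed
  moreover have "countable (r ` S)"
    by (rule countable_subset[OF _ countable_SIGMA[OF countable_rat countable_rat]]) (use r in blast)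
  ultimately show ?thesis by (rule countable_image_inj_on[rotated])
qed

text \<open>If the derivative at \<open>t\<close> is nonzero, then
  \<open>\<gamma> s \<noteq> \<gamma> t\<close> for all \<open>s \<noteq> t\<close> close to
  \<open>t\<close>, so such times are isolated.\<close>

lemma countable_nondegenerate_level_set:
  fixes \<gamma> :: "real \<Rightarrow> 'a::real_normed_vector"
  shows "countable {t. \<gamma> t = c \<and> (\<exists>v. v \<noteq> 0 \<and> (\<gamma> has_vector_derivative v) (at t))}" (is "countable ?S")
proof (rule countable_isolated_reals, rule notI)
  fix t assume t: "t \<in> ?S" "t islimpt ?S"
  then obtain v where v: "v \<noteq> 0" "(\<gamma> has_vector_derivative v) (at t)" and c: "\<gamma> t = c" by auto
  have "norm v / 2 > 0" using v(1) by simp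
  then obtain e where e: "e > 0" "\<And>s. norm (s - t) < e \<Longrightarrow> norm (\<gamma> s - \<gamma> t - (s - t) *\<^sub>R v) \<le> norm v / 2 * norm (s - t)"
    using v(2) unfolding has_vector_derivative_def has_derivative_at_alt by metis
  obtain s where s: "s \<in> ?S" "s \<noteq> t" "dist s t < e"
    using t(2)[unfolded islimpt_approachable, rule_format, OF e(1)] by blast
  then have "norm (s - t) * norm v \<le> norm (s - t) * (norm v / 2)"
    using e(2)[of s] c by (simp add: dist_norm mult.commute)
  then have "norm v \<le> norm v / 2" using s(2) by (simp add: mult_le_cancel_left)
  then show False using v(1) by simp
qed

section \<open>Admissible curves, their lengths and the resulting distance\<close>

lemma valid_path_vector_derivative:
  assumes "valid_path \<gamma>"
  obtains K where "finite K" "\<And>t. t \<in> {0..1} - K \<Longrightarrow> (\<gamma> has_vector_derivative vector_derivative \<gamma> (at t)) (at t)"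
    "continuous_on ({0..1} - K) (\<lambda>t. vector_derivative \<gamma> (at t))" "continuous_on {0..1} \<gamma>"
  using assms unfolding valid_path_def piecewise_C1_differentiable_on_def C1_differentiable_on_eq
  by (auto simp: vector_derivative_works)

definition admissible :: "'a::euclidean_space bilinear_field \<Rightarrow> (real \<Rightarrow> 'a) \<Rightarrow> 'a \<Rightarrow> 'a \<Rightarrow> bool" where
  "admissible g \<gamma> p q \<longleftrightarrow> valid_path \<gamma> \<and> path_image \<gamma> \<subseteq> usphere \<and> pathstart \<gamma> = p \<and> pathfinish \<gamma> = q \<and>
     speed g \<gamma> integrable_on {0..1}"

definition path_len :: "'a::euclidean_space bilinear_field \<Rightarrow> (real \<Rightarrow> 'a) \<Rightarrow> real" where
  "path_len g \<gamma> = integral {0..1} (speed g \<gamma>)"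

lemma riem_dist_eq: "riem_dist g p q = Inf {path_len g \<gamma> | \<gamma>. admissible g \<gamma> p q}"
  by (simp add: riem_dist_def admissible_def path_len_def)

text \<open>What the length of a curve sees of a metric, common to \<open>round_metric\<close> and
  every \<open>riemannian_metric\<close>. Homogeneity is used with the factors \<open>-1\<close> and
  2, for reversing and joining curves.\<close>

definition tangent_quadratic :: "'a::euclidean_space bilinear_field \<Rightarrow> bool" where
  "tangent_quadratic g \<longleftrightarrow>
     (\<forall>p\<in>usphere. \<forall>v\<in>tangent p. g p v v \<ge> 0 \<and> (\<forall>c. g p (c *\<^sub>R v) (c *\<^sub>R v) = c\<^sup>2 * g p v v))"

lemma tangent_quadratic_scale:
  "tangent_quadratic g \<Longrightarrow> p \<in> usphere \<Longrightarrow> v \<in> tangent p \<Longrightarrow> g p (c *\<^sub>R v) (c *\<^sub>R v) = c\<^sup>2 * g p v v"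
  by (simp add: tangent_quadratic_def)

lemma tangent_quadratic_round: "tangent_quadratic round_metric"
  by (simp add: tangent_quadratic_def round_metric_def power2_eq_square)

lemma tangent_quadratic_riemannian:
  fixes g :: "'a::euclidean_space bilinear_field"
  assumes "riemannian_metric g"
  shows "tangent_quadratic g"
  unfolding tangent_quadratic_def
proof (intro ballI conjI allI)
  fix p v :: 'a assume p: "p \<in> usphere" "v \<in> tangent p"
  show "g p v v \<ge> 0"
  proof (cases "v = 0")
    case True
    then show ?thesis using riemannian_metric_zero[OF assms p] by simp
  next
    case False
    have "\<forall>p\<in>usphere. \<forall>v\<in>tangent p. v \<noteq> 0 \<longrightarrow> g p v v > 0"
      using assms unfolding riemannian_metric_def by blast
    then show ?thesis using p False by force
  qed
  have lin: "g p (c *\<^sub>R v) w = c * g p v w" if "w \<in> tangent p" for c w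
  proof -
    have "g p (c *\<^sub>R v + 0 *\<^sub>R v) w = c * g p v w + 0 * g p v w"
      using assms p that unfolding riemannian_metric_def by blast
    then show ?thesis by simp
  qed
  fix c
  have cv: "c *\<^sub>R v \<in> tangent p" using p(2) by (simp add: tangent_def)
  have "g p (c *\<^sub>R v) (c *\<^sub>R v) = c * g p v (c *\<^sub>R v)" by (rule lin[OF cv])
  also have "g p v (c *\<^sub>R v) = g p (c *\<^sub>R v) v"
    using assms p cv unfolding riemannian_metric_def by blast
  also have "\<dots> = c * g p v v" by (rule lin[OF p(2)])
  finally show "g p (c *\<^sub>R v) (c *\<^sub>R v) = c\<^sup>2 * g p v v" by (simp add: power2_eq_square)
qed

text \<open>Differentiate \<open>\<gamma> \<bullet> \<gamma> = 1\<close>. The time is interior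
  because \<open>at t\<close> looks to both sides and \<open>\<gamma>\<close> is constrained to the
  sphere only on \<open>{0..1}\<close>.\<close>

lemma velocity_tangent:
  fixes \<gamma> :: "real \<Rightarrow> 'a::euclidean_space"
  assumes "path_image \<gamma> \<subseteq> usphere" "t \<in> {0<..<1}" "(\<gamma> has_vector_derivative v) (at t)"
  shows "v \<in> tangent (\<gamma> t)"
proof -
  have "((\<lambda>t. \<gamma> t \<bullet> \<gamma> t) has_vector_derivative (\<gamma> t \<bullet> v + v \<bullet> \<gamma> t)) (at t)"
    using bounded_bilinear.has_vector_derivative[OF bounded_bilinear_inner assms(3,3)] .
  moreover have 1: "1 = \<gamma> s \<bullet> \<gamma> s" if "s \<in> {0<..<1}" for s
  proof -
    have "\<gamma> s \<in> path_image \<gamma>" using that by (auto simp: path_image_def)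
    then have "\<gamma> s \<in> usphere" using assms(1) by blast
    then have "norm (\<gamma> s) = 1" by simp
    then show ?thesis by (simp add: norm_eq_1)
  qed
  have "((\<lambda>t. \<gamma> t \<bullet> \<gamma> t) has_vector_derivative 0) (at t)"
    by (rule has_vector_derivative_transform_within_open[OF has_vector_derivative_const
          open_greaterThanLessThan assms(2)]) (rule 1)
  ultimately have "\<gamma> t \<bullet> v + v \<bullet> \<gamma> t = 0" by (rule vector_derivative_unique_at)
  then show ?thesis by (simp add: tangent_def inner_commute)
qed

lemma speed_nonneg:
  assumes "tangent_quadratic g" "path_image \<gamma> \<subseteq> usphere" "t \<in> {0<..<1}"
    "(\<gamma> has_vector_derivative vector_derivative \<gamma> (at t)) (at t)"
  shows "speed g \<gamma> t \<ge> 0"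
proof -
  have "\<gamma> t \<in> path_image \<gamma>" using assms(3) by (auto simp: path_image_def)
  then have "\<gamma> t \<in> usphere" using assms(2) by blast
  then show ?thesis
    using assms(1) velocity_tangent[OF assms(2-4)] by (simp add: tangent_quadratic_def speed_def)
qed

lemma path_len_nonneg:
  assumes "tangent_quadratic g" "admissible g \<gamma> p q"
  shows "path_len g \<gamma> \<ge> 0"
proof -
  obtain K where K: "finite K"
    "\<And>t. t \<in> {0..1} - K \<Longrightarrow> (\<gamma> has_vector_derivative vector_derivative \<gamma> (at t)) (at t)"
    using assms(2) valid_path_vector_derivative unfolding admissible_def by metis
  have "integral {0..1} (\<lambda>_::real. 0::real) \<le> integral {0..1} (speed g \<gamma>)"
  proof (rule integral_le_off_negligible)
    show "negligible (K \<union> {0, 1})" using K(1) by (intro negligible_finite) auto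
    show "0 \<le> speed g \<gamma> t" if "t \<in> {0..1} - (K \<union> {0, 1})" for t
      using that assms K(2)[of t] by (intro speed_nonneg) (auto simp: admissible_def)
  qed (use assms(2) in \<open>auto simp: admissible_def integrable_const_ivl\<close>)
  then show ?thesis by (simp add: path_len_def)
qed

lemma bdd_below_path_len: "tangent_quadratic g \<Longrightarrow> bdd_below {path_len g \<gamma> | \<gamma>. admissible g \<gamma> p q}"
  by (rule bdd_belowI[of _ 0]) (auto intro: path_len_nonneg)

lemma riem_dist_le:
  "tangent_quadratic g \<Longrightarrow> admissible g \<gamma> p q \<Longrightarrow> riem_dist g p q \<le> path_len g \<gamma>"
  unfolding riem_dist_eq by (rule cInf_lower) (auto intro: bdd_below_path_len)

lemma riem_dist_greatest:
  assumes "admissible g \<gamma>0 p q" "\<And>\<gamma>. admissible g \<gamma> p q \<Longrightarrow> b \<le> path_len g \<gamma>"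
  shows "b \<le> riem_dist g p q"
  unfolding riem_dist_eq using assms by (intro cInf_greatest) auto

lemma admissible_reversepath:
  assumes quad: "tangent_quadratic g" and \<gamma>: "admissible g \<gamma> p q"
  shows "admissible g (reversepath \<gamma>) q p" and "path_len g (reversepath \<gamma>) = path_len g \<gamma>"
proof -
  have sub: "path_image \<gamma> \<subseteq> usphere" and int: "speed g \<gamma> integrable_on {0..1}"
    using \<gamma> by (auto simp: admissible_def)
  obtain K where K: "finite K"
    "\<And>t. t \<in> {0..1} - K \<Longrightarrow> (\<gamma> has_vector_derivative vector_derivative \<gamma> (at t)) (at t)"
    using \<gamma> valid_path_vector_derivative unfolding admissible_def by metis
  have "((\<lambda>t. speed g \<gamma> (1 - t)) has_integral path_len g \<gamma>) {0..1}"
    using has_integral_affinity01[where m = "-1" and c = 1, OF integrable_integral[OF int]]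
    by (simp add: path_len_def)
  then have "(speed g (reversepath \<gamma>) has_integral path_len g \<gamma>) {0..1}"
  proof (rule has_integral_spike_finite[of "{0, 1} \<union> (\<lambda>t. 1 - t) ` K", rotated 2])
    fix t assume t: "t \<in> {0..1} - ({0, 1} \<union> (\<lambda>t. 1 - t) ` K)"
    then have t': "1 - t \<in> {0..1} - K" "1 - t \<in> {0<..<1}" by force+
    have "(\<gamma> \<circ> (\<lambda>t. 1 - t) has_vector_derivative (- 1) *\<^sub>R vector_derivative \<gamma> (at (1 - t))) (at t)"
      by (rule vector_diff_chain_at[of "\<lambda>t. 1 - t" "- 1" t \<gamma>])
         (use K(2)[OF t'(1)] in \<open>auto intro!: derivative_eq_intros\<close>)
    then have "vector_derivative (reversepath \<gamma>) (at t) = (- 1) *\<^sub>R vector_derivative \<gamma> (at (1 - t))"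
      by (intro vector_derivative_at) (simp add: reversepath_def o_def)
    moreover have "\<gamma> (1 - t) \<in> usphere"
      using sub t' by (intro subsetD[OF sub]) (auto simp: path_image_def)
    ultimately show "speed g (reversepath \<gamma>) t = speed g \<gamma> (1 - t)"
      using tangent_quadratic_scale[OF quad _ velocity_tangent[OF sub t'(2) K(2)[OF t'(1)]], of "- 1"]
      by (simp add: speed_def reversepath_def)
  qed (use K in auto)
  then show "admissible g (reversepath \<gamma>) q p" "path_len g (reversepath \<gamma>) = path_len g \<gamma>"
    using \<gamma> by (auto simp: admissible_def path_len_def has_integral_iff)
qed

lemma admissible_join:
  assumes quad: "tangent_quadratic g" and \<gamma>1: "admissible g \<gamma>1 p q" and \<gamma>2: "admissible g \<gamma>2 q r"
  shows "admissible g (\<gamma>1 +++ \<gamma>2) p r" and "path_len g (\<gamma>1 +++ \<gamma>2) = path_len g \<gamma>1 + path_len g \<gamma>2"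
proof -
  have half: "((\<lambda>t. 2 * speed g \<gamma> (2 * t - c)) has_integral path_len g \<gamma>) {c / 2..(c + 1) / 2}"
    if "admissible g \<gamma> p q" for \<gamma> p q and c :: real
  proof -
    have "(speed g \<gamma> has_integral path_len g \<gamma>) {0..1}"
      using that by (auto simp: admissible_def path_len_def integrable_integral)
    note has_integral_affinity01[OF this, where m = 2 and c = "- c", THEN has_integral_cmul[where c = 2]]
    moreover have "(\<lambda>x. x / 2 + c / 2) ` {0..1} = {c / 2..(c + 1) / 2}"
      using image_affinity_atLeastAtMost[of "1 / 2" "c / 2" 0 1] by (simp add: add_divide_distrib add.commute)
    ultimately show ?thesis by simp
  qed
  \<comment> \<open>Formulated for any \<open>\<eta>\<close> that agrees with the rescaled
    \<open>\<gamma>\<close> on an open half interval, so that it covers both pieces of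
    \<open>\<gamma>1 +++ \<gamma>2\<close>, with \<open>c = 0\<close> and
    \<open>c = 1\<close>.\<close>
  have speed_half: "\<exists>K. finite K \<and> (\<forall>t\<in>{c / 2<..<(c + 1) / 2} - K.
      (\<forall>\<eta>. (\<forall>s\<in>{c / 2<..<(c + 1) / 2}. \<eta> s = \<gamma> (2 * s - c)) \<longrightarrow> speed g \<eta> t = 2 * speed g \<gamma> (2 * t - c)))"
    if adm: "admissible g \<gamma> p q" for \<gamma> p q and c :: real
  proof -
    have sub: "path_image \<gamma> \<subseteq> usphere" using adm by (auto simp: admissible_def)
    obtain K where K: "finite K"
      "\<And>t. t \<in> {0..1} - K \<Longrightarrow> (\<gamma> has_vector_derivative vector_derivative \<gamma> (at t)) (at t)"
      using adm valid_path_vector_derivative unfolding admissible_def by metis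
    let ?K = "(\<lambda>t. (t + c) / 2) ` K"
    have "speed g \<eta> t = 2 * speed g \<gamma> (2 * t - c)"
      if t: "t \<in> {c / 2<..<(c + 1) / 2} - ?K" and \<eta>: "\<forall>s\<in>{c / 2<..<(c + 1) / 2}. \<eta> s = \<gamma> (2 * s - c)" for t \<eta>
    proof -
      have t': "2 * t - c \<in> {0<..<1}" "2 * t - c \<in> {0..1} - K"
        using t by (auto simp: field_simps image_iff)
      have "(\<gamma> \<circ> (\<lambda>t. 2 * t - c) has_vector_derivative 2 *\<^sub>R vector_derivative \<gamma> (at (2 * t - c))) (at t)"
        by (rule vector_diff_chain_at[of "\<lambda>t. 2 * t - c" 2 t \<gamma>])
           (use K(2)[OF t'(2)] in \<open>auto intro!: derivative_eq_intros\<close>)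
      then have "(\<eta> has_vector_derivative 2 *\<^sub>R vector_derivative \<gamma> (at (2 * t - c))) (at t)"
        by (rule has_vector_derivative_transform_within_open[where S = "{c / 2<..<(c + 1) / 2}"])
           (use t \<eta> in auto)
      then have "vector_derivative \<eta> (at t) = 2 *\<^sub>R vector_derivative \<gamma> (at (2 * t - c))"
        by (rule vector_derivative_at)
      moreover have "\<eta> t = \<gamma> (2 * t - c)" using t \<eta> by auto
      moreover have "\<gamma> (2 * t - c) \<in> usphere"
        using t' by (intro subsetD[OF sub]) (auto simp: path_image_def)
      ultimately show ?thesis
        using tangent_quadratic_scale[OF quad _ velocity_tangent[OF sub t'(1) K(2)[OF t'(2)]], of 2]
        by (simp add: speed_def real_sqrt_mult)
    qed
    then show ?thesis using K(1) by (intro exI[of _ ?K]) auto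
  qed
  obtain K1 where K1: "finite K1" "\<And>t. t \<in> {0<..<1 / 2} - K1 \<Longrightarrow> speed g (\<gamma>1 +++ \<gamma>2) t = 2 * speed g \<gamma>1 (2 * t)"
    using speed_half[OF \<gamma>1, of 0] by (auto simp: joinpaths_def)
  obtain K2 where K2: "finite K2" "\<And>t. t \<in> {1 / 2<..<1} - K2 \<Longrightarrow> speed g (\<gamma>1 +++ \<gamma>2) t = 2 * speed g \<gamma>2 (2 * t - 1)"
    using speed_half[OF \<gamma>2, of 1] by (auto simp: joinpaths_def)
  have "(speed g (\<gamma>1 +++ \<gamma>2) has_integral path_len g \<gamma>1) {0..1 / 2}"
    by (rule has_integral_spike_finite[of "{0, 1 / 2} \<union> K1", OF _ _ half[OF \<gamma>1, of 0, simplified]]) (use K1 in auto)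
  moreover have "(speed g (\<gamma>1 +++ \<gamma>2) has_integral path_len g \<gamma>2) {1 / 2..1}"
    by (rule has_integral_spike_finite[of "{1 / 2, 1} \<union> K2", OF _ _ half[OF \<gamma>2, of 1, simplified]]) (use K2 in auto)
  ultimately have "(speed g (\<gamma>1 +++ \<gamma>2) has_integral path_len g \<gamma>1 + path_len g \<gamma>2) {0..1}"
    by (rule has_integral_combine[rotated 2]) auto
  then show "admissible g (\<gamma>1 +++ \<gamma>2) p r" "path_len g (\<gamma>1 +++ \<gamma>2) = path_len g \<gamma>1 + path_len g \<gamma>2"
    using \<gamma>1 \<gamma>2
    by (auto simp: admissible_def path_len_def has_integral_iff path_image_join intro!: valid_path_join)
qed

lemma riem_dist_commute:
  assumes "tangent_quadratic g"
  shows "riem_dist g p q = riem_dist g q p"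
proof -
  have "{path_len g \<gamma> | \<gamma>. admissible g \<gamma> p q} \<subseteq> {path_len g \<gamma> | \<gamma>. admissible g \<gamma> q p}" for p q
    using admissible_reversepath[OF assms] by (force)
  then show ?thesis unfolding riem_dist_eq by (metis (no_types, lifting) subset_antisym)
qed

text \<open>The infimum is taken over one curve at a time; the two given curves make both sets of
  lengths nonempty.\<close>

lemma riem_dist_triangle:
  assumes quad: "tangent_quadratic g"
    and "admissible g \<gamma>1 p q" "admissible g \<gamma>2 q r"
  shows "riem_dist g p r \<le> riem_dist g p q + riem_dist g q r"
proof -
  have "riem_dist g p r - path_len g \<gamma>2' \<le> riem_dist g p q" if "admissible g \<gamma>2' q r" for \<gamma>2'
  proof (rule riem_dist_greatest[OF assms(2)])
    fix \<gamma> assume "admissible g \<gamma> p q"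
    with that show "riem_dist g p r - path_len g \<gamma>2' \<le> path_len g \<gamma>"
      using riem_dist_le[OF quad admissible_join(1)[OF quad]] admissible_join(2)[OF quad] by fastforce
  qed
  then have "riem_dist g p r - riem_dist g p q \<le> riem_dist g q r"
    by (intro riem_dist_greatest[OF assms(3)]) (simp add: algebra_simps)
  then show ?thesis by simp
qed

lemma riem_dist_nonneg:
  assumes "tangent_quadratic g" "admissible g \<gamma> p q"
  shows "riem_dist g p q \<ge> 0"
  using assms by (intro riem_dist_greatest[OF assms(2)] path_len_nonneg)

section \<open>The round sphere: chords and great circles\<close>

lemma speed_round: "speed round_metric \<gamma> t = norm (vector_derivative \<gamma> (at t))"
  by (simp add: speed_def round_metric_def norm_eq_sqrt_inner)

text \<open>Bounds the norm of the integral of the velocity. It will give distinct points a positive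
  distance.\<close>

lemma chord_le_path_len_round:
  assumes "admissible round_metric \<gamma> p q"
  shows "norm (q - p) \<le> path_len round_metric \<gamma>"
proof -
  obtain K where K: "finite K" "continuous_on {0..1} \<gamma>"
    "\<And>t. t \<in> {0..1} - K \<Longrightarrow> (\<gamma> has_vector_derivative vector_derivative \<gamma> (at t)) (at t)"
    using assms valid_path_vector_derivative unfolding admissible_def by metis
  have "((\<lambda>t. vector_derivative \<gamma> (at t)) has_integral \<gamma> 1 - \<gamma> 0) {0..1}"
    using K by (intro fundamental_theorem_of_calculus_interior_strong[of K]) auto
  moreover have "speed round_metric \<gamma> integrable_on {0..1}" using assms by (simp add: admissible_def)
  ultimately have "norm (\<gamma> 1 - \<gamma> 0) \<le> integral {0..1} (speed round_metric \<gamma>)"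
    using Henstock_Kurzweil_Integration.integral_norm_bound_integral[of
        "\<lambda>t. vector_derivative \<gamma> (at t)" "{0..1}" "speed round_metric \<gamma>"]
    by (auto simp: speed_round has_integral_iff)
  then show ?thesis using assms by (simp add: admissible_def path_len_def pathstart_def pathfinish_def)
qed

text \<open>Provides both the existence of admissible curves and a bound on the diameter. A crude
  bound is enough, so any angle in \<open>[0, 2 pi)\<close> with the right sine and cosine will do,
  and 8 exceeds \<open>2 pi\<close>.\<close>

lemma great_circle_arc:
  fixes p q :: "'a::euclidean_space"
  assumes "DIM('a) \<ge> 2" "p \<in> usphere" "q \<in> usphere"
  shows "\<exists>\<gamma>. admissible round_metric \<gamma> p q \<and> path_len round_metric \<gamma> \<le> 8"
proof -
  have p: "norm p = 1" "p \<bullet> p = 1" and q: "norm q = 1" "q \<bullet> q = 1" using assms(2,3) by (auto simp: norm_eq_1)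
  define w where "w = q - (q \<bullet> p) *\<^sub>R p"
  have wp: "p \<bullet> w = 0" using p by (simp add: w_def inner_diff_right inner_commute)
  obtain u where u: "norm u = 1" "p \<bullet> u = 0" "w = norm w *\<^sub>R u"
  proof (cases "w = 0")
    case True
    \<comment> \<open>Here \<open>q\<close> is \<open>p\<close> or \<open>- p\<close>, and any unit
      vector orthogonal to \<open>p\<close> spans a suitable plane with it; this is where the
      dimension enters.\<close>
    obtain z where z: "z \<noteq> 0" "orthogonal p z" using orthogonal_to_vector_exists[OF assms(1)] by metis
    show ?thesis
      by (rule that[of "z /\<^sub>R norm z"]) (use z True in \<open>auto simp: orthogonal_def\<close>)
  next
    case False
    show ?thesis by (rule that[of "w /\<^sub>R norm w"]) (use False wp in auto)
  qed
  have qw: "q = (q \<bullet> p) *\<^sub>R p + norm w *\<^sub>R u" using u(3) by (simp add: w_def)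
  have "u \<bullet> u = 1" using u(1) by (simp add: norm_eq_1)
  then have "(q \<bullet> p)\<^sup>2 + (norm w)\<^sup>2 = ((q \<bullet> p) *\<^sub>R p + norm w *\<^sub>R u) \<bullet> ((q \<bullet> p) *\<^sub>R p + norm w *\<^sub>R u)"
    using p u(2) by (simp add: inner_add_left inner_add_right power2_eq_square inner_commute[of u p])
  then have "(q \<bullet> p)\<^sup>2 + (norm w)\<^sup>2 = 1" using q(2) qw by simp
  then obtain c where c: "0 \<le> c" "c < 2 * pi" "q \<bullet> p = cos c" "norm w = sin c"
    using sincos_total_2pi[of "q \<bullet> p" "norm w"] by metis
  define \<gamma> where "\<gamma> t = cos (c * t) *\<^sub>R p + sin (c * t) *\<^sub>R u" for t
  define \<gamma>' where "\<gamma>' t = (c * - sin (c * t)) *\<^sub>R p + (c * cos (c * t)) *\<^sub>R u" for t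
  have d: "(\<gamma> has_vector_derivative \<gamma>' t) (at t)" for t
    unfolding \<gamma>_def[abs_def] \<gamma>'_def
    by (auto intro!: derivative_eq_intros simp: has_real_derivative_iff_has_vector_derivative[symmetric] algebra_simps)
  have norm_comb: "norm (a *\<^sub>R p + b *\<^sub>R u) = sqrt (a\<^sup>2 + b\<^sup>2)" for a b
    using p u(2) \<open>u \<bullet> u = 1\<close>
    by (simp add: norm_eq_sqrt_inner inner_add_left inner_add_right power2_eq_square inner_commute[of u p])
  have sp: "speed round_metric \<gamma> t = c" for t
  proof -
    have "(c * - sin (c * t))\<^sup>2 + (c * cos (c * t))\<^sup>2 = c\<^sup>2 * ((sin (c * t))\<^sup>2 + (cos (c * t))\<^sup>2)"
      by (simp only: power_mult_distrib power2_minus distrib_left)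
    then have "norm (\<gamma>' t) = sqrt (c\<^sup>2)" unfolding \<gamma>'_def norm_comb by simp
    then show ?thesis using c(1) vector_derivative_at[OF d] by (simp add: speed_round)
  qed
  have "continuous_on {0..1} \<gamma>'" unfolding \<gamma>'_def[abs_def] by (intro continuous_intros)
  then have "\<gamma> C1_differentiable_on {0..1}" unfolding C1_differentiable_on_def using d by blast
  then have "valid_path \<gamma>" unfolding valid_path_def by (rule C1_differentiable_imp_piecewise)
  moreover have "path_image \<gamma> \<subseteq> usphere"
    unfolding path_image_def \<gamma>_def by (auto simp: norm_comb)
  moreover have "\<gamma> 0 = p" by (simp add: \<gamma>_def)
  moreover have "\<gamma> 1 = q" using qw c by (simp add: \<gamma>_def)
  moreover have "speed round_metric \<gamma> = (\<lambda>t. c)" using sp by blast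
  ultimately have "admissible round_metric \<gamma> p q \<and> path_len round_metric \<gamma> \<le> 8"
    using c(2) pi_less_4
    by (simp add: admissible_def path_len_def pathstart_def pathfinish_def integrable_const_ivl)
  then show ?thesis by blast
qed

lemma chord_le_riem_dist_round:
  assumes "admissible round_metric \<gamma> p q"
  shows "norm (q - p) \<le> riem_dist round_metric p q"
  using assms by (intro riem_dist_greatest[OF assms] chord_le_path_len_round)

text \<open>The derivative of \<open>h\<close> is known to be continuous for fixed directions,
  whereas the velocity varies along the curve; as in \<open>Ck_on_compose\<close>, expanding it in
  \<open>Basis\<close> bridges the gap.\<close>

lemma C1_compose_valid_path:
  fixes h :: "'a::euclidean_space \<Rightarrow> 'b::euclidean_space"
  assumes V: "open V" "Ck_on 1 h V" and \<gamma>: "valid_path \<gamma>" "path_image \<gamma> \<subseteq> V"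
  shows "valid_path (h \<circ> \<gamma>)"
    and "t \<in> {0..1} \<Longrightarrow> (\<gamma> has_vector_derivative v) (at t) \<Longrightarrow>
      ((h \<circ> \<gamma>) has_vector_derivative frechet_derivative h (at (\<gamma> t)) v) (at t)"
proof -
  have h': "(h has_derivative frechet_derivative h (at x)) (at x)" if "x \<in> V" for x
    using Ck_on_has_derivative[of 0 h V x] V that by simp
  have \<gamma>V: "\<gamma> t \<in> V" if "t \<in> {0..1}" for t using \<gamma>(2) that by (auto simp: path_image_def)
  show d: "((h \<circ> \<gamma>) has_vector_derivative frechet_derivative h (at (\<gamma> t)) v) (at t)"
    if "t \<in> {0..1}" "(\<gamma> has_vector_derivative v) (at t)" for t v
    by (rule vector_derivative_diff_chain_within[OF that(2) has_derivative_at_withinI[OF h'[OF \<gamma>V[OF that(1)]]]])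
  obtain K where K: "finite K" "continuous_on {0..1} \<gamma>"
    "\<And>t. t \<in> {0..1} - K \<Longrightarrow> (\<gamma> has_vector_derivative vector_derivative \<gamma> (at t)) (at t)"
    "continuous_on ({0..1} - K) (\<lambda>t. vector_derivative \<gamma> (at t))"
    using valid_path_vector_derivative[OF \<gamma>(1)] by metis
  have eq: "frechet_derivative h (at x) z = (\<Sum>b\<in>Basis. (z \<bullet> b) *\<^sub>R frechet_derivative h (at x) b)"
    if "x \<in> V" for x z
  proof -
    interpret linear "frechet_derivative h (at x)"
      using h'[OF that] by (rule has_derivative_linear)
    have "frechet_derivative h (at x) (\<Sum>b\<in>Basis. (z \<bullet> b) *\<^sub>R b) = (\<Sum>b\<in>Basis. (z \<bullet> b) *\<^sub>R frechet_derivative h (at x) b)"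
      by (simp only: sum scale)
    then show ?thesis by (simp add: euclidean_representation)
  qed
  have hb: "continuous_on V (\<lambda>x. frechet_derivative h (at x) b)" for b using V(2) by simp
  have "continuous_on ({0..1} - K) (\<lambda>t. \<Sum>b\<in>Basis. (vector_derivative \<gamma> (at t) \<bullet> b) *\<^sub>R frechet_derivative h (at (\<gamma> t)) b)"
  proof (intro continuous_on_sum continuous_on_scaleR continuous_on_inner continuous_on_const K(4))
    show "continuous_on ({0..1} - K) (\<lambda>t. frechet_derivative h (at (\<gamma> t)) b)" for b
      by (rule continuous_on_compose2[OF hb continuous_on_subset[OF K(2)]]) (use \<gamma>V in auto)
  qed
  then have cont: "continuous_on ({0..1} - K) (\<lambda>t. frechet_derivative h (at (\<gamma> t)) (vector_derivative \<gamma> (at t)))"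
    by (rule continuous_on_eq) (use eq \<gamma>V in auto)
  have "continuous_on V h" using Ck_on_SucD[of 0 h V] V(2) by simp
  then have "continuous_on {0..1} (h \<circ> \<gamma>)"
    using K(2) \<gamma>V by (intro continuous_on_compose) (auto intro: continuous_on_subset)
  then show "valid_path (h \<circ> \<gamma>)"
    unfolding valid_path_def piecewise_C1_differentiable_on_def C1_differentiable_on_def
    using K(1,3) cont d by (intro conjI exI[of _ K]) (auto intro!: exI[of _ "\<lambda>t. frechet_derivative h (at (\<gamma> t)) (vector_derivative \<gamma> (at t))"])
qed

section \<open>Comparison with the round metric\<close>

lemma polar_has_derivative:
  "(polar D has_derivative (\<lambda>(a, v). ((cos (pi * s / D) * (pi * a / D)) *\<^sub>R \<theta> + sin (pi * s / D) *\<^sub>R v,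
      - (sin (pi * s / D) * (pi * a / D))))) (at (s, \<theta>))"
proof -
  have lin: "((\<lambda>p. pi * fst p / D) has_derivative (\<lambda>p. pi * fst p / D)) (at (s, \<theta>))"
    using bounded_linear_imp_has_derivative[OF bounded_linear_compose[OF bounded_linear_mult_right[of "pi / D"] bounded_linear_fst]]
    by simp
  have "((\<lambda>p. (sin (pi * fst p / D) *\<^sub>R snd p, cos (pi * fst p / D))) has_derivative
      (\<lambda>p. (sin (pi * fst (s, \<theta>) / D) *\<^sub>R snd p + (pi * fst p / D * cos (pi * fst (s, \<theta>) / D)) *\<^sub>R snd (s, \<theta>),
         pi * fst p / D * - sin (pi * fst (s, \<theta>) / D)))) (at (s, \<theta>))"
    by (intro has_derivative_Pair has_derivative_scaleR has_derivative_sin has_derivative_cos lin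
        has_derivative_snd has_derivative_ident)
  then show ?thesis
    by (simp add: polar_eq[abs_def] split_beta' mult_ac add.commute)
qed

lemma usphere_Pair: "p \<in> usphere \<longleftrightarrow> norm (fst p) ^ 2 + snd p ^ 2 = 1" for p :: "'a::euclidean_space \<times> real"
proof -
  have "norm (fst p) ^ 2 + snd p ^ 2 = (norm p)\<^sup>2" by (simp add: norm_prod_def)
  moreover have "norm p \<noteq> - 1" using norm_ge_zero[of p] by linarith
  ultimately show ?thesis by (simp add: power2_eq_1_iff)
qed

lemma convex_combination_squares:
  fixes a b \<kappa> x y :: real
  assumes "\<bar>a - 1\<bar> \<le> \<kappa>" "\<bar>b - 1\<bar> \<le> \<kappa>" "\<kappa> \<le> 1" "0 \<le> x" "x \<le> y"
  shows "(1 - \<kappa>)\<^sup>2 * y \<le> a\<^sup>2 * x + b\<^sup>2 * (y - x)" and "a\<^sup>2 * x + b\<^sup>2 * (y - x) \<le> (1 + \<kappa>)\<^sup>2 * y"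
proof -
  have sq: "(1 - \<kappa>)\<^sup>2 \<le> a\<^sup>2" "(1 - \<kappa>)\<^sup>2 \<le> b\<^sup>2" "a\<^sup>2 \<le> (1 + \<kappa>)\<^sup>2" "b\<^sup>2 \<le> (1 + \<kappa>)\<^sup>2"
    using assms(1-3) by (auto intro!: power_mono)
  have "(1 - \<kappa>)\<^sup>2 * x + (1 - \<kappa>)\<^sup>2 * (y - x) \<le> a\<^sup>2 * x + b\<^sup>2 * (y - x)"
    using sq assms(4,5) by (intro add_mono mult_right_mono) auto
  then show "(1 - \<kappa>)\<^sup>2 * y \<le> a\<^sup>2 * x + b\<^sup>2 * (y - x)" by (simp add: algebra_simps)
  have "a\<^sup>2 * x + b\<^sup>2 * (y - x) \<le> (1 + \<kappa>)\<^sup>2 * x + (1 + \<kappa>)\<^sup>2 * (y - x)"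
    using sq assms(4,5) by (intro add_mono mult_right_mono) auto
  then show "a\<^sup>2 * x + b\<^sup>2 * (y - x) \<le> (1 + \<kappa>)\<^sup>2 * y" by (simp add: algebra_simps)
qed

context warped_sphere
begin

lemma F_has_derivative: "p \<in> usphere \<Longrightarrow> (F has_derivative frechet_derivative F (at p)) (at p)"
proof -
  assume p: "p \<in> usphere"
  obtain V where V: "open V" "usphere \<subseteq> V" "\<And>k. Ck_on k F V" by (rule F_smooth) blast
  show ?thesis using Ck_on_has_derivative[OF V(3)] V(2) p by blast
qed

text \<open>The coordinate \<open>s\<close> of a point of the sphere, recovered from its height
  \<open>cos (pi * s / D)\<close>.\<close>

definition radius :: "(real^'n) \<times> real \<Rightarrow> real" where "radius p = D / pi * arccos (snd p)"

text \<open>Up to sign \<open>t\<close> is the component of \<open>w\<close> along the meridian, and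
  \<open>(norm w)^2 - t^2\<close> is the squared length of its component along the slice. Measuring
  with \<open>g\<close> through \<open>F\<close> stretches the first by \<open>D / pi\<close> and
  the second by \<open>f / sin\<close>, the sine being \<open>norm (fst p)\<close>.\<close>

lemma metric_off_poles:
  assumes p: "p \<in> usphere" "fst p \<noteq> 0" and w: "w \<in> tangent p"
  defines "t \<equiv> snd w / norm (fst p)" and "dF \<equiv> frechet_derivative F (at p)"
  shows "radius p \<in> {0<..<D}" and "sin (pi * radius p / D) = norm (fst p)" and "t\<^sup>2 \<le> (norm w)\<^sup>2"
    and "g (F p) (dF w) (dF w) = (D / pi)\<^sup>2 * t\<^sup>2 + (f (radius p) / norm (fst p))\<^sup>2 * ((norm w)\<^sup>2 - t\<^sup>2)"
proof -
  define r z s where "r = norm (fst p)" and "z = snd p" and "s = radius p"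
  define \<theta> where "\<theta> = fst p /\<^sub>R r"
  have r: "r > 0" using p(2) by (simp add: r_def)
  have rz: "r\<^sup>2 + z\<^sup>2 = 1" using p(1)[unfolded usphere_Pair] by (simp add: r_def z_def)
  then have "z\<^sup>2 < 1" using r by (smt (verit) zero_less_power)
  then have z: "-1 < z" "z < 1" using abs_square_less_1[of z] by auto
  have D: "D > 0" by (rule D_pos)
  have ang: "pi * s / D = arccos z" using D by (simp add: s_def radius_def z_def)
  show s: "radius p \<in> {0<..<D}"
    using arccos_lt_bounded[OF z] D unfolding radius_def z_def[symmetric] by (auto simp: field_simps)
  have "sin (arccos z) = sqrt (1 - z\<^sup>2)" using z by (intro sin_arccos) auto
  also have "1 - z\<^sup>2 = r\<^sup>2" using rz by linarith
  finally have sin_s: "sin (pi * s / D) = r" using r by (simp add: ang)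
  then show "sin (pi * radius p / D) = norm (fst p)" by (simp add: s_def r_def)
  have cos_s: "cos (pi * s / D) = z" using z by (simp add: ang)
  have \<theta>: "norm \<theta> = 1" "\<theta> \<in> usphere" using r by (simp_all add: \<theta>_def r_def dist_norm)
  have \<theta>\<theta>: "\<theta> \<bullet> \<theta> = 1" using \<theta>(1) by (simp add: norm_eq_1)
  have fst_p: "fst p = r *\<^sub>R \<theta>" using r by (simp add: \<theta>_def)
  have p_eq: "polar D (s, \<theta>) = p"
    using sin_s cos_s fst_p by (simp add: polar_eq prod_eq_iff z_def)
  \<comment> \<open>\<open>(a, v)\<close> solves the equation \<open>dw\<close> below, that is, the
    derivative of the polar map takes it to \<open>w\<close>. The sign of \<open>a\<close> is
    opposite to that of \<open>t\<close> because the height decreases as \<open>s\<close>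
    grows.\<close>
  define a where "a = - (D / pi * t)"
  define v where "v = (fst w + (z * t) *\<^sub>R \<theta>) /\<^sub>R r"
  have tr: "r * t = snd w" using r by (simp add: t_def r_def)
  have "fst p \<bullet> fst w + z * snd w = 0" using w by (simp add: tangent_def inner_prod_def z_def)
  then have "r * (\<theta> \<bullet> fst w + z * t) = 0" by (simp add: fst_p tr[symmetric] algebra_simps)
  then have \<theta>w: "\<theta> \<bullet> fst w = - (z * t)" using r by simp
  have v_tan: "v \<in> tangent \<theta>" using \<theta>w \<theta>\<theta> by (simp add: tangent_def v_def inner_add_right)
  have pa: "pi * a / D = - t" using D by (simp add: a_def)
  have rv: "r *\<^sub>R v = fst w + (z * t) *\<^sub>R \<theta>" using r by (simp add: v_def)
  have dw: "((cos (pi * s / D) * (pi * a / D)) *\<^sub>R \<theta> + sin (pi * s / D) *\<^sub>R v, - (sin (pi * s / D) * (pi * a / D))) = w"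
    unfolding sin_s cos_s pa rv using tr by (simp add: prod_eq_iff)
  have "((F \<circ> polar D) has_derivative (\<lambda>u. dF ((\<lambda>(a, v). ((cos (pi * s / D) * (pi * a / D)) *\<^sub>R \<theta> + sin (pi * s / D) *\<^sub>R v,
      - (sin (pi * s / D) * (pi * a / D)))) u))) (at (s, \<theta>))"
    using has_derivative_compose[OF polar_has_derivative[of D s \<theta>], of F dF] F_has_derivative[OF p(1)] p_eq
    by (simp add: o_def dF_def)
  from frechet_derivative_at[OF this] have "frechet_derivative (F \<circ> polar D) (at (s, \<theta>)) (a, v) = dF w"
    using dw by (metis (mono_tags, lifting) case_prod_conv)
  then have "g (F p) (dF w) (dF w) = pullback (F \<circ> polar D) g (s, \<theta>) (a, v) (a, v)"
    by (simp add: pullback_def p_eq)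
  also have "\<dots> = a * a + (f s)\<^sup>2 * (v \<bullet> v)"
    using s by (intro form_polar \<theta> v_tan) (simp add: s_def)
  finally have G: "g (F p) (dF w) (dF w) = a * a + (f s)\<^sup>2 * (v \<bullet> v)" .
  have "(r *\<^sub>R v) \<bullet> (r *\<^sub>R v) = fst w \<bullet> fst w - (z * t)\<^sup>2"
    unfolding rv using \<theta>w \<theta>\<theta> inner_commute[of "fst w" \<theta>]
    by (simp add: inner_add_left inner_add_right power2_eq_square)
  also have "\<dots> = (norm w)\<^sup>2 - t\<^sup>2 * (r\<^sup>2 + z\<^sup>2)"
  proof -
    have "(norm w)\<^sup>2 = fst w \<bullet> fst w + (r * t)\<^sup>2"
      unfolding tr power2_norm_eq_inner by (simp add: inner_prod_def power2_eq_square)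
    then show ?thesis by (simp add: power2_eq_square algebra_simps)
  qed
  also have "\<dots> = (norm w)\<^sup>2 - t\<^sup>2" by (simp add: rz)
  finally have vv: "r\<^sup>2 * (v \<bullet> v) = (norm w)\<^sup>2 - t\<^sup>2" by (simp add: power2_eq_square)
  moreover have "r\<^sup>2 * (v \<bullet> v) \<ge> 0" by simp
  ultimately show "t\<^sup>2 \<le> (norm w)\<^sup>2" by linarith
  have "(f s / r)\<^sup>2 * (r\<^sup>2 * (v \<bullet> v)) = (f s)\<^sup>2 * (v \<bullet> v)" using r by (simp add: power_divide)
  then show "g (F p) (dF w) (dF w) = (D / pi)\<^sup>2 * t\<^sup>2 + (f (radius p) / norm (fst p))\<^sup>2 * ((norm w)\<^sup>2 - t\<^sup>2)"
    unfolding G vv by (simp add: a_def s_def r_def power_mult_distrib[symmetric] power2_eq_square)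
qed

lemma pole_cases:
  fixes p :: "(real^'n) \<times> real"
  assumes "p \<in> usphere" "fst p = 0"
  shows "p = (0, 1) \<or> p = (0, -1)"
proof -
  have "(snd p)\<^sup>2 = 1" using assms(1)[unfolded usphere_Pair] assms(2) by simp
  then show ?thesis using assms(2) by (auto simp: prod_eq_iff power2_eq_1_iff)
qed

end

text \<open>\<open>length_near\<close> and \<open>profile_near\<close> say that the two stretching
  factors of \<open>metric_off_poles\<close> are within \<open>\<kappa>\<close> of 1; the error in
  the profile is relative to the sine, hence meaningful up to the poles.\<close>

locale near_round_sphere = warped_sphere g D f F d
  for g :: "((real^'n) \<times> real) bilinear_field" and D f F d +
  fixes \<kappa> :: real
  assumes kappa: "0 \<le> \<kappa>" "\<kappa> < 1"
    and length_near: "\<bar>D / pi - 1\<bar> \<le> \<kappa>"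
    and profile_near: "\<And>s. s \<in> {0<..<D} \<Longrightarrow> \<bar>f s - sin (pi * s / D)\<bar> \<le> \<kappa> * sin (pi * s / D)"
begin

lemma metric_near_round:
  assumes "p \<in> usphere" "fst p \<noteq> 0" "w \<in> tangent p"
  defines "dF \<equiv> frechet_derivative F (at p)"
  shows "(1 - \<kappa>) * norm w \<le> sqrt (g (F p) (dF w) (dF w))"
    and "sqrt (g (F p) (dF w) (dF w)) \<le> (1 + \<kappa>) * norm w"
proof -
  note H = metric_off_poles[OF assms(1-3)]
  have r: "norm (fst p) > 0" using assms(2) by simp
  have "\<bar>f (radius p) - norm (fst p)\<bar> \<le> \<kappa> * norm (fst p)"
    using profile_near[OF H(1)] H(2) by simp
  then have "\<bar>f (radius p) / norm (fst p) - 1\<bar> \<le> \<kappa>"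
    using r by (simp add: field_simps abs_le_iff)
  note C = convex_combination_squares[OF length_near this _ zero_le_power2 H(3)]
  have "sqrt ((1 - \<kappa>)\<^sup>2 * (norm w)\<^sup>2) \<le> sqrt (g (F p) (dF w) (dF w))"
    unfolding dF_def H(4) using C(1) kappa by (intro real_sqrt_le_mono) auto
  then show "(1 - \<kappa>) * norm w \<le> sqrt (g (F p) (dF w) (dF w))"
    using kappa by (simp add: real_sqrt_mult)
  have "sqrt (g (F p) (dF w) (dF w)) \<le> sqrt ((1 + \<kappa>)\<^sup>2 * (norm w)\<^sup>2)"
    unfolding dF_def H(4) using C(2) kappa by (intro real_sqrt_le_mono) auto
  then show "sqrt (g (F p) (dF w) (dF w)) \<le> (1 + \<kappa>) * norm w"
    using kappa by (simp add: real_sqrt_mult)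
qed

text \<open>At the poles the two speeds cannot be compared directly. But a curve is at a pole with
  nonzero velocity only at isolated, hence countably many, times.\<close>

lemma speed_comparison:
  fixes \<gamma> :: "real \<Rightarrow> (real^'n) \<times> real"
  assumes \<gamma>: "valid_path \<gamma>" "path_image \<gamma> \<subseteq> usphere"
  obtains G N where "open G" "negligible N"
    "continuous_on G (speed g (F \<circ> \<gamma>))" "continuous_on G (speed round_metric \<gamma>)"
    "\<And>t. t \<in> {0..1} - G - N \<Longrightarrow> speed g (F \<circ> \<gamma>) t = 0 \<and> speed round_metric \<gamma> t = 0"
    "\<And>t. t \<in> {0..1} - N \<Longrightarrow> (1 - \<kappa>) * speed round_metric \<gamma> t \<le> speed g (F \<circ> \<gamma>) t
        \<and> speed g (F \<circ> \<gamma>) t \<le> (1 + \<kappa>) * speed round_metric \<gamma> t"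
proof -
  obtain V where V: "open V" "usphere \<subseteq> V" "\<And>k. Ck_on k F V" by (rule F_smooth) blast
  obtain K where K: "finite K" "continuous_on {0..1} \<gamma>"
    "\<And>t. t \<in> {0..1} - K \<Longrightarrow> (\<gamma> has_vector_derivative vector_derivative \<gamma> (at t)) (at t)"
    "continuous_on ({0..1} - K) (\<lambda>t. vector_derivative \<gamma> (at t))"
    using valid_path_vector_derivative[OF \<gamma>(1)] by metis
  define \<gamma>' where "\<gamma>' t = vector_derivative \<gamma> (at t)" for t
  define I where "I = {0<..<1} - K"
  define G where "G = I \<inter> \<gamma> -` {p. fst p \<noteq> 0}"
  define N where "N = K \<union> {0, 1} \<union> (\<Union>c\<in>{(0, 1), (0, -1)}. {t. \<gamma> t = c \<and> (\<exists>v. v \<noteq> 0 \<and> (\<gamma> has_vector_derivative v) (at t))})"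
  have I: "I \<subseteq> {0..1} - K" "I \<subseteq> {0<..<1}" by (auto simp: I_def)
  have on_sphere: "\<gamma> t \<in> usphere" if "t \<in> I" for t
    using that I(1) \<gamma>(2) by (intro subsetD[OF \<gamma>(2)]) (auto simp: path_image_def)
  have d\<gamma>: "(\<gamma> has_vector_derivative \<gamma>' t) (at t)" if "t \<in> I" for t
    using K(3) I that unfolding \<gamma>'_def by blast
  have tang: "\<gamma>' t \<in> tangent (\<gamma> t)" if "t \<in> I" for t
    using velocity_tangent[OF \<gamma>(2) _ d\<gamma>[OF that]] I(2) that by blast
  have speed_r: "speed round_metric \<gamma> t = norm (\<gamma>' t)" for t by (simp add: speed_round \<gamma>'_def)
  have "path_image \<gamma> \<subseteq> V" using \<gamma>(2) V(2) by blast
  then have dF\<gamma>: "((F \<circ> \<gamma>) has_vector_derivative frechet_derivative F (at (\<gamma> t)) (\<gamma>' t)) (at t)" if "t \<in> I" for t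
    using I that by (intro C1_compose_valid_path(2)[OF V(1,3) \<gamma>(1) _ _ d\<gamma>]) auto
  have speed_g: "speed g (F \<circ> \<gamma>) t =
      sqrt (g (F (\<gamma> t)) (frechet_derivative F (at (\<gamma> t)) (\<gamma>' t)) (frechet_derivative F (at (\<gamma> t)) (\<gamma>' t)))" if "t \<in> I" for t
    by (simp add: speed_def vector_derivative_at[OF dF\<gamma>[OF that]])
  have cont_I: "continuous_on I \<gamma>" by (rule continuous_on_subset[OF K(2)]) (use I(1) in blast)
  have "open I" using K(1) by (simp add: I_def open_Diff finite_imp_closed)
  moreover have "open {p :: (real^'n) \<times> real. fst p \<noteq> 0}" by (intro open_Collect_neq continuous_intros)
  ultimately have "open G" unfolding G_def using cont_I by (intro continuous_open_preimage)
  have "countable (K \<union> {0, 1} \<union> (\<Union>c\<in>{(0, 1), (0, -1)}. {t. \<gamma> t = c \<and> (\<exists>v. v \<noteq> 0 \<and> (\<gamma> has_vector_derivative v) (at t))}))"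
    using K(1) by (intro countable_Un countable_UN countable_nondegenerate_level_set) (auto intro: countable_finite)
  then have "negligible (\<Union>t\<in>N. {t})"
    unfolding N_def by (intro negligible_countable_Union countable_image) auto
  then have "negligible N" by simp
  have GI: "G \<subseteq> I" by (auto simp: G_def)
  have cont': "continuous_on G \<gamma>'"
    unfolding \<gamma>'_def[abs_def] using K(4) by (rule continuous_on_subset) (use GI I in auto)
  have cont\<gamma>: "continuous_on G \<gamma>" by (rule continuous_on_subset[OF cont_I GI])
  have cont_r: "continuous_on G (speed round_metric \<gamma>)"
    unfolding speed_r[abs_def] using cont' by (rule continuous_on_norm)
  have off: "\<gamma> t \<in> usphere" "fst (\<gamma> t) \<noteq> 0" "\<gamma>' t \<in> tangent (\<gamma> t)" if "t \<in> G" for t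
    using that GI on_sphere tang by (auto simp: G_def)
  have cont_radius: "continuous_on G (\<lambda>t. radius (\<gamma> t))"
  proof -
    have "- 1 \<le> snd (\<gamma> t) \<and> snd (\<gamma> t) \<le> 1" if "t \<in> G" for t
    proof -
      have "(snd (\<gamma> t))\<^sup>2 \<le> 1"
        using off(1)[OF that, unfolded usphere_Pair] zero_le_power2[of "norm (fst (\<gamma> t))"] by linarith
      then show ?thesis by (simp add: abs_square_le_1 abs_le_iff)
    qed
    then show ?thesis
      unfolding radius_def using cont\<gamma>
      by (intro continuous_on_mult continuous_on_const continuous_on_arccos continuous_on_snd) auto
  qed
  have rad: "radius (\<gamma> t) \<in> {0<..<D}" if "t \<in> G" for t
    by (rule metric_off_poles(1)[OF off[OF that]])
  have cont_f_radius: "continuous_on G (\<lambda>t. f (radius (\<gamma> t)))"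
    by (rule continuous_on_compose2[OF cont_f cont_radius]) (use rad in force)
  \<comment> \<open>Smoothness of \<open>g\<close> is stated for pairs of smooth tangent fields, not
    for the velocity of a curve, so continuity of the speed is read off the explicit formula of
    \<open>metric_off_poles\<close>.\<close>
  have "continuous_on G (\<lambda>t. sqrt ((D / pi)\<^sup>2 * (snd (\<gamma>' t) / norm (fst (\<gamma> t)))\<^sup>2
      + (f (radius (\<gamma> t)) / norm (fst (\<gamma> t)))\<^sup>2 * ((norm (\<gamma>' t))\<^sup>2 - (snd (\<gamma>' t) / norm (fst (\<gamma> t)))\<^sup>2)))"
    using off(2)
    by (intro continuous_on_real_sqrt continuous_on_add continuous_on_mult continuous_on_const
        continuous_on_power continuous_on_divide continuous_on_diff continuous_on_norm
        continuous_on_snd continuous_on_fst cont' cont\<gamma> cont_f_radius) auto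
  then have cont_g: "continuous_on G (speed g (F \<circ> \<gamma>))"
    by (rule continuous_on_eq) (use speed_g metric_off_poles(4)[OF off] GI in auto)
  have zero: "speed g (F \<circ> \<gamma>) t = 0 \<and> speed round_metric \<gamma> t = 0" if t: "t \<in> {0..1} - G - N" for t
  proof -
    have tI: "t \<in> I" using t by (auto simp: N_def I_def)
    then have "fst (\<gamma> t) = 0" using t by (auto simp: G_def)
    then have "\<gamma> t = (0, 1) \<or> \<gamma> t = (0, -1)" using pole_cases on_sphere[OF tI] by blast
    then have "\<gamma>' t = 0" using t d\<gamma>[OF tI] unfolding N_def by blast
    moreover have "frechet_derivative F (at (\<gamma> t)) 0 = 0"
      using F_has_derivative[OF on_sphere[OF tI]] by (meson has_derivative_linear linear_0)
    moreover have "g (F (\<gamma> t)) 0 0 = 0"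
      using bij_betwE[OF F_bij] on_sphere[OF tI] by (intro riemannian_metric_zero[OF metric]) (auto simp: tangent_def)
    ultimately show ?thesis by (simp add: speed_g[OF tI] speed_r)
  qed
  have le: "(1 - \<kappa>) * speed round_metric \<gamma> t \<le> speed g (F \<circ> \<gamma>) t
        \<and> speed g (F \<circ> \<gamma>) t \<le> (1 + \<kappa>) * speed round_metric \<gamma> t" if t: "t \<in> {0..1} - N" for t
  proof (cases "t \<in> G")
    case True
    then show ?thesis
      using metric_near_round[OF off[OF True]] speed_g[of t] GI by (auto simp: speed_r)
  next
    case False
    then show ?thesis using zero[of t] t by simp
  qed
  show ?thesis by (rule that[OF \<open>open G\<close> \<open>negligible N\<close> cont_g cont_r zero le])
qed

lemma path_len_push:
  assumes "admissible round_metric \<gamma> p q"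
  shows "admissible g (F \<circ> \<gamma>) (F p) (F q)"
    and "path_len g (F \<circ> \<gamma>) \<le> (1 + \<kappa>) * path_len round_metric \<gamma>"
proof -
  have \<gamma>: "valid_path \<gamma>" "path_image \<gamma> \<subseteq> usphere" "speed round_metric \<gamma> integrable_on {0..1}"
    using assms by (auto simp: admissible_def)
  obtain G N where G: "open G" "negligible N"
    "continuous_on G (speed g (F \<circ> \<gamma>))"
    "\<And>t. t \<in> {0..1} - G - N \<Longrightarrow> speed g (F \<circ> \<gamma>) t = 0 \<and> speed round_metric \<gamma> t = 0"
    "\<And>t. t \<in> {0..1} - N \<Longrightarrow> (1 - \<kappa>) * speed round_metric \<gamma> t \<le> speed g (F \<circ> \<gamma>) t
        \<and> speed g (F \<circ> \<gamma>) t \<le> (1 + \<kappa>) * speed round_metric \<gamma> t"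
    by (rule speed_comparison[OF \<gamma>(1,2)]) blast
  have "0 \<le> speed g (F \<circ> \<gamma>) t \<and> speed g (F \<circ> \<gamma>) t \<le> (1 + \<kappa>) * speed round_metric \<gamma> t"
    if "t \<in> {0..1} - N" for t
  proof -
    have "0 \<le> (1 - \<kappa>) * speed round_metric \<gamma> t" using kappa by (simp add: speed_round)
    then show ?thesis using G(5)[OF that] by linarith
  qed
  note I = integral_dominated[OF G(1,3,2) _ \<gamma>(3) this]
  have int: "speed g (F \<circ> \<gamma>) integrable_on {0..1}" by (rule I(1)) (use G(4) in auto)
  show "path_len g (F \<circ> \<gamma>) \<le> (1 + \<kappa>) * path_len round_metric \<gamma>"
    unfolding path_len_def by (rule I(2)) (use G(4) in auto)
  obtain V where V: "open V" "usphere \<subseteq> V" "\<And>k. Ck_on k F V" by (rule F_smooth) blast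
  have "valid_path (F \<circ> \<gamma>)"
    using V(2) \<gamma> by (intro C1_compose_valid_path(1)[OF V(1,3)]) auto
  moreover have "path_image (F \<circ> \<gamma>) \<subseteq> usphere"
    using bij_betwE[OF F_bij] \<gamma>(2) unfolding path_image_compose by blast
  ultimately show "admissible g (F \<circ> \<gamma>) (F p) (F q)"
    using int assms by (auto simp: admissible_def pathstart_compose pathfinish_compose)
qed

text \<open>Take \<open>\<gamma> = h \<circ> \<eta>\<close> with a smooth extension \<open>h\<close>
  of the inverse of \<open>F\<close>. Then \<open>F \<circ> \<gamma>\<close> is
  \<open>\<eta>\<close> on \<open>{0..1}\<close>, and the comparison of speeds applies to
  \<open>\<gamma>\<close>.\<close>

lemma path_len_pull:
  assumes "admissible g \<eta> (F p) (F q)" "p \<in> usphere" "q \<in> usphere"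
  shows "\<exists>\<gamma>. admissible round_metric \<gamma> p q \<and> (1 - \<kappa>) * path_len round_metric \<gamma> \<le> path_len g \<eta>"
proof -
  have \<eta>: "valid_path \<eta>" "path_image \<eta> \<subseteq> usphere" "speed g \<eta> integrable_on {0..1}"
    using assms by (auto simp: admissible_def)
  have "smooth_on_sphere (inv_into usphere F)" using diffeo by (simp add: sphere_diffeo_def)
  then obtain V h where V: "open V" "usphere \<subseteq> V" "\<And>k. Ck_on k h V"
    and h: "\<And>p. p \<in> usphere \<Longrightarrow> h p = inv_into usphere F p"
    unfolding smooth_on_sphere_def smooth_def by metis
  have hF: "h (F p) = p" if "p \<in> usphere" for p
  proof -
    have "F p \<in> usphere" using that bij_betwE[OF F_bij] by blast
    then show ?thesis using h bij_betw_inv_into_left[OF F_bij that] by metis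
  qed
  have Fh: "F (h p) = p" "h p \<in> usphere" if "p \<in> usphere" for p
    using h[OF that] bij_betw_inv_into_right[OF F_bij that] bij_betwE[OF bij_betw_inv_into[OF F_bij]] that by auto
  define \<gamma> where "\<gamma> = h \<circ> \<eta>"
  have valid: "valid_path \<gamma>"
    unfolding \<gamma>_def using V(2) \<eta> by (intro C1_compose_valid_path(1)[OF V(1,3)]) auto
  have sub: "path_image \<gamma> \<subseteq> usphere"
    unfolding \<gamma>_def path_image_compose using Fh(2) \<eta>(2) by blast
  have F\<gamma>: "(F \<circ> \<gamma>) t = \<eta> t" if "t \<in> {0..1}" for t
  proof -
    have "\<eta> t \<in> usphere" using \<eta>(2) that by (intro subsetD[OF \<eta>(2)]) (auto simp: path_image_def)
    then show ?thesis by (simp only: \<gamma>_def o_def Fh(1))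
  qed
  \<comment> \<open>Outside \<open>{0..1}\<close> the curve \<open>\<eta>\<close> may leave the
    sphere, where \<open>F \<circ> h\<close> need not be the identity. As \<open>at t\<close> is
    two-sided, the end points are left out.\<close>
  have speed_eq: "speed g (F \<circ> \<gamma>) t = speed g \<eta> t" if t: "t \<in> {0<..<1}" for t
  proof -
    have "((F \<circ> \<gamma>) has_vector_derivative v) (at t) \<longleftrightarrow> (\<eta> has_vector_derivative v) (at t)" for v
      using F\<gamma> t has_vector_derivative_transform_within_open[of _ v t "{0<..<1}"]
      by (metis atLeastAtMost_iff greaterThanLessThan_iff less_imp_le open_greaterThanLessThan)
    then have "vector_derivative (F \<circ> \<gamma>) (at t) = vector_derivative \<eta> (at t)"
      by (simp add: vector_derivative_def)
    then show ?thesis using F\<gamma>[of t] t by (simp add: speed_def)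
  qed
  have fin: "finite {0, 1::real}" by simp
  have eq_off: "speed g (F \<circ> \<gamma>) t = speed g \<eta> t" if "t \<in> {0..1} - {0, 1}" for t
    using speed_eq[of t] that by auto
  have int: "speed g (F \<circ> \<gamma>) integrable_on {0..1}"
    using integrable_spike_finite[OF fin eq_off \<eta>(3)] .
  have len: "integral {0..1} (speed g (F \<circ> \<gamma>)) = path_len g \<eta>"
    unfolding path_len_def
    using integral_spike[OF negligible_finite[OF fin], of "{0..1}" "speed g (F \<circ> \<gamma>)" "speed g \<eta>"] eq_off by metis
  obtain G N where G: "open G" "negligible N"
    "continuous_on G (speed round_metric \<gamma>)"
    "\<And>t. t \<in> {0..1} - G - N \<Longrightarrow> speed g (F \<circ> \<gamma>) t = 0 \<and> speed round_metric \<gamma> t = 0"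
    "\<And>t. t \<in> {0..1} - N \<Longrightarrow> (1 - \<kappa>) * speed round_metric \<gamma> t \<le> speed g (F \<circ> \<gamma>) t
        \<and> speed g (F \<circ> \<gamma>) t \<le> (1 + \<kappa>) * speed round_metric \<gamma> t"
    by (rule speed_comparison[OF valid sub]) blast
  have "0 \<le> speed round_metric \<gamma> t \<and> speed round_metric \<gamma> t \<le> 1 / (1 - \<kappa>) * speed g (F \<circ> \<gamma>) t"
    if "t \<in> {0..1} - N" for t
    using G(5)[OF that] kappa by (simp add: speed_round field_simps)
  note I = integral_dominated[OF G(1,3,2) _ int this]
  have "speed round_metric \<gamma> integrable_on {0..1}" by (rule I(1)) (use G(4) in auto)
  then have "admissible round_metric \<gamma> p q"
    using valid sub assms hF
    by (auto simp: admissible_def \<gamma>_def pathstart_compose pathfinish_compose)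
  moreover have "path_len round_metric \<gamma> \<le> 1 / (1 - \<kappa>) * path_len g \<eta>"
    unfolding path_len_def[of round_metric] len[symmetric] by (rule I(2)) (use G(4) in auto)
  then have "(1 - \<kappa>) * path_len round_metric \<gamma> \<le> path_len g \<eta>"
    using kappa by (simp add: field_simps)
  ultimately show ?thesis by blast
qed

end

section \<open>Gromov--Hausdorff distance of almost isometric spaces\<close>

text \<open>Confined to \<open>X\<close>, whereas \<open>Metric_space\<close> wants nonnegativity
  and symmetry on the whole type: \<open>riem_dist\<close> is controlled on the sphere only.\<close>

definition metric_on :: "'a set \<Rightarrow> ('a \<Rightarrow> 'a \<Rightarrow> real) \<Rightarrow> bool" where
  "metric_on X d \<longleftrightarrow>
     (\<forall>x\<in>X. \<forall>y\<in>X. 0 \<le> d x y \<and> d x y = d y x \<and> (d x y = 0 \<longleftrightarrow> x = y)) \<and>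
     (\<forall>x\<in>X. \<forall>y\<in>X. \<forall>z\<in>X. d x z \<le> d x y + d y z)"

locale almost_isometry =
  fixes X :: "'a set" and dX :: "'a \<Rightarrow> 'a \<Rightarrow> real" and Y :: "'b set" and dY :: "'b \<Rightarrow> 'b \<Rightarrow> real"
    and h :: "'b \<Rightarrow> 'a" and \<eta> :: real
  assumes metric_X: "metric_on X dX" and metric_Y: "metric_on Y dY"
    and bij: "bij_betw h Y X" and Y_ne: "Y \<noteq> {}" and eta: "\<eta> > 0"
    and distortion: "y \<in> Y \<Longrightarrow> y' \<in> Y \<Longrightarrow> \<bar>dX (h y) (h y') - dY y y'\<bar> \<le> 2 * \<eta>"
begin

lemma hX: "y \<in> Y \<Longrightarrow> h y \<in> X"
  using bij_betwE[OF bij] by blast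

lemma X_nonneg: "x \<in> X \<Longrightarrow> x' \<in> X \<Longrightarrow> 0 \<le> dX x x'"
  and X_commute: "x \<in> X \<Longrightarrow> x' \<in> X \<Longrightarrow> dX x x' = dX x' x"
  and X_zero: "x \<in> X \<Longrightarrow> x' \<in> X \<Longrightarrow> dX x x' = 0 \<longleftrightarrow> x = x'"
  and X_triangle: "x \<in> X \<Longrightarrow> x' \<in> X \<Longrightarrow> x'' \<in> X \<Longrightarrow> dX x x'' \<le> dX x x' + dX x' x''"
  using metric_X unfolding metric_on_def by blast+

lemma Y_nonneg: "x \<in> Y \<Longrightarrow> x' \<in> Y \<Longrightarrow> 0 \<le> dY x x'"
  and Y_commute: "x \<in> Y \<Longrightarrow> x' \<in> Y \<Longrightarrow> dY x x' = dY x' x"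
  and Y_zero: "x \<in> Y \<Longrightarrow> x' \<in> Y \<Longrightarrow> dY x x' = 0 \<longleftrightarrow> x = x'"
  and Y_triangle: "x \<in> Y \<Longrightarrow> x' \<in> Y \<Longrightarrow> x'' \<in> Y \<Longrightarrow> dY x x'' \<le> dY x x' + dY x' x''"
  using metric_Y unfolding metric_on_def by blast+

text \<open>Gluing along the correspondence \<open>h\<close>: to get from \<open>x\<close> to
  \<open>y\<close>, walk to some \<open>h z\<close>, pay \<open>\<eta>\<close> for the jump to
  \<open>z\<close>, and walk on to \<open>y\<close>.\<close>

definition cross :: "'a \<Rightarrow> 'b \<Rightarrow> real" where
  "cross x y = (INF z\<in>Y. dX x (h z) + dY z y + \<eta>)"

lemma cross_le:
  assumes "x \<in> X" "y \<in> Y" "z \<in> Y"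
  shows "cross x y \<le> dX x (h z) + dY z y + \<eta>"
  unfolding cross_def
proof (rule cINF_lower)
  show "bdd_below ((\<lambda>z. dX x (h z) + dY z y + \<eta>) ` Y)"
    using assms eta X_nonneg Y_nonneg hX by (intro bdd_belowI2[of _ 0]) (force intro: add_nonneg_nonneg)
qed (use assms in simp)

lemma le_cross:
  assumes "\<And>z. z \<in> Y \<Longrightarrow> b \<le> dX x (h z) + dY z y + \<eta>"
  shows "b \<le> cross x y"
  unfolding cross_def using Y_ne assms by (intro cINF_greatest) auto

lemma cross_ge_eta: "x \<in> X \<Longrightarrow> y \<in> Y \<Longrightarrow> \<eta> \<le> cross x y"
  using X_nonneg Y_nonneg hX by (intro le_cross) (simp add: add_nonneg_nonneg)

lemma cross_h:
  assumes "y \<in> Y"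
  shows "cross (h y) y = \<eta>"
proof -
  have "dX (h y) (h y) = 0" "dY y y = 0" using assms hX X_zero Y_zero by auto
  then show ?thesis
    using cross_le[OF hX[OF assms] assms assms] cross_ge_eta[OF hX[OF assms] assms] by linarith
qed

lemma cross_triangle_X:
  assumes "x \<in> X" "x' \<in> X" "y \<in> Y"
  shows "cross x y \<le> dX x x' + cross x' y"
proof -
  have "cross x y - dX x x' \<le> cross x' y"
  proof (rule le_cross)
    fix z assume z: "z \<in> Y"
    show "cross x y - dX x x' \<le> dX x' (h z) + dY z y + \<eta>"
      using cross_le[OF assms(1,3) z] X_triangle[OF assms(1,2) hX[OF z]] by linarith
  qed
  then show ?thesis by simp
qed

lemma cross_triangle_Y:
  assumes "x \<in> X" "y \<in> Y" "y' \<in> Y"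
  shows "cross x y \<le> cross x y' + dY y' y"
proof -
  have "cross x y - dY y' y \<le> cross x y'"
  proof (rule le_cross)
    fix z assume z: "z \<in> Y"
    show "cross x y - dY y' y \<le> dX x (h z) + dY z y' + \<eta>"
      using cross_le[OF assms(1,2) z] Y_triangle[OF z assms(3,2)] by linarith
  qed
  then show ?thesis by simp
qed

text \<open>The detour through \<open>y\<close> pays for two jumps, and these
  \<open>2 \<eta>\<close> are exactly what \<open>distortion\<close> may cost when
  \<open>dX (h z) (h z')\<close> is replaced by \<open>dY z z'\<close>.\<close>

lemma X_le_cross:
  assumes "x \<in> X" "x' \<in> X" "y \<in> Y"
  shows "dX x x' \<le> cross x y + cross x' y"
proof -
  have "dX x x' - cross x' y \<le> cross x y"
  proof (rule le_cross)
    fix z assume z: "z \<in> Y"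
    have "dX x x' - (dX x (h z) + dY z y + \<eta>) \<le> cross x' y"
    proof (rule le_cross)
      fix z' assume z': "z' \<in> Y"
      have "dX x x' \<le> dX x (h z) + (dX (h z) (h z') + dX (h z') x')"
        using X_triangle[OF assms(1) hX[OF z] assms(2)] X_triangle[OF hX[OF z] hX[OF z'] assms(2)] by linarith
      moreover have "dX (h z) (h z') \<le> dY z z' + 2 * \<eta>" using distortion[OF z z'] by linarith
      moreover have "dY z z' \<le> dY z y + dY z' y"
        using Y_triangle[OF z assms(3) z'] Y_commute[OF z' assms(3)] by linarith
      ultimately show "dX x x' - (dX x (h z) + dY z y + \<eta>) \<le> dX x' (h z') + dY z' y + \<eta>"
        using X_commute[OF assms(2) hX[OF z']] by linarith
    qed
    then show "dX x x' - cross x' y \<le> dX x (h z) + dY z y + \<eta>" by linarith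
  qed
  then show ?thesis by linarith
qed

lemma Y_le_cross:
  assumes "x \<in> X" "y \<in> Y" "y' \<in> Y"
  shows "dY y y' \<le> cross x y + cross x y'"
proof -
  have "dY y y' - cross x y' \<le> cross x y"
  proof (rule le_cross)
    fix z assume z: "z \<in> Y"
    have "dY y y' - (dX x (h z) + dY z y + \<eta>) \<le> cross x y'"
    proof (rule le_cross)
      fix z' assume z': "z' \<in> Y"
      have "dY y y' \<le> dY z y + (dY z z' + dY z' y')"
        using Y_triangle[OF assms(2) z assms(3)] Y_triangle[OF z z' assms(3)] Y_commute[OF z assms(2)] by linarith
      moreover have "dY z z' \<le> dX (h z) (h z') + 2 * \<eta>" using distortion[OF z z'] by linarith
      moreover have "dX (h z) (h z') \<le> dX x (h z) + dX x (h z')"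
        using X_triangle[OF hX[OF z] assms(1) hX[OF z']] X_commute[OF assms(1) hX[OF z]] by linarith
      ultimately show "dY y y' - (dX x (h z) + dY z y + \<eta>) \<le> dX x (h z') + dY z' y' + \<eta>"
        by linarith
    qed
    then show "dY y y' - cross x y' \<le> dX x (h z) + dY z y + \<eta>" by linarith
  qed
  then show ?thesis by linarith
qed

text \<open>Zero off the carrier, so that nonnegativity and symmetry hold at all arguments.\<close>

definition glue :: "'a + 'b \<Rightarrow> 'a + 'b \<Rightarrow> real" where
  "glue a b = (if a \<in> X <+> Y \<and> b \<in> X <+> Y then
     (case a of Inl x \<Rightarrow> (case b of Inl x' \<Rightarrow> dX x x' | Inr y \<Rightarrow> cross x y)
      | Inr y \<Rightarrow> (case b of Inl x \<Rightarrow> cross x y | Inr y' \<Rightarrow> dY y y')) else 0)"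

lemma cross_pos: "x \<in> X \<Longrightarrow> y \<in> Y \<Longrightarrow> 0 < cross x y"
  using cross_ge_eta[of x y] eta by linarith

lemma Metric_space_glue: "Metric_space (X <+> Y) glue"
proof
  fix a b
  show "0 \<le> glue a b"
    unfolding glue_def using X_nonneg Y_nonneg cross_pos by (auto split: sum.split simp: less_imp_le)
  show "glue a b = glue b a"
    unfolding glue_def using X_commute Y_commute by (auto split: sum.split)
  assume "a \<in> X <+> Y" "b \<in> X <+> Y"
  then show "glue a b = 0 \<longleftrightarrow> a = b"
    unfolding glue_def using X_zero Y_zero cross_pos by (auto split: sum.split simp: less_imp_neq[symmetric])
next
  fix a b c assume abc: "a \<in> X <+> Y" "b \<in> X <+> Y" "c \<in> X <+> Y"
  show "glue a c \<le> glue a b + glue b c"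
  proof -
    have 1: "cross x' y \<le> cross x y + dX x x'" if "x \<in> X" "x' \<in> X" "y \<in> Y" for x x' y
      using cross_triangle_X[OF that(2,1,3)] X_commute[OF that(1,2)] by linarith
    have 2: "cross x y \<le> dY y y' + cross x y'" if "x \<in> X" "y \<in> Y" "y' \<in> Y" for x y y'
      using cross_triangle_Y[OF that] Y_commute[OF that(2,3)] by linarith
    show ?thesis
      using abc unfolding glue_def
      by (auto split: sum.split intro: X_triangle Y_triangle X_le_cross Y_le_cross cross_triangle_X
          cross_triangle_Y 1 2)
  qed
qed

text \<open>Each point has its partner under \<open>h\<close> at distance exactly
  \<open>\<eta>\<close>; the inequalities in \<open>hausdorff_dist\<close> are strict, so
  \<open>r\<close> has to exceed \<open>\<eta>\<close>.\<close>

lemma hausdorff_dist_glue_le: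
  assumes "\<eta> < r"
  shows "hausdorff_dist glue (Inl ` X) (Inr ` Y) \<le> r"
  unfolding hausdorff_dist_def
proof (rule cInf_lower)
  have "\<exists>y\<in>Y. glue (Inl x) (Inr y) < r" if x: "x \<in> X" for x
  proof -
    obtain y where y: "y \<in> Y" "x = h y" using x bij by (auto simp: bij_betw_def)
    then show ?thesis using cross_h assms hX by (intro bexI[of _ y]) (auto simp: glue_def)
  qed
  moreover have "\<exists>x\<in>X. glue (Inl x) (Inr y) < r" if "y \<in> Y" for y
    using that cross_h assms hX by (intro bexI[of _ "h y"]) (auto simp: glue_def)
  ultimately show "r \<in> {r. r > 0 \<and> (\<forall>a\<in>Inl ` X. \<exists>b\<in>Inr ` Y. glue a b < r) \<and> (\<forall>b\<in>Inr ` Y. \<exists>a\<in>Inl ` X. glue a b < r)}"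
    using assms eta by auto
qed (auto intro: bdd_belowI[of _ 0])

text \<open>The infimum of the empty set is some real number, so it is a lower bound for
  \<^const>\<open>hausdorff_dist\<close> on pairs of sets at infinite distance.\<close>

lemma gh_dist_le:
  assumes "\<eta> < r"
  shows "gh_dist X dX Y dY \<le> r"
proof -
  let ?S = "{hausdorff_dist d (\<phi> ` X) (\<psi> ` Y) | (Z :: ('a + 'b) set) d \<phi> \<psi>.
            Metric_space Z d \<and> isometric_embedding X dX Z d \<phi> \<and> isometric_embedding Y dY Z d \<psi>}"
  have "min 0 (Inf {}) \<le> hausdorff_dist d A B" for d :: "'a + 'b \<Rightarrow> 'a + 'b \<Rightarrow> real" and A B
  proof (cases "{r. r > 0 \<and> (\<forall>a\<in>A. \<exists>b\<in>B. d a b < r) \<and> (\<forall>b\<in>B. \<exists>a\<in>A. d a b < r)} = {}")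
    case True
    show ?thesis unfolding hausdorff_dist_def True by simp
  next
    case False
    then have "0 \<le> hausdorff_dist d A B" unfolding hausdorff_dist_def by (intro cInf_greatest) auto
    then show ?thesis by simp
  qed
  then have "bdd_below ?S" by (intro bdd_belowI[of _ "min 0 (Inf {})"]) auto
  moreover have "isometric_embedding X dX (X <+> Y) glue Inl" "isometric_embedding Y dY (X <+> Y) glue Inr"
    by (auto simp: isometric_embedding_def glue_def)
  then have "hausdorff_dist glue (Inl ` X) (Inr ` Y) \<in> ?S" using Metric_space_glue by blast
  ultimately have "gh_dist X dX Y dY \<le> hausdorff_dist glue (Inl ` X) (Inr ` Y)"
    unfolding gh_dist_def by (intro cInf_lower)
  then show ?thesis using hausdorff_dist_glue_le[OF assms] by linarith
qed

end

section \<open>Distances on rotationally symmetric spheres\<close>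

lemma admissible_const_path:
  fixes g :: "'a::euclidean_space bilinear_field"
  assumes "tangent_quadratic g" "p \<in> usphere"
  shows "admissible g (\<lambda>_. p) p p" and "path_len g (\<lambda>_. p) = 0"
proof -
  have "g p (0 *\<^sub>R 0) (0 *\<^sub>R 0) = 0\<^sup>2 * g p 0 0"
    using assms by (intro tangent_quadratic_scale) (auto simp: tangent_def)
  then have sp: "speed g (\<lambda>_. p) = (\<lambda>_. 0)" by (simp add: speed_def fun_eq_iff)
  have "valid_path (\<lambda>_. p)" using valid_path_linepath[of p p] by (simp add: linepath_def scaleR_left_distrib[symmetric])
  then show "admissible g (\<lambda>_. p) p p" "path_len g (\<lambda>_. p) = 0"
    using assms(2) sp
    by (auto simp: admissible_def path_len_def path_image_def pathstart_def pathfinish_def)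
qed

lemma metric_on_riem_dist:
  fixes g :: "'a::euclidean_space bilinear_field"
  assumes quad: "tangent_quadratic g"
    and adm: "\<And>p q. p \<in> usphere \<Longrightarrow> q \<in> usphere \<Longrightarrow> \<exists>\<gamma>. admissible g \<gamma> p q"
    and pos: "\<And>p q. p \<in> usphere \<Longrightarrow> q \<in> usphere \<Longrightarrow> p \<noteq> q \<Longrightarrow> riem_dist g p q > 0"
  shows "metric_on usphere (riem_dist g)"
proof -
  have nonneg: "riem_dist g p q \<ge> 0" if "p \<in> usphere" "q \<in> usphere" for p q
    using adm[OF that] riem_dist_nonneg[OF quad] by blast
  have "riem_dist g p p = 0" if "p \<in> usphere" for p
    using riem_dist_le[OF quad admissible_const_path(1)[OF quad that]] admissible_const_path(2)[OF quad that]
      nonneg[OF that that] by linarith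
  then have zero: "riem_dist g p q = 0 \<longleftrightarrow> p = q" if "p \<in> usphere" "q \<in> usphere" for p q
    using pos[OF that] that by (metis less_irrefl)
  have "riem_dist g p r \<le> riem_dist g p q + riem_dist g q r"
    if "p \<in> usphere" "q \<in> usphere" "r \<in> usphere" for p q r
    using adm[OF that(1,2)] adm[OF that(2,3)] riem_dist_triangle[OF quad] by blast
  then show ?thesis
    unfolding metric_on_def using nonneg zero riem_dist_commute[OF quad] by blast
qed

lemma riem_dist_round_le:
  fixes p q :: "'a::euclidean_space"
  assumes "DIM('a) \<ge> 2" "p \<in> usphere" "q \<in> usphere"
  shows "riem_dist round_metric p q \<le> 8"
proof -
  obtain \<gamma> where \<gamma>: "admissible round_metric \<gamma> p q" "path_len round_metric \<gamma> \<le> 8"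
    using great_circle_arc[OF assms] by blast
  have "riem_dist round_metric p q \<le> path_len round_metric \<gamma>"
    by (rule riem_dist_le[OF tangent_quadratic_round \<gamma>(1)])
  with \<gamma>(2) show ?thesis by linarith
qed

lemma metric_on_round:
  assumes "DIM('a::euclidean_space) \<ge> 2"
  shows "metric_on (usphere :: 'a set) (riem_dist round_metric)"
proof (rule metric_on_riem_dist[OF tangent_quadratic_round])
  fix p q :: 'a assume pq: "p \<in> usphere" "q \<in> usphere"
  then show ex: "\<exists>\<gamma>. admissible round_metric \<gamma> p q" using great_circle_arc[OF assms] by blast
  assume "p \<noteq> q"
  then have "norm (q - p) > 0" by simp
  also have "norm (q - p) \<le> riem_dist round_metric p q"
    using ex chord_le_riem_dist_round by blast
  finally show "riem_dist round_metric p q > 0" .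
qed

section \<open>Comparing the distances of \<open>g\<close> and of the round metric\<close>

context near_round_sphere
begin

lemma DIM_ge_2: "DIM((real^'n) \<times> real) \<ge> 2"
proof -
  have "CARD('n) \<ge> 1" by (simp add: Suc_leI)
  then show ?thesis by simp
qed

lemma riem_dist_near_round:
  assumes p: "p \<in> usphere" and q: "q \<in> usphere"
  shows "(1 - \<kappa>) * riem_dist round_metric p q \<le> riem_dist g (F p) (F q)"
    and "riem_dist g (F p) (F q) \<le> (1 + \<kappa>) * riem_dist round_metric p q"
proof -
  note quad = tangent_quadratic_riemannian[OF metric]
  obtain \<gamma>0 where \<gamma>0: "admissible round_metric \<gamma>0 p q"
    using great_circle_arc[OF DIM_ge_2 p q] by blast
  show "(1 - \<kappa>) * riem_dist round_metric p q \<le> riem_dist g (F p) (F q)"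
  proof (rule riem_dist_greatest[OF path_len_push(1)[OF \<gamma>0]])
    fix \<eta> assume "admissible g \<eta> (F p) (F q)"
    then obtain \<gamma> where \<gamma>: "admissible round_metric \<gamma> p q" "(1 - \<kappa>) * path_len round_metric \<gamma> \<le> path_len g \<eta>"
      using path_len_pull[OF _ p q] by blast
    have "(1 - \<kappa>) * riem_dist round_metric p q \<le> (1 - \<kappa>) * path_len round_metric \<gamma>"
      using kappa riem_dist_le[OF tangent_quadratic_round \<gamma>(1)] by (intro mult_left_mono) auto
    with \<gamma>(2) show "(1 - \<kappa>) * riem_dist round_metric p q \<le> path_len g \<eta>" by linarith
  qed
  have "riem_dist g (F p) (F q) / (1 + \<kappa>) \<le> riem_dist round_metric p q"
  proof (rule riem_dist_greatest[OF \<gamma>0])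
    fix \<gamma> assume \<gamma>: "admissible round_metric \<gamma> p q"
    have "riem_dist g (F p) (F q) \<le> (1 + \<kappa>) * path_len round_metric \<gamma>"
      using riem_dist_le[OF quad path_len_push(1)[OF \<gamma>]] path_len_push(2)[OF \<gamma>] by linarith
    then show "riem_dist g (F p) (F q) / (1 + \<kappa>) \<le> path_len round_metric \<gamma>"
      using kappa by (simp add: field_simps)
  qed
  then show "riem_dist g (F p) (F q) \<le> (1 + \<kappa>) * riem_dist round_metric p q"
    using kappa by (simp add: field_simps)
qed

lemma metric_on_g: "metric_on usphere (riem_dist g)"
proof (rule metric_on_riem_dist[OF tangent_quadratic_riemannian[OF metric]])
  fix x y :: "(real^'n) \<times> real" assume "x \<in> usphere" "y \<in> usphere"
  then have "x \<in> F ` usphere" "y \<in> F ` usphere" using F_bij by (simp_all add: bij_betw_def)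
  then obtain p q where pq: "p \<in> usphere" "q \<in> usphere" "x = F p" "y = F q" by blast
  show "\<exists>\<gamma>. admissible g \<gamma> x y"
  proof -
    obtain \<gamma> where "admissible round_metric \<gamma> p q"
      using great_circle_arc[OF DIM_ge_2 pq(1,2)] by blast
    then show ?thesis unfolding pq(3,4) by (blast intro: path_len_push(1))
  qed
  assume "x \<noteq> y"
  then have "p \<noteq> q" using pq by blast
  moreover have "0 \<le> riem_dist round_metric p q \<and> (riem_dist round_metric p q = 0 \<longleftrightarrow> p = q)"
    using metric_on_round[OF DIM_ge_2] pq(1,2) unfolding metric_on_def by blast
  ultimately have "riem_dist round_metric p q > 0" by simp
  then have "0 < (1 - \<kappa>) * riem_dist round_metric p q" using kappa by simp
  then show "riem_dist g x y > 0" using riem_dist_near_round(1)[OF pq(1,2)] pq by simp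
qed

lemma gh_dist_near_round:
  assumes "8 * \<kappa> \<le> \<delta>" "\<delta> > 0"
  shows "gh_dist (usphere :: ((real^'n) \<times> real) set) (riem_dist g)
    (usphere :: ((real^'n) \<times> real) set) (riem_dist round_metric) \<le> \<delta>"
proof -
  \<comment> \<open>The distortion is at most \<open>\<kappa>\<close> times the bound 8 on the round
    diameter, hence at most \<open>\<delta> = 2 * (\<delta> / 2)\<close>. The jump
    \<open>\<delta> / 2\<close> then lies strictly below \<open>\<delta>\<close>.\<close>
  interpret almost_isometry usphere "riem_dist g" usphere "riem_dist round_metric" F "\<delta> / 2"
  proof
    show "usphere \<noteq> ({} :: ((real^'n) \<times> real) set)" by simp
    fix p q :: "(real^'n) \<times> real" assume pq: "p \<in> usphere" "q \<in> usphere"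
    have "0 \<le> riem_dist round_metric p q"
      using metric_on_round[OF DIM_ge_2] pq unfolding metric_on_def by blast
    then have "\<kappa> * riem_dist round_metric p q \<le> \<kappa> * 8"
      using kappa riem_dist_round_le[OF DIM_ge_2 pq] by (intro mult_left_mono) auto
    then show "\<bar>riem_dist g (F p) (F q) - riem_dist round_metric p q\<bar> \<le> 2 * (\<delta> / 2)"
      using riem_dist_near_round[OF pq] assms(1) by (simp add: algebra_simps abs_le_iff)
  qed (use metric_on_g metric_on_round[OF DIM_ge_2] F_bij assms in auto)
  show ?thesis by (rule gh_dist_le) (use assms in simp)
qed

end

theorem theorem3:
  fixes \<delta> :: real
  assumes "CARD('n::finite) \<ge> 3" and "\<delta> > 0"
  shows "\<exists>\<epsilon>>0. \<forall>(g :: ((real^'n) \<times> real) bilinear_field) D f F.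
           riemannian_metric g \<and> rot_symmetric_form g D f F \<and>
           Scal_ge g (real CARD('n) * (real CARD('n) - 1) * (1 - \<epsilon>)\<^sup>2) \<and>
           Ric_nonneg g \<and>
           width g D F
             \<ge> sphere_volume (round_metric :: (real^'n) bilinear_field) * (1 - \<epsilon>) ^ (CARD('n) - 1)
           \<longrightarrow> gh_dist (usphere :: ((real^'n) \<times> real) set) (riem_dist g)
                       (usphere :: ((real^'n) \<times> real) set) (riem_dist round_metric) \<le> \<delta>"
proof -
  \<comment> \<open>At least 1 because the dimension is at least 3; hence the weight
    \<open>f ^ N\<close> vanishes at the poles.\<close>
  define N where "N = CARD('n) - 2"
  have N: "N \<ge> 1" "real N = real CARD('n) - 2" "real N + 2 = real CARD('n)"
    using assms(1) by (auto simp: N_def of_nat_diff)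
  \<comment> \<open>\<open>\<kappa>\<close> will be \<open>18 * \<tau>\<close>, and
    \<open>8 * 18 = 144\<close>. The bound \<open>1 / 100\<close> ensures
    \<open>\<kappa> < 1\<close> and \<open>\<tau> \<le> 1 / 10\<close>.\<close>
  define \<tau> where "\<tau> = min (1 / 100) (\<delta> / 144)"
  have \<tau>: "0 < \<tau>" "\<tau> \<le> 1 / 100" "144 * \<tau> \<le> \<delta>" using assms(2) by (auto simp: \<tau>_def)
  obtain c \<rho> \<eta> \<beta> where c: "1 / 2 \<le> c" "c < 1" "real N < (real N + 2) * c ^ 4"
    and par: "0 < \<rho>" "\<rho> \<le> 1 / 4" "2 ^ N * (1 - c ^ 4) / \<rho> ^ N \<le> \<eta>" "real N * \<eta> \<le> 1 / 8"
      "\<rho>\<^sup>2 + sqrt \<eta> \<le> \<beta>" "\<beta> \<le> 1 / 4" "4 * (1 - c) + 18 * sqrt \<beta> \<le> \<tau>"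
    by (rule pinching_parameters[OF N(1) \<tau>(1)]) blast
  show ?thesis
  \<comment> \<open>With this \<open>\<epsilon>\<close>, the number \<open>1 - \<epsilon>\<close> in
    the hypotheses is the \<open>c\<close> of the profile estimates; it depends on
    \<open>\<delta>\<close> and the dimension alone.\<close>
  proof (intro exI[of _ "1 - c"] conjI allI impI)
    show "1 - c > 0" using c by simp
    fix g :: "((real^'n) \<times> real) bilinear_field" and D f F
    assume hyp: "riemannian_metric g \<and> rot_symmetric_form g D f F \<and>
           Scal_ge g (real CARD('n) * (real CARD('n) - 1) * (1 - (1 - c))\<^sup>2) \<and>
           Ric_nonneg g \<and>
           width g D F
             \<ge> sphere_volume (round_metric :: (real^'n) bilinear_field) * (1 - (1 - c)) ^ (CARD('n) - 1)"
    then obtain d :: "nat \<Rightarrow> real \<Rightarrow> real" where d: "\<forall>s\<in>{0..D}. d 0 s = f s"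
      "\<forall>k. \<forall>s\<in>{0..D}. (d k has_real_derivative d (Suc k) s) (at s within {0..D})"
      "d 1 0 = 1" "d 1 D = -1"
      unfolding rot_symmetric_form_def warping_function_def by blast
    interpret warped_sphere g D f F d
      using hyp d by unfold_locales auto
    have curv: "d 2 s \<le> 0"
      "real N * (1 - (d 1 s)\<^sup>2) - 2 * f s * d 2 s \<ge> (real N + 2) * c\<^sup>2 * (f s)\<^sup>2" if "s \<in> {0<..<D}" for s
      unfolding N(3) unfolding N(2)
      using curvature_inequalities[OF _ that, of c] hyp assms(1) by auto
    have wide: "\<exists>s\<in>{0..D}. c \<le> f s"
      using width_imp_wide_slice[of c] hyp assms(1) c(1) by simp
    note near = profile_near_sine[OF curv wide N(1) c(1) less_imp_le[OF c(2)] c(3) par]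
    have Dpi: "\<bar>D - pi\<bar> \<le> 2 * \<tau>" using near(1) \<tau> by simp
    have "\<bar>D / pi - 1\<bar> = \<bar>D - pi\<bar> / pi" by (simp add: field_simps abs_divide)
    also have "\<dots> \<le> 2 * \<tau> / 2" using Dpi pi_ge_two by (intro frac_le) auto
    finally have len: "\<bar>D / pi - 1\<bar> \<le> 18 * \<tau>" using \<tau> by simp
    interpret near_round_sphere g D f F d "18 * \<tau>"
      using len near(2) \<tau> by unfold_locales auto
    show "gh_dist (usphere :: ((real^'n) \<times> real) set) (riem_dist g)
                       (usphere :: ((real^'n) \<times> real) set) (riem_dist round_metric) \<le> \<delta>"
      by (rule gh_dist_near_round) (use \<tau> assms in auto)
  qed
qed

end
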